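(* Assume the Riemann hypothesis. There is an absolute constant $c_0>0$ such that for every fixed $0<\varepsilon<c_0$ and every fixed $c'<\sqrt{2\pi}$ there is a constant $K=K(\varepsilon,c')$ such that for all sufficiently large $X$ (in terms of $\varepsilon$ and $c'$), $$\mu\left(\left\{0<x\le X \ : \ |\psi(x)-x|\ge \varepsilon X^{1/2}(\log X)^2\right\}\right)\le K\,X^{1-c'\varepsilon^{1/2}}.$$
   Context: $\psi(x)=\sum_{n\le x}\Lambda(n)$ is the Chebyshev function, where $\Lambda$ is the von Mangoldt function, and $\mu$ denotes Lebesgue measure on $\mathbb{R}$. The Riemann hypothesis (every non-trivial zero of the Riemann zeta function has real part $1/2$) is a standing assumption. *)

theory Defs
  imports "HOL-Complex_Analysis.Complex_Analysis" "HOL-Number_Theory.Prime_Powers" "HOL-Real_Asymp.Real_Asymp"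
begin

definition chebyshev_psi :: "real \<Rightarrow> real" where
  "chebyshev_psi x = (\<Sum>n | 1 \<le> n \<and> real n \<le> x. mangoldt n)"

(*
  The Riemann zeta function as the analytic continuation of its Dirichlet series.
  The value at the pole s = 1 is a dummy value, fixed to 0 only to make the function unique;
  riemann_zeta_unique below shows that the description is well-defined.
*)
definition is_riemann_zeta :: "(complex \<Rightarrow> complex) \<Rightarrow> bool" where
  "is_riemann_zeta f \<longleftrightarrow>
     f holomorphic_on (- {1}) \<and>
     (\<forall>s. Re s > 1 \<longrightarrow> (\<lambda>n. 1 / of_nat (Suc n) powr s) sums f s) \<and>
     f 1 = 0"

definition riemann_zeta :: "complex \<Rightarrow> complex" where
  "riemann_zeta = (THE f. is_riemann_zeta f)"

(* The point s = 1 is excluded because riemann_zeta 1 = 0 is only a convention. *)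
definition nontrivial_zeta_zeros :: "complex set" where
  "nontrivial_zeta_zeros =
     {s. s \<noteq> 1 \<and> riemann_zeta s = 0 \<and> (\<forall>k::nat. s \<noteq> - 2 * of_nat (Suc k))}"

definition riemann_hypothesis :: bool where
  "riemann_hypothesis \<longleftrightarrow> (\<forall>s \<in> nontrivial_zeta_zeros. Re s = 1 / 2)"

(*
  Well-definedness.  Put C(s,j) = zeta_coeff j s / j!, the binomial coefficient of -s over j.
  Summing the Taylor expansion (n+1)^(-s) = (SUM j<=K. C(s,j) n^(-s-j)) + zeta_rem K n s
  over n >= 1 expresses s zeta(s+1) through the zeta(s+j), 2 <= j <= K, and a series that
  is holomorphic for Re s > -K.  This continues (s-1) zeta(s) strip by strip.
*)
definition zeta_coeff :: "nat \<Rightarrow> complex \<Rightarrow> complex" where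
  "zeta_coeff j s = (\<Prod>l<j. (- s - of_nat l))"

definition zeta_rem :: "nat \<Rightarrow> complex \<Rightarrow> complex \<Rightarrow> complex" where
  "zeta_rem k N s = (N + 1) powr (- s) - (\<Sum>j\<le>k. zeta_coeff j s * N powr (- s - of_nat j) / fact j)"

lemma zeta_coeff_0 [simp]: "zeta_coeff 0 s = 1" by (simp add: zeta_coeff_def)
lemma zeta_coeff_Suc: "zeta_coeff (Suc j) s = zeta_coeff j s * (- s - of_nat j)" by (simp add: zeta_coeff_def)
lemma holo_zeta_coeff [holomorphic_intros]: "zeta_coeff j holomorphic_on A"
  unfolding zeta_coeff_def by (intro holomorphic_intros)

lemma zeta_rem_bound:
  assumes "Re s + of_nat k + 1 \<ge> 0"
  shows "norm (zeta_rem k (of_nat (Suc n)) s) \<le> norm (zeta_coeff (Suc k) s) * real (Suc n) powr (- Re s - k - 1) / fact k"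
proof -
  define N where "N = real (Suc n)"
  have N: "N \<ge> 1" by (simp add: N_def)
  define S where "S = closed_segment (of_real N) (of_real (N + 1) :: complex)"
  have S: "\<exists>t. z = of_real t \<and> t \<ge> N" if "z \<in> S" for z
  proof -
    from that obtain u where u: "u \<ge> 0" "z = of_real (N + u)"
      unfolding S_def closed_segment_def by (auto simp: algebra_simps scaleR_conv_of_real)
    thus ?thesis by (intro exI[of _ "N + u"]) auto
  qed
  define f where "f = (\<lambda>i z. zeta_coeff i s * z powr (- s - of_nat i))"
  have "norm (f 0 (of_real (N+1)) - (\<Sum>i\<le>k. f i (of_real N) * (of_real (N+1) - of_real N) ^ i / fact i))
     \<le> (norm (zeta_coeff (Suc k) s) * N powr (- Re s - k - 1)) * norm (of_real (N+1) - of_real N :: complex) ^ Suc k / fact k"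
  proof (rule complex_Taylor[of S])
    show "convex S" "of_real N \<in> S" "of_real (N + 1) \<in> S" by (auto simp: S_def)
    show "(f i has_field_derivative f (Suc i) z) (at z within S)" if "z \<in> S" "i \<le> k" for i z
    proof -
      from S[OF that(1)] N obtain t where t: "z = of_real t" "t \<ge> 1" by force
      hence "z \<notin> \<real>\<^sub>\<le>\<^sub>0" by (auto simp: complex_nonpos_Reals_iff)
      thus ?thesis unfolding f_def
        by (auto intro!: derivative_eq_intros simp: zeta_coeff_Suc algebra_simps)
    qed
    show "norm (f (Suc k) z) \<le> norm (zeta_coeff (Suc k) s) * N powr (- Re s - k - 1)" if "z \<in> S" for z
    proof -
      from S[OF that(1)] N obtain t where t: "z = of_real t" "t \<ge> N" by force
      have "t powr (- Re s - k - 1) \<le> N powr (- Re s - k - 1)"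
        using N t assms by (intro powr_mono2') auto
      thus ?thesis using t N
        by (auto simp: f_def norm_mult norm_powr_real_powr algebra_simps intro!: mult_left_mono)
    qed
  qed
  thus ?thesis by (simp add: f_def zeta_rem_def N_def add_ac)
qed
lemma halfplane_series:
  fixes f :: "nat \<Rightarrow> complex \<Rightarrow> complex"
  assumes holo: "\<And>n. f n holomorphic_on {s. Re s > a}"
    and cont: "continuous_on UNIV C"
    and bound: "\<And>n s. Re s > a \<Longrightarrow> norm (f n s) \<le> C s * real (Suc n) powr (a - Re s - 1)"
  shows "\<exists>g. g holomorphic_on {s. Re s > a} \<and> (\<forall>s. Re s > a \<longrightarrow> (\<lambda>n. f n s) sums g s)"
proof -
  define S where "S = {s. Re s > a}"
  have S: "open S" unfolding S_def by (rule open_halfspace_Re_gt)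
  have dom: "\<exists>d h. 0 < (d::real) \<and> summable (h :: nat \<Rightarrow> complex) \<and> range h \<subseteq> \<real>\<^sub>\<ge>\<^sub>0 \<and>
          (\<forall>\<^sub>F n in sequentially. \<forall>y\<in>ball x d \<inter> S. cmod (f n y) \<le> cmod (h n))" if "x \<in> S" for x
  proof -
    define d where "d = (Re x - a) / 2"
    have d: "d > 0" using that by (simp add: d_def S_def)
    have "compact (C ` cball x d)"
      by (intro compact_continuous_image continuous_on_subset[OF cont]) auto
    then obtain B where B: "\<And>y. y \<in> cball x d \<Longrightarrow> norm (C y) \<le> B"
      by (meson compact_imp_bounded bounded_iff imageI)
    have B0: "B \<ge> 0" using B[of x] d norm_ge_zero order_trans by fastforce
    define h where "h = (\<lambda>n. complex_of_real (B * real (Suc n) powr (- d - 1)))"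
    have "summable (\<lambda>n. real n powr (- d - 1))"
      using d by (subst summable_real_powr_iff) auto
    hence "summable (\<lambda>n. real (Suc n) powr (- d - 1))"
      by (subst summable_Suc_iff)
    hence "summable h" unfolding h_def
      by (intro summable_of_real summable_mult)
    moreover have "range h \<subseteq> \<real>\<^sub>\<ge>\<^sub>0" using B0 by (auto simp: h_def complex_nonneg_Reals_iff)
    moreover have "cmod (f n y) \<le> cmod (h n)" if y: "y \<in> ball x d \<inter> S" for n y
    proof -
      have "\<bar>Re x - Re y\<bar> < d"
        using y abs_Re_le_cmod[of "x - y"] by (auto simp: dist_norm)
      moreover have "2 * d = Re x - a" by (simp add: d_def)
    ultimately have re: "a - Re y - 1 \<le> - d - 1" by (simp add: abs_less_iff)
      have "cmod (f n y) \<le> C y * real (Suc n) powr (a - Re y - 1)"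
        using y by (intro bound) (auto simp: S_def)
      also have "\<dots> \<le> B * real (Suc n) powr (- d - 1)"
        using B[of y] y B0 re by (intro mult_mono powr_mono) auto
      finally show ?thesis using B0 by (simp add: h_def norm_mult)
    qed
    ultimately show ?thesis using d
      by (intro exI[of _ d] exI[of _ h] conjI always_eventually allI ballI) auto
  qed
  have diff: "f n field_differentiable (at x)" if "x \<in> S" for n x
    using holo[of n] S that by (auto simp: S_def intro: holomorphic_on_imp_differentiable_at)
  obtain g where g: "\<forall>x\<in>S. ((\<lambda>n. f n x) sums g x) \<and> g field_differentiable (at x)"
    by (rule series_differentiable_comparison_complex[OF S diff dom])
  hence "g holomorphic_on S"
    using S by (simp add: holomorphic_on_def field_differentiable_at_within)
  with g show ?thesis by (auto simp: S_def)
qed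

lemma zeta_rem_series:
  "\<exists>g. g holomorphic_on {s. Re s > - real k} \<and>
       (\<forall>s. Re s > - real k \<longrightarrow> (\<lambda>n. zeta_rem k (of_nat (Suc n)) s) sums g s)"
proof (rule halfplane_series)
  show "(\<lambda>s. zeta_rem k (of_nat (Suc n)) s) holomorphic_on {s. - real k < Re s}" for n
    unfolding zeta_rem_def by (intro holomorphic_intros) (auto simp: add_eq_0_iff simp flip: of_nat_Suc)
  show "continuous_on UNIV (\<lambda>s. norm (zeta_coeff (Suc k) s) / fact k)"
    by (intro continuous_intros holomorphic_on_imp_continuous_on holo_zeta_coeff) auto
  show "norm (zeta_rem k (of_nat (Suc n)) s) \<le> norm (zeta_coeff (Suc k) s) / fact k * real (Suc n) powr (- real k - Re s - 1)"
    if "Re s > - real k" for n s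
  proof -
    have e: "- Re s - real k - 1 = - real k - Re s - 1" by simp
    show ?thesis using zeta_rem_bound[of s k n, unfolded e] that by simp
  qed
qed

lemma zeta_series:
  "\<exists>g. g holomorphic_on {s. Re s > 1} \<and>
       (\<forall>s. Re s > 1 \<longrightarrow> (\<lambda>n. 1 / of_nat (Suc n) powr s) sums g s)"
proof (rule halfplane_series)
  show "(\<lambda>s. 1 / of_nat (Suc n) powr s) holomorphic_on {s. 1 < Re s}" for n
    by (intro holomorphic_intros) (auto simp flip: of_nat_Suc)
  show "continuous_on UNIV (\<lambda>s. 1)" by simp
  show "norm (1 / of_nat (Suc n) powr s) \<le> 1 * real (Suc n) powr (1 - Re s - 1)" for n s
    using norm_powr_real_powr[of "of_nat (Suc n)" s]
    by (simp add: norm_divide powr_minus field_simps del: of_nat_Suc)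
qed

definition zeta_dirichlet where "zeta_dirichlet = (\<lambda>s::complex. \<Sum>n. 1 / of_nat (Suc n) powr s :: complex)"

lemma holo_zeta_dirichlet: "zeta_dirichlet holomorphic_on {s. Re s > 1}"
  and zeta_dirichlet_sums: "Re s > 1 \<Longrightarrow> (\<lambda>n. 1 / of_nat (Suc n) powr s) sums zeta_dirichlet s"
proof -
  from zeta_series obtain g where g: "g holomorphic_on {s. Re s > 1}"
     "\<And>s. Re s > 1 \<Longrightarrow> (\<lambda>n. 1 / of_nat (Suc n) powr s) sums g s" by blast
  have eq: "zeta_dirichlet s = g s" if "Re s > 1" for s using g(2)[OF that] by (simp add: zeta_dirichlet_def sums_iff)
  show "zeta_dirichlet holomorphic_on {s. Re s > 1}" using g(1) by (rule holomorphic_transform) (auto simp: eq)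
  show "Re s > 1 \<Longrightarrow> (\<lambda>n. 1 / of_nat (Suc n) powr s) sums zeta_dirichlet s" using g(2) eq by simp
qed

lemma zeta_recurrence:
  assumes s: "Re s > 0" and K: "K > 0"
    and g: "(\<lambda>n. zeta_rem K (of_nat (Suc n)) s) sums g"
  shows "s * zeta_dirichlet (s + 1) = 1 + (\<Sum>j=2..K. zeta_coeff j s / fact j * zeta_dirichlet (s + of_nat j)) + g"
proof -
  have "(\<lambda>n. of_nat (Suc n) powr (-s)) \<longlonglongrightarrow> (0::complex)"
  proof (rule tendsto_norm_zero_cancel)
    have "(\<lambda>n. real (Suc n) powr (- Re s)) \<longlonglongrightarrow> 0"
      using s by real_asymp
    thus "(\<lambda>n. norm (of_nat (Suc n) powr (-s) :: complex)) \<longlonglongrightarrow> 0"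
      using norm_powr_real_powr[of "of_nat (Suc n)" "-s" for n] by (simp del: of_nat_Suc)
  qed
  from telescope_sums[OF this]
  have t: "(\<lambda>n. (of_nat (Suc n) + 1) powr (-s) - of_nat (Suc n) powr (-s)) sums (- 1 :: complex)"
    by (simp add: add_ac)
  have "(\<lambda>n. zeta_coeff j s / fact j * (1 / of_nat (Suc n) powr (s + of_nat j))) sums (zeta_coeff j s / fact j * zeta_dirichlet (s + of_nat j))"
    if "j \<in> {1..K}" for j
    using that s by (intro sums_mult zeta_dirichlet_sums) auto
  hence 1: "(\<lambda>n. \<Sum>j=1..K. zeta_coeff j s / fact j * (1 / of_nat (Suc n) powr (s + of_nat j)))
          sums (\<Sum>j=1..K. zeta_coeff j s / fact j * zeta_dirichlet (s + of_nat j))"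
    by (rule sums_sum)
  have eq: "zeta_rem K (of_nat (Suc n)) s + (\<Sum>j=1..K. zeta_coeff j s / fact j * (1 / of_nat (Suc n) powr (s + of_nat j)))
     = (of_nat (Suc n) + 1) powr (-s) - of_nat (Suc n) powr (-s)" for n
  proof -
    have p: "1 / of_nat (Suc n) powr (s + of_nat j) = (of_nat (Suc n) powr (- s - of_nat j) :: complex)" for j
      by (metis powr_minus inverse_eq_divide minus_add_distrib uminus_add_conv_diff diff_conv_add_uminus)
    have "{..K} = insert 0 {1..K}" by auto
    thus ?thesis unfolding p zeta_rem_def by simp
  qed
  have "(- 1) = g + (\<Sum>j=1..K. zeta_coeff j s / fact j * zeta_dirichlet (s + of_nat j))"
    using sums_unique2[OF t] sums_add[OF g 1] unfolding eq by blast
  also have "{1..K} = insert 1 {2..K}" using K by auto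
  finally show ?thesis by (simp add: zeta_coeff_Suc algebra_simps add_eq_0_iff2)
qed

lemma zeta_ext_step:
  "\<exists>F. F holomorphic_on {s. Re s > 1 - real k} \<and> (\<forall>s. Re s > 1 \<longrightarrow> F s = (s - 1) * zeta_dirichlet s)"
proof (induction k)
  case 0
  show ?case by (intro exI[of _ "\<lambda>s. (s - 1) * zeta_dirichlet s"]) (auto intro!: holomorphic_intros holo_zeta_dirichlet)
next
  case (Suc k)
  then obtain F where F: "F holomorphic_on {s. Re s > 1 - real k}"
    "\<And>s. Re s > 1 \<Longrightarrow> F s = (s - 1) * zeta_dirichlet s" by blast
  define K where "K = Suc k"
  from zeta_rem_series[of K] obtain g where g: "g holomorphic_on {s. Re s > - real K}"
    "\<And>s. Re s > - real K \<Longrightarrow> (\<lambda>n. zeta_rem K (of_nat (Suc n)) s) sums g s" by blast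
  define G where "G = (\<lambda>w. 1 - (\<Sum>j=2..K. zeta_coeff (j - 1) (w - 1) / fact j * F (w - 1 + of_nat j)) + g (w - 1))"
  have "(\<lambda>w. g (w - 1)) holomorphic_on {s. Re s > 1 - real (Suc k)}"
    by (rule holomorphic_on_compose_gen[OF _ g(1), of "\<lambda>w. w - 1", unfolded o_def])
       (auto simp: K_def intro!: holomorphic_intros)
  moreover have "(\<lambda>w. F (w - 1 + of_nat j)) holomorphic_on {s. Re s > 1 - real (Suc k)}"
    if "j \<in> {2..K}" for j
    by (rule holomorphic_on_compose_gen[OF _ F(1), of "\<lambda>w. w - 1 + of_nat j", unfolded o_def])
       (use that in \<open>auto simp: K_def intro!: holomorphic_intros\<close>)
  moreover have "(\<lambda>w. zeta_coeff (j - 1) (w - 1)) holomorphic_on A" for j A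
    unfolding zeta_coeff_def by (intro holomorphic_intros)
  ultimately have "G holomorphic_on {s. Re s > 1 - real (Suc k)}"
    unfolding G_def by (intro holomorphic_intros) auto
  moreover have "G w = (w - 1) * zeta_dirichlet w" if w: "Re w > 1" for w
  proof -
    define s where "s = w - 1"
    have s: "Re s > 0" using w by (simp add: s_def)
    have "s * zeta_dirichlet (s + 1) = 1 + (\<Sum>j=2..K. zeta_coeff j s / fact j * zeta_dirichlet (s + of_nat j)) + g s"
      using s by (intro zeta_recurrence g) (auto simp: K_def)
    also have "(\<Sum>j=2..K. zeta_coeff j s / fact j * zeta_dirichlet (s + of_nat j)) =
       (\<Sum>j=2..K. - (zeta_coeff (j - 1) s / fact j * F (s + of_nat j)))"
    proof (rule sum.cong)
      fix j assume j: "j \<in> {2..K}"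
      then obtain i where i: "j = Suc i" by (cases j) auto
      have "F (s + of_nat j) = (s + of_nat j - 1) * zeta_dirichlet (s + of_nat j)"
        using j s by (intro F) auto
      thus "zeta_coeff j s / fact j * zeta_dirichlet (s + of_nat j) = - (zeta_coeff (j - 1) s / fact j * F (s + of_nat j))"
        using i by (simp add: zeta_coeff_Suc field_simps del: fact_Suc)
    qed simp
    finally show ?thesis by (simp add: G_def s_def sum_negf)
  qed
  ultimately show ?case by blast
qed

lemma zeta_ext: "\<exists>F. F holomorphic_on UNIV \<and> (\<forall>s. Re s > 1 \<longrightarrow> F s = (s - 1) * zeta_dirichlet s)"
proof -
  from zeta_ext_step obtain F where F:
    "\<And>k. F k holomorphic_on {s. Re s > 1 - real k}" 
    "\<And>k s. Re s > 1 \<Longrightarrow> F k s = (s - 1) * zeta_dirichlet s" by metis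
  have eq: "F j s = F k s" if "j \<le> k" "Re s > 1 - real j" for j k s
  proof (rule analytic_continuation_open[of "{s. Re s > 1}" "{s. Re s > 1 - real j}" "F j" "F k"])
    show "open {s. Re s > 1}" "open {s. Re s > 1 - real j}" by (rule open_halfspace_Re_gt)+
    show "connected {s. Re s > 1 - real j}"
      by (intro convex_connected convex_halfspace_Re_gt)
    show "{s. Re s > 1} \<noteq> {}" by (auto intro: exI[of _ 2])
    show "F k holomorphic_on {s. Re s > 1 - real j}"
      using F(1)[of k] by (rule holomorphic_on_subset) (use that in auto)
  qed (use that F in auto)
  define G where "G = (\<lambda>s. F (nat \<lceil>2 - Re s\<rceil>) s)"
  have G: "G s = F k s" if "Re s > 1 - real k" for k s
  proof -
    have "Re s > 1 - real (nat \<lceil>2 - Re s\<rceil>)" by linarith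
    thus ?thesis unfolding G_def using eq that by (metis nle_le)
  qed
  have "G holomorphic_on {s. Re s > 1 - real k}" for k
    using F(1)[of k] by (rule holomorphic_transform) (auto simp: G)
  hence "G holomorphic_on (\<Union>k. {s. Re s > 1 - real k})"
    by (intro holomorphic_on_UN_open) (auto simp: open_halfspace_Re_gt)
  also have "(\<Union>k. {s. Re s > 1 - real k}) = UNIV"
  proof (intro equalityI subsetI UN_I)
    fix s :: complex show "s \<in> {z. Re z > 1 - real (nat \<lceil>2 - Re s\<rceil>)}" by simp linarith
  qed auto
  finally show ?thesis using F(2) by (auto simp: G_def)
qed

lemma riemann_zeta_unique: "\<exists>!f. is_riemann_zeta f"
proof (rule ex_ex1I)
  from zeta_ext obtain F where F: "F holomorphic_on UNIV" "\<And>s. Re s > 1 \<Longrightarrow> F s = (s - 1) * zeta_dirichlet s"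
    by (elim exE conjE) auto
  have "(\<lambda>s. F s / (s - 1)) holomorphic_on (- {1})"
    by (intro holomorphic_on_divide holomorphic_on_subset[OF F(1)] holomorphic_on_diff
              holomorphic_on_ident holomorphic_on_const) auto
  moreover have "F s / (s - 1) = zeta_dirichlet s" if "Re s > 1" for s
    using F(2)[OF that] that by auto
  ultimately show "\<exists>f. is_riemann_zeta f"
    unfolding is_riemann_zeta_def using zeta_dirichlet_sums by (intro exI[of _ "\<lambda>s. F s / (s - 1)"]) auto
next
  fix f g assume f: "is_riemann_zeta f" and g: "is_riemann_zeta g"
  have "f s = g s" if "s \<noteq> 1" for s
  proof (rule analytic_continuation_open[of "{s. Re s > 1}" "- {1}" f g])
    show "open {s. Re s > 1}" by (rule open_halfspace_Re_gt)
    show "{s. Re s > 1} \<noteq> {}" by (auto intro: exI[of _ 2])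
    show "connected (- {1::complex})"
      by (rule connected_punctured_universe) simp
    show "f z = g z" if "z \<in> {s. Re s > 1}" for z
      using f g that sums_unique2 unfolding is_riemann_zeta_def by blast
  qed (use f g that in \<open>auto simp: is_riemann_zeta_def\<close>)
  moreover have "f 1 = g 1" using f g by (simp add: is_riemann_zeta_def)
  ultimately show "f = g" by (metis ext)
qed

lemma is_riemann_zeta_riemann_zeta: "is_riemann_zeta riemann_zeta"
  unfolding riemann_zeta_def by (rule theI'[OF riemann_zeta_unique])

end

theory Submission
  imports Defs
begin

text \<open>
  Put \<open>F(s) = (s - 1) \<zeta>(s)\<close>, an entire function. By the explicit formula, \<open>\<psi>(x) - x\<close> is up to a small
  error minus the sum of \<open>x\<^sup>\<rho> / \<rho>\<close> over the zeros \<open>\<rho>\<close> of height below about \<open>X\<^sup>1\<^sup>0\<close>, as long as \<open>x\<close> is not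
  extremely close to an integer. Choose \<open>\<delta>\<close> with \<open>c' \<surd>\<epsilon> < \<delta> < \<surd>(2 \<pi> \<epsilon>)\<close> and split the zeros at height \<open>X\<^sup>\<delta>\<close>.
  The sum of \<open>1 / |\<rho>|\<close> over \<open>|\<rho>| < T\<close> is at most \<open>(ln T)\<^sup>2 / (2 \<pi>) + O(ln T)\<close>, so under the Riemann
  hypothesis the low zeros contribute at most \<open>(\<delta>\<^sup>2 / (2 \<pi>) + o(1)) \<surd>X (ln X)\<^sup>2\<close>, which is smaller than
  \<open>\<epsilon> \<surd>X (ln X)\<^sup>2\<close>. The mean square over \<open>x \<le> X\<close> of the high zeros is \<open>X\<^sup>2\<^sup>-\<^sup>\<delta>\<close> up to powers of
  \<open>ln X\<close>, and Chebyshev's inequality bounds the measure of the set where they exceed \<open>\<surd>X\<close>.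

  The sharp constant \<open>1 / (2 \<pi>)\<close> comes from Jensen's formula and needs no functional equation: the
  recurrence that continues \<open>\<zeta>\<close> to the left already shows that \<open>ln |F(s)|\<close> is at most
  \<open>max 0 (- Re s) ln |s| + O(|s|)\<close>.
\<close>

section \<open>Zeros of entire functions in a disc\<close>

text \<open>Working with the pole-free F keeps every estimate on one entire function: -zeta'/zeta is
  1/(s - 1) - F'/F. The number sqrt(2 pi) has a single source. The low zeros are estimated by the
  triangle inequality alone, so the split exponent \<delta> can grow only until \<delta>^2 / (2 pi)
  reaches \<epsilon>, and the measure saved is X^(-\<delta>). Jensen's formula yields this constant
  because the negative part of the cosine has mean 1/pi over a circle; the trivial zeros are counted
  as well, but they add only O(R) to the logarithmic sum. The truncation height near X^10 and the
  excluded radius X^(-4) around integers are generous, so polynomial losses in Perron's formula do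
  no harm. The height still has to keep away from all zeros, and one height must serve every x <= X,
  since the mean square integrates over x with the set of zeros fixed. The restriction on \<epsilon>
  keeps the saved exponent below 1: leaving out 0 < x <= 1 already costs measure 1.\<close>

lemma entire_factor:
  fixes f :: "complex \<Rightarrow> complex"
  assumes f: "f holomorphic_on UNIV" "f a \<noteq> 0" and Z: "finite Z" "\<And>z. z \<in> Z \<Longrightarrow> f z = 0"
  obtains g where "g holomorphic_on UNIV" "\<And>s. f s = g s * (\<Prod>z\<in>Z. (s - z) ^ nat (zorder f z))"
    "\<And>s. g s = 0 \<longleftrightarrow> f s = 0 \<and> s \<notin> Z"
proof -
  define P where "P = (\<lambda>W s. \<Prod>z\<in>W. (s - z) ^ nat (zorder f z))"
  have P_holo [holomorphic_intros]: "P W holomorphic_on A" for W A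
    unfolding P_def by (intro holomorphic_intros)
  have P0: "P W s \<noteq> 0" if "finite W" "s \<notin> W" for W s
    using that by (auto simp: P_def)
  \<comment> \<open>At a point of \<open>Z\<close> the quotient is filled in by the local cofactor
    \<open>zor_poly\<close>; since \<open>f a \<noteq> 0\<close> excludes f = 0, these cofactors
    exist and do not vanish.\<close>
  define g where "g = (\<lambda>s. if s \<in> Z then zor_poly f s s / P (Z - {s}) s else f s / P Z s)"
  have ex: "\<exists>r>0. zor_poly f z holomorphic_on cball z r \<and>
      (\<forall>w\<in>cball z r. f w = zor_poly f z w * (w - z) ^ nat (zorder f z) \<and> zor_poly f z w \<noteq> 0)"
    and zpos: "zorder f z > 0" if "z \<in> Z" for z
    using zorder_exist_zero[of f UNIV z] f Z(2)[OF that] by auto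
  have eqz: "g w = zor_poly f z w / P (Z - {z}) w"
    if z: "z \<in> Z" and w: "w = z \<or> (w \<notin> Z \<and> f w = zor_poly f z w * (w - z) ^ nat (zorder f z))" for z w
  proof (cases "w = z")
    case True thus ?thesis using z by (simp add: g_def)
  next
    case False
    have "P Z w = (w - z) ^ nat (zorder f z) * P (Z - {z}) w"
      unfolding P_def by (rule prod.remove) (use z Z in auto)
    thus ?thesis using False w by (simp add: g_def)
  qed
  have "g field_differentiable (at x)" for x
  proof (cases "x \<in> Z")
    case True
    from ex[OF this] obtain r where r: "r > 0" "zor_poly f x holomorphic_on cball x r"
      "\<And>w. w \<in> cball x r \<Longrightarrow> f w = zor_poly f x w * (w - x) ^ nat (zorder f x)" by blast
    define U where "U = ball x r - (Z - {x})"
    have U: "open U" "x \<in> U" using r Z by (auto simp: U_def intro!: open_Diff finite_imp_closed)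
    have "(\<lambda>w. zor_poly f x w / P (Z - {x}) w) holomorphic_on U"
      by (intro holomorphic_intros holomorphic_on_subset[OF r(2)] P0) (use Z in \<open>auto simp: U_def\<close>)
    moreover have "zor_poly f x w / P (Z - {x}) w = g w" if "w \<in> U" for w
      using eqz[OF True, of w] r(3)[of w] that by (auto simp: U_def)
    ultimately have "g holomorphic_on U" by (rule holomorphic_transform)
    thus ?thesis using U holomorphic_on_imp_differentiable_at by blast
  next
    case False
    define U where "U = - Z"
    have U: "open U" "x \<in> U" using False Z by (auto simp: U_def intro!: open_Compl finite_imp_closed)
    have "(\<lambda>w. f w / P Z w) holomorphic_on U"
      by (intro holomorphic_intros holomorphic_on_subset[OF f(1)] P0) (use Z in \<open>auto simp: U_def\<close>)
    hence "g holomorphic_on U" by (rule holomorphic_transform) (auto simp: U_def g_def)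
    thus ?thesis using U holomorphic_on_imp_differentiable_at by blast
  qed
  hence "g holomorphic_on UNIV" by (auto simp: holomorphic_on_def field_differentiable_at_within)
  moreover have "f s = g s * (\<Prod>z\<in>Z. (s - z) ^ nat (zorder f z))" for s
  proof (cases "s \<in> Z")
    case True
    hence "P Z s = 0" using zpos[OF True] Z(1) by (auto simp: P_def)
    thus ?thesis using Z(2)[OF True] by (simp add: P_def)
  next
    case False
    thus ?thesis using P0[OF Z(1) False] by (simp add: g_def P_def)
  qed
  moreover have "g s = 0 \<longleftrightarrow> f s = 0 \<and> s \<notin> Z" for s
  proof (cases "s \<in> Z")
    case True
    from ex[OF this] have "zor_poly f s s \<noteq> 0" by (auto dest: bspec[of _ _ s])
    thus ?thesis using True P0[of "Z - {s}" s] Z by (simp add: g_def)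
  qed (use P0[OF Z(1)] in \<open>auto simp: g_def\<close>)
  ultimately show ?thesis using that by blast
qed

text \<open>Reflecting a zero in the circle keeps the modulus on the circle and removes the zero from the disc.\<close>

lemma blaschke_reflection:
  fixes f :: "complex \<Rightarrow> complex"
  assumes f: "f holomorphic_on UNIV" "f a \<noteq> 0" and R: "R > 0"
    and Z: "finite Z" "\<forall>z\<in>Z. f z = 0" "Z \<subseteq> ball a R"
  shows "\<exists>h. h holomorphic_on UNIV \<and>
    (\<forall>s\<in>sphere a R. norm (h s) = norm (f s)) \<and>
    (\<forall>s\<in>cball a R. h s = 0 \<longleftrightarrow> f s = 0 \<and> s \<notin> Z) \<and>
    norm (h a) = norm (f a) * (\<Prod>z\<in>Z. (R / norm (z - a)) ^ nat (zorder f z)) \<and>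
    (\<forall>s\<in>cball a R. f s \<noteq> 0 \<longrightarrow> deriv f s / f s = deriv h s / h s +
        (\<Sum>z\<in>Z. of_nat (nat (zorder f z)) * (1 / (s - z) + cnj (z - a) / (of_real (R\<^sup>2) - cnj (z - a) * (s - a)))))"
proof -
  obtain g where g: "g holomorphic_on UNIV" "\<And>s. f s = g s * (\<Prod>z\<in>Z. (s - z) ^ nat (zorder f z))"
    "\<And>s. g s = 0 \<longleftrightarrow> f s = 0 \<and> s \<notin> Z"
    using entire_factor[OF f Z(1), of thesis] Z(2) by blast
  \<comment> \<open>\<open>b z\<close> is the Blaschke partner of s - z: its zero is the mirror
    image of z in the circle, |b z s| = |s - z| holds on the circle, and |b z a| = R.\<close>
  define b where "b = (\<lambda>z s. (of_real (R\<^sup>2) - cnj (z - a) * (s - a)) / of_real R)"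
  define m where "m = (\<lambda>z. nat (zorder f z))"
  define h where "h = (\<lambda>s. g s * (\<Prod>z\<in>Z. b z s ^ m z))"
  have b_holo: "b z holomorphic_on A" for z A unfolding b_def using R by (intro holomorphic_intros) auto
  have h_holo: "h holomorphic_on UNIV" unfolding h_def by (intro holomorphic_intros g b_holo)
  have b0: "b z s \<noteq> 0" if "z \<in> Z" "s \<in> cball a R" for z s
  proof
    assume "b z s = 0"
    hence "cnj (z - a) * (s - a) = of_real (R\<^sup>2)" using R by (simp add: b_def)
    hence "norm (cnj (z - a) * (s - a)) = R\<^sup>2" by (simp only: norm_of_real) simp
    hence "norm (z - a) * norm (s - a) = R\<^sup>2" by (simp only: norm_mult complex_mod_cnj)
    moreover have "norm (z - a) < R" "norm (s - a) \<le> R"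
      using that Z(3) by (auto simp: dist_norm norm_minus_commute)
    ultimately show False using R
      by (smt (verit) mult_left_mono mult_right_mono mult_less_cancel_right norm_ge_zero power2_eq_square)
  qed
  have bs: "norm (b z s) = norm (s - z)" if "s \<in> sphere a R" for z s
  proof -
    have 1: "(s - a) * cnj (s - a) = of_real (R\<^sup>2)"
      using that by (subst complex_norm_square [symmetric]) (simp add: dist_norm norm_minus_commute)
    have "of_real (R\<^sup>2) - cnj (z - a) * (s - a) = (s - a) * cnj (s - z)"
      unfolding 1[symmetric] by (simp add: algebra_simps)
    hence "norm (b z s) = norm (s - a) * norm (s - z) / R"
      using R by (simp only: b_def norm_divide norm_mult complex_mod_cnj norm_of_real)
    thus ?thesis using that R by (simp add: dist_norm norm_minus_commute)
  qed
  have ba: "norm (b z a) = R" for z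
    using R by (simp add: b_def norm_divide power2_eq_square norm_mult)
  have aZ: "a \<notin> Z" using f Z by auto
  show ?thesis
  proof (intro exI[of _ h] conjI ballI impI)
    show "norm (h s) = norm (f s)" if "s \<in> sphere a R" for s
      using bs[OF that] by (simp add: h_def g(2) m_def norm_mult prod_norm [symmetric] norm_power)
    show "h s = 0 \<longleftrightarrow> f s = 0 \<and> s \<notin> Z" if "s \<in> cball a R" for s
      using b0[OF _ that] Z(1) by (auto simp: h_def g(3))
    have "norm (f a) = norm (g a) * (\<Prod>z\<in>Z. norm (z - a) ^ m z)"
      by (simp add: g(2) m_def norm_mult prod_norm [symmetric] norm_power norm_minus_commute)
    moreover have "norm (h a) = norm (g a) * (\<Prod>z\<in>Z. R ^ m z)"
      by (simp add: h_def norm_mult prod_norm [symmetric] norm_power ba)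
    moreover have "(\<Prod>z\<in>Z. norm (z - a) ^ m z) * (\<Prod>z\<in>Z. (R / norm (z - a)) ^ m z) = (\<Prod>z\<in>Z. R ^ m z)"
      unfolding prod.distrib [symmetric] power_mult_distrib [symmetric]
      by (rule prod.cong) (use aZ in auto)
    ultimately show "norm (h a) = norm (f a) * (\<Prod>z\<in>Z. (R / norm (z - a)) ^ nat (zorder f z))"
      by (simp only: m_def mult.assoc)
    fix s assume s: "s \<in> cball a R" "f s \<noteq> 0"
    hence sZ: "s \<notin> Z" using Z by auto
    have gs: "g s \<noteq> 0" using s g(3) by auto
    have gd: "(g has_field_derivative deriv g s) (at s)"
      using g(1) by (intro holomorphic_derivI[of _ UNIV]) auto
    have P: "((\<lambda>s. \<Prod>z\<in>Z. c z s ^ m z) has_field_derivative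
         (\<Prod>z\<in>Z. c z s ^ m z) * (\<Sum>z\<in>Z. of_nat (m z) * c' z / c z s)) (at s)"
      if c: "\<And>z. z \<in> Z \<Longrightarrow> (c z has_field_derivative c' z) (at s)" "\<And>z. z \<in> Z \<Longrightarrow> c z s \<noteq> 0"
      for c :: "complex \<Rightarrow> complex \<Rightarrow> complex" and c'
    proof -
      have 1: "((\<lambda>s. c z s ^ m z) has_field_derivative c z s ^ m z * (of_nat (m z) * c' z / c z s)) (at s)"
        if "z \<in> Z" for z
      proof (cases "m z")
        case (Suc n)
        have "c z s ^ m z * (of_nat (m z) * c' z / c z s) = (1 + of_nat n) * (c' z * c z s ^ n)"
          using c(2)[OF that] Suc by (simp add: field_simps)
        thus ?thesis using DERIV_power_Suc[OF c(1)[OF that], of n] unfolding Suc by metis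
      qed simp
      show ?thesis using Z(1) c(2) 1
      proof (induction Z rule: finite_induct)
        case (insert x F)
        have "((\<lambda>s. c x s ^ m x * (\<Prod>z\<in>F. c z s ^ m z)) has_field_derivative
          (c x s ^ m x * (of_nat (m x) * c' x / c x s)) * (\<Prod>z\<in>F. c z s ^ m z) +
           (\<Prod>z\<in>F. c z s ^ m z) * (\<Sum>z\<in>F. of_nat (m z) * c' z / c z s) * c x s ^ m x) (at s)"
          by (rule DERIV_mult) (use insert in auto)
        thus ?case using insert by (simp add: algebra_simps)
      qed simp
    qed
    \<comment> \<open>One product rule serves twice: with the factors s - z it gives f'/f, with the
      factors \<open>b z\<close> it gives h'/h, and the common g'/g cancels in the
      difference.\<close>
    have Lg: "deriv (\<lambda>s. g s * (\<Prod>z\<in>Z. c z s ^ m z)) s / (g s * (\<Prod>z\<in>Z. c z s ^ m z))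
       = deriv g s / g s + (\<Sum>z\<in>Z. of_nat (m z) * c' z / c z s)"
      if c: "\<And>z. z \<in> Z \<Longrightarrow> (c z has_field_derivative c' z) (at s)" "\<And>z. z \<in> Z \<Longrightarrow> c z s \<noteq> 0"
      for c :: "complex \<Rightarrow> complex \<Rightarrow> complex" and c'
    proof -
      have nz: "(\<Prod>z\<in>Z. c z s ^ m z) \<noteq> 0" using c(2) Z(1) by auto
      have "deriv (\<lambda>s. g s * (\<Prod>z\<in>Z. c z s ^ m z)) s = deriv g s * (\<Prod>z\<in>Z. c z s ^ m z) +
         ((\<Prod>z\<in>Z. c z s ^ m z) * (\<Sum>z\<in>Z. of_nat (m z) * c' z / c z s)) * g s"
        by (rule DERIV_imp_deriv, rule DERIV_mult[OF gd P[OF c]]) auto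
      thus ?thesis using nz gs by (simp add: field_simps)
    qed
    have feq: "f = (\<lambda>s. g s * (\<Prod>z\<in>Z. (s - z) ^ m z))" using g(2) by (auto simp: m_def)
    have 1: "deriv f s / f s = deriv g s / g s + (\<Sum>z\<in>Z. of_nat (m z) * 1 / (s - z))"
      by (subst (1 2) feq, rule Lg[of "\<lambda>z s. s - z" "\<lambda>_. 1"])
         (use sZ in \<open>auto intro!: derivative_eq_intros\<close>)
    have 2: "deriv h s / h s = deriv g s / g s + (\<Sum>z\<in>Z. of_nat (m z) * (- cnj (z - a) / of_real R) / b z s)"
      unfolding h_def using b0[OF _ s(1)]
      by (intro Lg) (use R in \<open>auto intro!: derivative_eq_intros simp: b_def\<close>)
    have 3: "(- cnj (z - a) / of_real R) / b z s = - (cnj (z - a) / (of_real (R\<^sup>2) - cnj (z - a) * (s - a)))"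
      if "z \<in> Z" for z
    proof -
      have "(- c / r) / (D / r) = - (c / D)" if "r \<noteq> 0" for c r D :: complex using that by simp
      moreover have "complex_of_real R \<noteq> 0" using R by simp
      ultimately show ?thesis unfolding b_def by blast
    qed
    have "(\<Sum>z\<in>Z. of_nat (m z) * (- cnj (z - a) / of_real R) / b z s) =
       (\<Sum>z\<in>Z. - (of_nat (m z) * (cnj (z - a) / (of_real (R\<^sup>2) - cnj (z - a) * (s - a)))))"
      by (rule sum.cong[OF refl]) (use 3 in \<open>simp only: times_divide_eq_right[symmetric], simp\<close>)
    thus "deriv f s / f s = deriv h s / h s +
        (\<Sum>z\<in>Z. of_nat (nat (zorder f z)) * (1 / (s - z) + cnj (z - a) / (of_real (R\<^sup>2) - cnj (z - a) * (s - a))))"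
      unfolding 1 2 by (simp add: m_def sum_negf sum.distrib ring_distribs)
  qed (rule h_holo)
qed

section \<open>Jensen's inequality\<close>

lemma finite_zeros_entire:
  fixes f :: "complex \<Rightarrow> complex"
  assumes "f holomorphic_on UNIV" "f a \<noteq> 0" "bounded K"
  shows "finite {z\<in>K. f z = 0}"
proof (cases "\<exists>z. f z = 0")
  case True
  then obtain z where "f z = 0" ..
  hence "\<not> f constant_on UNIV" using assms by (metis UNIV_I constant_on_def)
  hence "finite {z\<in>closure K. f z = 0}"
    using assms by (intro holomorphic_compact_finite_zeros[of f UNIV]) auto
  thus ?thesis by (rule rev_finite_subset) (use closure_subset in auto)
qed auto

lemma ln_prod_power:
  assumes "finite Z" "\<And>z. z \<in> Z \<Longrightarrow> (u z :: real) > 0"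
  shows "ln (\<Prod>z\<in>Z. u z ^ m z) = (\<Sum>z\<in>Z. real (m z) * ln (u z))"
proof -
  have "u z ^ m z \<noteq> 0" "ln (u z ^ m z) = real (m z) * ln (u z)" if "z \<in> Z" for z
    using assms(2)[OF that] by (auto simp: ln_realpow)
  thus ?thesis using assms(1) by (subst ln_prod) auto
qed

text \<open>Once all zeros in the disc are reflected, ln |h| is the real part of a holomorphic
  function and has the mean value property; |h| = |f| on the circle, and |h a| carries the factors R
  / |z - a|. The continuous majorant \<open>U\<close> stands in for ln |f|, so only an upper bound
  on the circle has to be supplied.\<close>

lemma jensen_inequality:
  fixes f :: "complex \<Rightarrow> complex" and U :: "real \<Rightarrow> real"
  assumes f: "f holomorphic_on UNIV" "f a \<noteq> 0" and R: "R > 0"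
    and sph: "\<And>z. z \<in> sphere a R \<Longrightarrow> f z \<noteq> 0"
    and U: "continuous_on {0..1} U" "\<And>t. t \<in> {0..1} \<Longrightarrow> norm (f (circlepath a R t)) \<le> exp (U t)"
  shows "(\<Sum>z | z \<in> ball a R \<and> f z = 0. real (nat (zorder f z)) * ln (R / norm (z - a)))
           \<le> integral {0..1} U - ln (norm (f a))"
proof -
  define Z where "Z = {z\<in>ball a R. f z = 0}"
  have Z: "finite Z" "\<forall>z\<in>Z. f z = 0" "Z \<subseteq> ball a R"
    unfolding Z_def by (rule finite_zeros_entire[OF f bounded_ball], auto)
  have aZ: "a \<notin> Z" using f by (auto simp: Z_def)
  obtain h where h0: "h holomorphic_on UNIV"
    "\<forall>s\<in>sphere a R. norm (h s) = norm (f s)"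
    "\<forall>s\<in>cball a R. h s = 0 \<longleftrightarrow> f s = 0 \<and> s \<notin> Z"
    "norm (h a) = norm (f a) * (\<Prod>z\<in>Z. (R / norm (z - a)) ^ nat (zorder f z))"
    using blaschke_reflection[OF f R Z] by (elim exE conjE) (rule that)
  note h = h0(1) h0(2)[rule_format] h0(3)[rule_format] h0(4)
  have hnz: "h s \<noteq> 0" if "s \<in> cball a R" for s
    using h(3)[OF that] sph[of s] that by (cases "dist a s = R") (auto simp: Z_def)
  have ha: "h a \<noteq> 0" using hnz[of a] R by auto
  define W where "W = {z\<in>cball a (R + 1). h z = 0}"
  have W: "finite W" unfolding W_def by (rule finite_zeros_entire[OF h(1) ha]) auto
  \<comment> \<open>A logarithm of \<open>h\<close> is wanted on an open disc that contains the
    closed one. Within radius R + 1 there are finitely many zeros of \<open>h\<close>, and none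
    within radius R, so some room is left.\<close>
  define R' where "R' = Min (insert (R + 1) (dist a ` W))"
  have R': "R' > R" unfolding R'_def using W hnz
    by (subst Min_gr_iff) (auto simp: W_def not_le[symmetric])
  have hnz': "h s \<noteq> 0" if "s \<in> ball a R'" for s
  proof
    assume "h s = 0"
    moreover have "R' \<le> R + 1" unfolding R'_def using W by (intro Min_le) auto
    ultimately have "s \<in> W" using that by (auto simp: W_def)
    hence "R' \<le> dist a s" unfolding R'_def using W by (intro Min_le) auto
    thus False using that by auto
  qed
  have "convex (ball a R')" "open (ball a R')" by auto
  moreover have "h holomorphic_on ball a R'" using h(1) by (rule holomorphic_on_subset) auto
  moreover have "a \<in> ball a R'" using R R' by auto
  ultimately obtain g where g: "g holomorphic_on ball a R'" "\<And>x. x \<in> ball a R' \<Longrightarrow> exp (g x) = h x"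
    using holomorphic_logarithm_exists[of "ball a R'" h a] hnz' by metis
  have "((\<lambda>u. g u / (u - a)) has_contour_integral (2 * of_real pi * \<i> * g a)) (circlepath a R)"
    by (rule Cauchy_integral_circlepath_simple)
       (use R R' in \<open>auto intro: holomorphic_on_subset[OF g(1)]\<close>)
  hence "((\<lambda>x. g (circlepath a R x) / (circlepath a R x - a) * vector_derivative (circlepath a R) (at x within {0..1}))
      has_integral (2 * of_real pi * \<i> * g a)) {0..1}"
    by (simp add: has_contour_integral_def)
  hence "((\<lambda>x. 2 * of_real pi * \<i> * g (circlepath a R x)) has_integral (2 * of_real pi * \<i> * g a)) {0..1}"
    by (rule has_integral_eq[rotated])
       (use R in \<open>subst vector_derivative_circlepath01, auto simp: circlepath field_simps\<close>)
  from has_integral_mult_right[OF this, of "1 / (2 * of_real pi * \<i>)"]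
  have "((\<lambda>x. g (circlepath a R x)) has_integral g a) {0..1}" by simp
  from has_integral_linear[OF this bounded_linear_Re]
  have I: "((\<lambda>x. Re (g (circlepath a R x))) has_integral Re (g a)) {0..1}" by (simp add: o_def)
  have Re_g: "Re (g x) = ln (norm (h x))" if "x \<in> ball a R'" for x
    using g(2)[OF that] by (metis ln_exp norm_exp_eq_Re)
  have "Re (g a) \<le> integral {0..1} U"
  proof (rule has_integral_le[OF I integrable_integral])
    show "U integrable_on {0..1}" using U by (intro integrable_continuous_real)
    fix t :: real assume t: "t \<in> {0..1}"
    have sp: "circlepath a R t \<in> sphere a R" using R t
      by (metis path_image_circlepath_nonneg path_image_def imageI less_imp_le)
    hence b: "circlepath a R t \<in> ball a R'" using R' by auto
    have "Re (g (circlepath a R t)) = ln (norm (f (circlepath a R t)))"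
      using Re_g[OF b] h(2)[OF sp] by simp
    also have "\<dots> \<le> ln (exp (U t))"
      by (subst ln_le_cancel_iff) (use U(2)[OF t] sph[OF sp] in auto)
    finally show "Re (g (circlepath a R t)) \<le> U t" by simp
  qed
  moreover have "Re (g a) = ln (norm (h a))" using R R' by (intro Re_g) auto
  moreover have "ln (norm (h a)) = ln (norm (f a)) + (\<Sum>z\<in>Z. real (nat (zorder f z)) * ln (R / norm (z - a)))"
  proof -
    have p: "R / norm (z - a) > 0" if "z \<in> Z" for z using that aZ R by (auto intro!: divide_pos_pos)
    have "(\<Prod>z\<in>Z. (R / norm (z - a)) ^ nat (zorder f z)) > 0" by (intro prod_pos) (use p in auto)
    hence "ln (norm (h a)) = ln (norm (f a)) + ln (\<Prod>z\<in>Z. (R / norm (z - a)) ^ nat (zorder f z))"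
      unfolding h(4) using f by (subst ln_mult) auto
    also have "ln (\<Prod>z\<in>Z. (R / norm (z - a)) ^ nat (zorder f z)) = (\<Sum>z\<in>Z. real (nat (zorder f z)) * ln (R / norm (z - a)))"
      by (rule ln_prod_power) (use Z p in auto)
    finally show ?thesis .
  qed
  ultimately show ?thesis by (simp add: Z_def)
qed

text \<open>The map w / (2M - w) sends the half-plane Re w < M into the unit disc and fixes 0.
  Schwarz's lemma therefore bounds H itself up to the radius halfway between r and R, and Cauchy's
  inequality on circles of radius (R - r)/2 bounds the derivative.\<close>

lemma borel_caratheodory_deriv:
  fixes H :: "complex \<Rightarrow> complex"
  assumes H: "H holomorphic_on ball a R" "H a = 0" and r: "0 < r" "r < R"
    and M: "\<And>s. s \<in> ball a R \<Longrightarrow> Re (H s) < M" and s: "s \<in> cball a r"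
  shows "norm (deriv H s) \<le> 8 * M * R / (R - r)\<^sup>2"
proof -
  have M0: "M > 0" using M[of a] H r by auto
  define \<phi> where "\<phi> = (\<lambda>z. H (a + of_real R * z) / (of_real (2 * M) - H (a + of_real R * z)))"
  have in_ball: "a + of_real R * z \<in> ball a R" if "norm z < 1" for z
    using that r by (auto simp: dist_norm norm_mult)
  have den: "of_real (2 * M) - H w \<noteq> 0" if "w \<in> ball a R" for w
    using M[OF that] M0 by (auto simp: complex_eq_iff)
  have lt: "norm (H w) < norm (of_real (2 * M) - H w)" if "w \<in> ball a R" for w
  proof -
    have "M * (Re (H w) - M) < 0" using M[OF that] M0 by (simp add: mult_pos_neg)
    hence "(norm (H w))\<^sup>2 < (norm (of_real (2 * M) - H w))\<^sup>2"
      unfolding cmod_power2 by (simp add: power2_eq_square algebra_simps)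
    thus ?thesis by (rule power2_less_imp_less) auto
  qed
  have holo: "(\<lambda>z. H (a + of_real R * z)) holomorphic_on ball 0 1"
    by (rule holomorphic_on_compose_gen[OF _ H(1), of "\<lambda>z. a + of_real R * z", unfolded o_def])
       (use in_ball in \<open>auto intro!: holomorphic_intros\<close>)
  have S: "norm (\<phi> z) \<le> norm z" if "norm z < 1" for z
  proof (rule Schwarz_Lemma(1)[of \<phi>])
    show "\<phi> holomorphic_on ball 0 1"
      unfolding \<phi>_def by (intro holomorphic_intros holo) (use den in_ball in auto)
    show "norm (\<phi> z) < 1" if "norm z < 1" for z
      using lt[OF in_ball[OF that]] den[OF in_ball[OF that]]
      by (simp add: \<phi>_def norm_divide divide_less_eq_1)
  qed (use that H in \<open>auto simp: \<phi>_def\<close>)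
  define r1 where "r1 = (r + R) / 2"
  have r1: "r < r1" "r1 < R" "r1 > 0" using r by (auto simp: r1_def)
  have bd: "norm (H w) \<le> 4 * M * R / (R - r)" if w: "w \<in> cball a r1" for w
  proof -
    define z where "z = (w - a) / of_real R"
    have wz: "w = a + of_real R * z" using r by (simp add: z_def)
    have nz: "norm z \<le> r1 / R" using w r by (simp add: z_def norm_divide dist_norm norm_minus_commute divide_right_mono)
    also have "r1 / R < 1" using r1 r by simp
    finally have z1: "norm z < 1" .
    have "norm (H w) = norm (\<phi> z) * norm (of_real (2 * M) - H w)"
      using den[OF in_ball[OF z1]] by (simp add: \<phi>_def wz norm_divide)
    also have "\<dots> \<le> r1 / R * (2 * M + norm (H w))"
      using S[OF z1] nz M0 r r1 norm_triangle_ineq4[of "of_real (2 * M)" "H w"]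
      by (intro mult_mono) (auto intro: order.trans)
    finally have "norm (H w) * (1 - r1 / R) \<le> r1 / R * (2 * M)" by (simp add: algebra_simps)
    hence "R * (norm (H w) * (1 - r1 / R)) \<le> R * (r1 / R * (2 * M))" using r by (intro mult_left_mono) auto
    moreover have "R * (norm (H w) * (1 - r1 / R)) = norm (H w) * (R - r1)" using r by (simp add: field_simps)
    moreover have "R * (r1 / R * (2 * M)) = r1 * (2 * M)" using r by simp
    ultimately have "norm (H w) * (R - r1) \<le> r1 * (2 * M)" by simp
    also have "\<dots> \<le> R * (2 * M)" using r1 M0 by (intro mult_right_mono) auto
    finally have "norm (H w) * (R - r) \<le> 4 * M * R" by (simp add: r1_def field_simps)
    thus ?thesis using r by (simp add: field_simps)
  qed
  have sub: "cball s ((R - r) / 2) \<subseteq> cball a r1"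
    using s by (subst cball_subset_cball_iff) (auto simp: r1_def dist_commute field_simps)
  have "norm ((deriv ^^ 1) H s) \<le> fact 1 * (4 * M * R / (R - r)) / ((R - r) / 2) ^ 1"
  proof (rule Cauchy_inequality)
    have sub2: "cball s ((R - r) / 2) \<subseteq> ball a R" using sub r1 by fastforce
    show "H holomorphic_on ball s ((R - r) / 2)"
      by (rule holomorphic_on_subset[OF H(1)]) (use sub2 ball_subset_cball in blast)
    show "continuous_on (cball s ((R - r) / 2)) H"
      by (intro holomorphic_on_imp_continuous_on holomorphic_on_subset[OF H(1)] sub2)
    show "norm (H x) \<le> 4 * M * R / (R - r)" if "norm (s - x) = (R - r) / 2" for x
    proof (rule bd)
      have "x \<in> cball s ((R - r) / 2)" using that by (simp add: dist_norm)
      thus "x \<in> cball a r1" using sub by blast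
    qed
  qed (use r in auto)
  thus ?thesis using r by (simp add: power2_eq_square field_simps)
qed

text \<open>Reflect the zeros of \<open>Z\<close> in the circle of radius r3. The maximum principle
  bounds the result h by |f a| exp M, while |h a| is at least |f a| (r3 / r2)^N with N zeros in
  \<open>Z\<close>; comparing the two counts the zeros. On the ball of radius r2 the function h has
  a logarithm, to which Borel-Caratheodory applies, and each reflected factor contributes at most 1
  / (r3 - r2) to the logarithmic derivative.\<close>

lemma local_log_deriv:
  fixes f :: "complex \<Rightarrow> complex"
  assumes f: "f holomorphic_on UNIV" "f a \<noteq> 0" and r: "0 < r1" "r1 < r2" "r2 < r3" and M: "M > 0"
    and bd: "\<forall>s\<in>sphere a r3. norm (f s) \<le> norm (f a) * exp M"
  defines "Z \<equiv> {z \<in> cball a r2. f z = 0}"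
  shows "(\<Sum>z\<in>Z. real (nat (zorder f z))) * ln (r3 / r2) \<le> M"
    and "\<And>s. s \<in> cball a r1 \<Longrightarrow> f s \<noteq> 0 \<Longrightarrow>
      norm (deriv f s / f s - (\<Sum>z\<in>Z. of_nat (nat (zorder f z)) / (s - z)))
        \<le> M * (16 * r2 / (r2 - r1)\<^sup>2 + 1 / ((r3 - r2) * ln (r3 / r2)))"
proof -
  have Z: "finite Z" "\<forall>z\<in>Z. f z = 0" "Z \<subseteq> ball a r3"
    unfolding Z_def by (rule finite_zeros_entire[OF f bounded_cball]) (use r in auto)
  have aZ: "a \<notin> Z" using f by (auto simp: Z_def)
  have r3: "r3 > 0" using r by auto
  obtain h where h0: "h holomorphic_on UNIV"
    "\<forall>s\<in>sphere a r3. norm (h s) = norm (f s)"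
    "\<forall>s\<in>cball a r3. h s = 0 \<longleftrightarrow> f s = 0 \<and> s \<notin> Z"
    "norm (h a) = norm (f a) * (\<Prod>z\<in>Z. (r3 / norm (z - a)) ^ nat (zorder f z))"
    "\<forall>s\<in>cball a r3. f s \<noteq> 0 \<longrightarrow> deriv f s / f s = deriv h s / h s +
        (\<Sum>z\<in>Z. of_nat (nat (zorder f z)) * (1 / (s - z) + cnj (z - a) / (of_real (r3\<^sup>2) - cnj (z - a) * (s - a))))"
    using blaschke_reflection[OF f r3 Z] by (elim exE conjE) (rule that)
  note h = h0(1) h0(2)[rule_format] h0(3)[rule_format] h0(4) h0(5)[rule_format]
  define m where "m = (\<lambda>z. nat (zorder f z))"
  have hb: "norm (h s) \<le> norm (f a) * exp M" if "s \<in> cball a r3" for s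
  proof (rule maximum_modulus_frontier[of h "cball a r3"])
    show "norm (h z) \<le> norm (f a) * exp M" if "z \<in> frontier (cball a r3)" for z
      using that h(2)[of z] bd r3 by auto
  qed (use that h(1) in \<open>auto intro: holomorphic_on_subset holomorphic_on_imp_continuous_on\<close>)
  have hnz: "h s \<noteq> 0" if "s \<in> ball a r2" for s
    using h(3)[of s] that r by (auto simp: Z_def)
  have zb: "norm (z - a) \<le> r2" "norm (z - a) > 0" if "z \<in> Z" for z
    using that aZ by (auto simp: Z_def dist_norm norm_minus_commute)
  have l0: "ln (r3 / r2) > 0" using r by simp
  have P: "(\<Prod>z\<in>Z. (r3 / norm (z - a)) ^ m z) \<ge> (r3 / r2) ^ (\<Sum>z\<in>Z. m z)"
    unfolding power_sum using zb r by (intro prod_mono conjI power_mono divide_left_mono) auto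
  have "(r3 / r2) ^ (\<Sum>z\<in>Z. m z) \<le> exp M"
  proof -
    have "norm (f a) * (r3 / r2) ^ (\<Sum>z\<in>Z. m z) \<le> norm (h a)"
      unfolding h(4) using P by (intro mult_left_mono) (auto simp: m_def)
    also have "\<dots> \<le> norm (f a) * exp M" using r3 by (intro hb) auto
    finally show ?thesis using f by simp
  qed
  hence "ln ((r3 / r2) ^ (\<Sum>z\<in>Z. m z)) \<le> ln (exp M)"
    using r by (subst ln_le_cancel_iff) auto
  hence N: "real (\<Sum>z\<in>Z. m z) * ln (r3 / r2) \<le> M"
    using r by (simp add: ln_realpow)
  thus N': "(\<Sum>z\<in>Z. real (nat (zorder f z))) * ln (r3 / r2) \<le> M" by (simp add: m_def)
  have "(r3 / r2) ^ (\<Sum>z\<in>Z. m z) \<ge> 1" using r by (intro one_le_power) auto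
  hence ha: "norm (f a) \<le> norm (h a)"
    unfolding h(4) m_def[symmetric] using P mult_left_mono[of 1 "(\<Prod>z\<in>Z. (r3 / norm (z - a)) ^ m z)" "norm (f a)"] by (simp add: m_def)
  have ha0: "h a \<noteq> 0" using ha f by auto
  define k where "k = (\<lambda>s. h s / h a)"
  have k: "k holomorphic_on ball a r2" unfolding k_def
    using ha0 by (intro holomorphic_intros holomorphic_on_subset[OF h(1)]) auto
  have "convex (ball a r2)" "open (ball a r2)" "a \<in> ball a r2" using r by auto
  then obtain G where G: "G holomorphic_on ball a r2" "\<And>x. x \<in> ball a r2 \<Longrightarrow> exp (G x) = k x"
    using holomorphic_logarithm_exists[of "ball a r2" k a] k hnz ha0 by (metis divide_eq_0_iff k_def)
  define H where "H = (\<lambda>s. G s - G a)"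
  have eGa: "exp (G a) = 1" using G(2)[of a] r ha0 by (simp add: k_def)
  have eH: "exp (H x) = k x" if "x \<in> ball a r2" for x
    using G(2)[OF that] eGa by (simp add: H_def exp_diff)
  have H: "H holomorphic_on ball a r2" "H a = 0" unfolding H_def by (intro holomorphic_intros G) auto
  \<comment> \<open>The natural bound is Re H <= M; doubling it gives the strict inequality that
    \<open>borel_caratheodory_deriv\<close> asks for.\<close>
  have ReH: "Re (H s) < 2 * M" if "s \<in> ball a r2" for s
  proof -
    have "exp (Re (H s)) = norm (h s) / norm (h a)"
      using arg_cong[OF eH[OF that], of norm] by (simp add: k_def norm_divide)
    also have "\<dots> \<le> norm (f a) * exp M / norm (f a)"
      using hb[of s] that r ha f by (intro frac_le) auto
    finally have "Re (H s) \<le> M" using f by simp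
    thus ?thesis using M by simp
  qed
  fix s assume s: "s \<in> cball a r1" "f s \<noteq> 0"
  have sb: "s \<in> ball a r2" "s \<in> cball a r3" using s r by auto
  have "deriv H s = deriv h s / h s"
  proof -
    have "(H has_field_derivative deriv H s) (at s)"
      using H(1) sb by (intro holomorphic_derivI[of _ "ball a r2"]) auto
    hence "((\<lambda>s. exp (H s)) has_field_derivative exp (H s) * deriv H s) (at s)"
      by (auto intro!: derivative_eq_intros)
    hence 1: "(k has_field_derivative exp (H s) * deriv H s) (at s)"
      by (rule has_field_derivative_transform_within_open[of _ _ _ "ball a r2"]) (use sb eH in auto)
    have "(h has_field_derivative deriv h s) (at s)"
      using h(1) by (intro holomorphic_derivI[of _ UNIV]) auto
    hence 2: "(k has_field_derivative deriv h s / h a) (at s)"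
      unfolding k_def by (rule DERIV_cdivide)
    have "k s * deriv H s = deriv h s / h a"
      using DERIV_unique[OF 1 2] eH[OF sb(1)] by simp
    thus ?thesis using ha0 hnz[OF sb(1)] by (simp add: k_def field_simps)
  qed
  hence 1: "norm (deriv h s / h s) \<le> 8 * (2 * M) * r2 / (r2 - r1)\<^sup>2"
    using borel_caratheodory_deriv[OF H r(1,2) ReH s(1)] by metis
  have 2: "norm (\<Sum>z\<in>Z. of_nat (m z) * (cnj (z - a) / (of_real (r3\<^sup>2) - cnj (z - a) * (s - a)))) \<le>
      (\<Sum>z\<in>Z. real (m z) * (1 / (r3 - r2)))"
  proof (rule order.trans[OF norm_sum sum_mono])
    fix z assume z: "z \<in> Z"
    have ns: "norm (s - a) \<le> r2" using sb by (auto simp: dist_norm norm_minus_commute)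
    have "norm (cnj (z - a) * (s - a)) \<le> r2 * r2"
      unfolding norm_mult complex_mod_cnj using zb[OF z] ns r by (intro mult_mono) auto
    hence "norm (complex_of_real (r3\<^sup>2) - cnj (z - a) * (s - a)) \<ge> r3\<^sup>2 - r2 * r2"
      using norm_triangle_ineq2[of "complex_of_real (r3\<^sup>2)" "cnj (z - a) * (s - a)"] by (simp only: norm_of_real abs_power2)
    also have "r3\<^sup>2 - r2 * r2 = (r3 - r2) * (r3 + r2)" by (simp add: power2_eq_square algebra_simps)
    finally have "norm (complex_of_real (r3\<^sup>2) - cnj (z - a) * (s - a)) \<ge> (r3 - r2) * r2"
      using r by (smt (verit) mult_left_mono)
    hence "norm (cnj (z - a) / (of_real (r3\<^sup>2) - cnj (z - a) * (s - a))) \<le> r2 / ((r3 - r2) * r2)"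
      unfolding norm_divide complex_mod_cnj using zb[OF z] r by (intro frac_le) auto
    also have "\<dots> = 1 / (r3 - r2)" using r by simp
    finally show "norm (of_nat (m z) * (cnj (z - a) / (of_real (r3\<^sup>2) - cnj (z - a) * (s - a)))) \<le> real (m z) * (1 / (r3 - r2))"
      unfolding norm_mult norm_of_nat by (rule mult_left_mono) auto
  qed
  also have "\<dots> = real (\<Sum>z\<in>Z. m z) * (1 / (r3 - r2))" by (simp add: sum_distrib_right sum_divide_distrib)
  also have "\<dots> \<le> M / ln (r3 / r2) * (1 / (r3 - r2))"
    using N l0 r by (intro mult_right_mono) (auto simp: field_simps)
  finally have 2: "norm (\<Sum>z\<in>Z. of_nat (m z) * (cnj (z - a) / (of_real (r3\<^sup>2) - cnj (z - a) * (s - a)))) \<le> M / ln (r3 / r2) * (1 / (r3 - r2))" .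
  have "deriv f s / f s - (\<Sum>z\<in>Z. of_nat (nat (zorder f z)) / (s - z)) =
     deriv h s / h s + (\<Sum>z\<in>Z. of_nat (m z) * (cnj (z - a) / (of_real (r3\<^sup>2) - cnj (z - a) * (s - a))))"
    unfolding h(5)[OF sb(2) s(2)] by (simp add: m_def ring_distribs sum.distrib)
  also have "norm \<dots> \<le> 8 * (2 * M) * r2 / (r2 - r1)\<^sup>2 + M / ln (r3 / r2) * (1 / (r3 - r2))"
    by (rule order.trans[OF norm_triangle_ineq add_mono[OF 1 2]])
  also have "\<dots> = M * (16 * r2 / (r2 - r1)\<^sup>2 + 1 / ((r3 - r2) * ln (r3 / r2)))"
    by (simp add: field_simps)
  finally show "norm (deriv f s / f s - (\<Sum>z\<in>Z. of_nat (nat (zorder f z)) / (s - z)))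
        \<le> M * (16 * r2 / (r2 - r1)\<^sup>2 + 1 / ((r3 - r2) * ln (r3 / r2)))" .
qed

section \<open>Growth of the zeta function\<close>

text \<open>Analytic continuation from Re s > 1 leaves only one such function, so the choice made by
  \<open>SOME\<close> is (s - 1) zeta(s) with its pole removed.\<close>

definition zeta_entire :: "complex \<Rightarrow> complex" where
  "zeta_entire = (SOME F. F holomorphic_on UNIV \<and> (\<forall>s. Re s > 1 \<longrightarrow> F s = (s - 1) * zeta_dirichlet s))"

lemma zeta_entire_holomorphic: "zeta_entire holomorphic_on A"
  and zeta_entire_dirichlet: "Re s > 1 \<Longrightarrow> zeta_entire s = (s - 1) * zeta_dirichlet s"
proof -
  have *: "zeta_entire holomorphic_on UNIV \<and> (\<forall>s. Re s > 1 \<longrightarrow> zeta_entire s = (s - 1) * zeta_dirichlet s)"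
    unfolding zeta_entire_def using zeta_ext by (rule someI_ex)
  thus "zeta_entire holomorphic_on A" by (auto intro: holomorphic_on_subset)
  show "Re s > 1 \<Longrightarrow> zeta_entire s = (s - 1) * zeta_dirichlet s" using * by blast
qed

lemma zeta_entire_riemann_zeta:
  assumes "s \<noteq> 1"
  shows "zeta_entire s = (s - 1) * riemann_zeta s"
proof -
  have "(\<lambda>s. zeta_entire s / (s - 1)) holomorphic_on (- {1})"
    by (intro holomorphic_intros zeta_entire_holomorphic) auto
  hence "(\<lambda>s. if s = 1 then 0 else zeta_entire s / (s - 1)) holomorphic_on (- {1})"
    by (rule holomorphic_transform) auto
  moreover have "zeta_entire s / (s - 1) = zeta_dirichlet s" if "Re s > 1" for s
    using zeta_entire_dirichlet[OF that] that by auto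
  ultimately have "is_riemann_zeta (\<lambda>s. if s = 1 then 0 else zeta_entire s / (s - 1))"
    unfolding is_riemann_zeta_def using zeta_dirichlet_sums by auto
  hence "riemann_zeta = (\<lambda>s. if s = 1 then 0 else zeta_entire s / (s - 1))"
    using riemann_zeta_unique is_riemann_zeta_riemann_zeta by blast
  hence "riemann_zeta s = zeta_entire s / (s - 1)" using assms fun_cong by fastforce
  thus ?thesis using assms by simp
qed

text \<open>For Re w > 1 this is \<open>zeta_recurrence\<close> at s = w - 1. The last factor -(s +
  j - 1) of \<open>zeta_coeff j s\<close> turns zeta(s + j) into -F(s + j), so no poles remain and
  both sides continue to Re w > 1 - K.\<close>

lemma zeta_entire_recurrence:
  assumes K: "K > 0" and w: "Re w > 1 - real K"
  shows "zeta_entire w = 1 - (\<Sum>j=2..K. zeta_coeff (j - 1) (w - 1) / fact j * zeta_entire (w - 1 + of_nat j)) +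
           (\<Sum>n. zeta_rem K (of_nat (Suc n)) (w - 1))"
proof -
  from zeta_rem_series[of K] obtain g where g: "g holomorphic_on {s. Re s > - real K}"
    "\<And>s. Re s > - real K \<Longrightarrow> (\<lambda>n. zeta_rem K (of_nat (Suc n)) s) sums g s" by blast
  define G where "G = (\<lambda>w. 1 - (\<Sum>j=2..K. zeta_coeff (j - 1) (w - 1) / fact j * zeta_entire (w - 1 + of_nat j)) + g (w - 1))"
  have 1: "(\<lambda>w. g (w - 1)) holomorphic_on {s. Re s > 1 - real K}"
    by (rule holomorphic_on_compose_gen[OF _ g(1), of "\<lambda>w. w - 1", unfolded o_def])
       (auto intro!: holomorphic_intros)
  have 2: "(\<lambda>w. zeta_entire (w - 1 + of_nat j)) holomorphic_on A" for j A
    by (rule holomorphic_on_compose_gen[OF _ zeta_entire_holomorphic, of "\<lambda>w. w - 1 + of_nat j" _ UNIV, unfolded o_def])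
       (auto intro!: holomorphic_intros)
  have 3: "(\<lambda>w. zeta_coeff (j - 1) (w - 1)) holomorphic_on A" for j A
    unfolding zeta_coeff_def by (intro holomorphic_intros)
  have holo: "G holomorphic_on {s. Re s > 1 - real K}"
    unfolding G_def by (intro holomorphic_intros 1 2 3) auto
  have eq: "zeta_entire w = G w" if w: "Re w > 1" for w
  proof -
    define s where "s = w - 1"
    have s: "Re s > 0" using w by (simp add: s_def)
    have "s * zeta_dirichlet (s + 1) = 1 + (\<Sum>j=2..K. zeta_coeff j s / fact j * zeta_dirichlet (s + of_nat j)) + g s"
      using s K by (intro zeta_recurrence g) auto
    also have "(\<Sum>j=2..K. zeta_coeff j s / fact j * zeta_dirichlet (s + of_nat j)) =
       (\<Sum>j=2..K. - (zeta_coeff (j - 1) s / fact j * zeta_entire (s + of_nat j)))"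
    proof (rule sum.cong)
      fix j assume j: "j \<in> {2..K}"
      then obtain i where i: "j = Suc i" by (cases j) auto
      have "zeta_entire (s + of_nat j) = (s + of_nat j - 1) * zeta_dirichlet (s + of_nat j)"
        using j s by (intro zeta_entire_dirichlet) auto
      thus "zeta_coeff j s / fact j * zeta_dirichlet (s + of_nat j) = - (zeta_coeff (j - 1) s / fact j * zeta_entire (s + of_nat j))"
        using i by (simp add: zeta_coeff_Suc field_simps del: fact_Suc)
    qed simp
    finally show ?thesis using w by (simp add: G_def s_def sum_negf zeta_entire_dirichlet)
  qed
  have "zeta_entire w = G w"
  proof (rule analytic_continuation_open[of "{s. Re s > 1}" "{s. Re s > 1 - real K}" zeta_entire G])
    show "open {s. Re s > 1}" "open {s. Re s > 1 - real K}" by (rule open_halfspace_Re_gt)+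
    show "connected {s. Re s > 1 - real K}"
      by (intro convex_connected convex_halfspace_Re_gt)
    show "{s. Re s > 1} \<noteq> {}" by (auto intro: exI[of _ 2])
  qed (use holo zeta_entire_holomorphic eq w in auto)
  moreover have "(\<lambda>n. zeta_rem K (of_nat (Suc n)) (w - 1)) sums g (w - 1)"
    using w by (intro g(2)) auto
  ultimately show "zeta_entire w = 1 - (\<Sum>j=2..K. zeta_coeff (j - 1) (w - 1) / fact j * zeta_entire (w - 1 + of_nat j)) +
           (\<Sum>n. zeta_rem K (of_nat (Suc n)) (w - 1))"
    by (auto simp: G_def sums_iff)
qed

text \<open>At K = 1, w = 1 the sum in the recurrence is empty and every remainder vanishes. In
  other words, zeta has residue 1.\<close>

lemma zeta_entire_1: "zeta_entire 1 = 1"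
proof -
  have "zeta_rem 1 (of_nat (Suc n)) 0 = 0" for n
  proof -
    have "of_nat (Suc n) + 1 = (of_nat (Suc (Suc n)) :: complex)" by simp
    hence "of_nat (Suc n) + 1 \<noteq> (0 :: complex)" by (metis of_nat_neq_0)
    thus ?thesis by (simp add: zeta_rem_def zeta_coeff_def del: of_nat_Suc)
  qed
  thus ?thesis using zeta_entire_recurrence[of 1 1] by simp
qed

text \<open>This is zeta(b) for real b > 1, the majorant of the remainder series.\<close>

definition powr_sum :: "real \<Rightarrow> real" where "powr_sum b = (\<Sum>n. real (Suc n) powr (-b))"

lemma powr_sum: "b > 1 \<Longrightarrow> summable (\<lambda>n. real (Suc n) powr (-b))" "b > 1 \<Longrightarrow> powr_sum b \<ge> 0"
proof -
  assume b: "b > 1"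
  have "summable (\<lambda>n. real n powr (-b))" using b by (subst summable_real_powr_iff) auto
  thus s: "summable (\<lambda>n. real (Suc n) powr (-b))" by (subst summable_Suc_iff)
  show "powr_sum b \<ge> 0" unfolding powr_sum_def by (intro suminf_nonneg s) auto
qed

lemma zeta_entire_recurrence_bound:
  assumes K: "K > 0" and b: "b > 1" "b \<le> Re w + real K"
  shows "norm (zeta_entire w) \<le> 1 + (\<Sum>j=2..K. norm (zeta_coeff (j - 1) (w - 1)) / fact j * norm (zeta_entire (w - 1 + of_nat j))) +
           norm (zeta_coeff (Suc K) (w - 1)) / fact K * powr_sum b"
proof -
  let ?c = "norm (zeta_coeff (Suc K) (w - 1)) / fact K"
  have w: "Re w > 1 - real K" using b by linarith
  have bd: "norm (zeta_rem K (of_nat (Suc n)) (w - 1)) \<le> ?c * real (Suc n) powr (-b)" for n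
  proof -
    have "norm (zeta_rem K (of_nat (Suc n)) (w - 1)) \<le> norm (zeta_coeff (Suc K) (w - 1)) * real (Suc n) powr (- Re (w - 1) - K - 1) / fact K"
      using w by (intro zeta_rem_bound) auto
    also have "\<dots> = ?c * real (Suc n) powr (- Re (w - 1) - K - 1)" by simp
    also have "\<dots> \<le> ?c * real (Suc n) powr (-b)"
      using b by (intro mult_left_mono powr_mono) auto
    finally show ?thesis .
  qed
  have "norm (\<Sum>n. zeta_rem K (of_nat (Suc n)) (w - 1)) \<le> (\<Sum>n. ?c * real (Suc n) powr (-b))"
    by (rule norm_suminf_le) (use bd powr_sum(1)[OF b(1)] in \<open>auto intro!: summable_mult simp del: of_nat_Suc\<close>)
  also have "\<dots> = ?c * powr_sum b"
    unfolding powr_sum_def by (rule suminf_mult) (use powr_sum(1)[OF b(1)] in auto)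
  finally have 1: "norm (\<Sum>n. zeta_rem K (of_nat (Suc n)) (w - 1)) \<le> ?c * powr_sum b" .
  have 2: "norm (\<Sum>j=2..K. zeta_coeff (j - 1) (w - 1) / fact j * zeta_entire (w - 1 + of_nat j)) \<le>
     (\<Sum>j=2..K. norm (zeta_coeff (j - 1) (w - 1)) / fact j * norm (zeta_entire (w - 1 + of_nat j)))"
    by (rule order.trans[OF norm_sum]) (simp add: norm_mult norm_divide)
  show ?thesis
    unfolding zeta_entire_recurrence[OF K w]
    by (rule order.trans[OF norm_triangle_ineq] add_mono order.trans[OF norm_triangle_ineq4])+ (use 1 2 in auto)
qed

text \<open>The recurrence with K = 1 has an empty sum, which leaves the remainder series alone; it
  converges for Re w > 0.\<close>

lemma zeta_entire_right_bound:
  assumes "\<delta> > 0" "Re w \<ge> \<delta>"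
  shows "norm (zeta_entire w) \<le> 1 + norm (w - 1) * norm w * powr_sum (1 + \<delta>)"
proof -
  have "zeta_coeff 2 (w - 1) = (w - 1) * w"
    by (simp add: zeta_coeff_def numeral_2_eq_2 algebra_simps)
  hence "norm (zeta_coeff (Suc 1) (w - 1)) = norm (w - 1) * norm w"
    by (metis Suc_1 norm_mult)
  thus ?thesis
    using zeta_entire_recurrence_bound[of 1 "1 + \<delta>" w] assms by simp
qed

lemma norm_zeta_coeff_le:
  assumes "norm s + real k \<le> L + 1"
  shows "norm (zeta_coeff k s) \<le> L ^ k"
proof -
  have "norm (zeta_coeff k s) = (\<Prod>l<k. norm (- s - of_nat l))"
    by (simp add: zeta_coeff_def prod_norm)
  also have "\<dots> \<le> (\<Prod>l<k. L)"
  proof (rule prod_mono, safe)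
    fix l assume "l < k"
    hence "real l + 1 \<le> real k" by simp
    thus "norm (- s - of_nat l) \<le> L"
      using assms norm_triangle_ineq4[of "-s" "of_nat l"] by simp
  qed auto
  finally show ?thesis by simp
qed

lemma sum_half_power_le: "(\<Sum>j=2..n. (1/2 :: real) ^ j) \<le> 1/2"
proof (cases "n \<ge> 2")
  case True
  have "(\<Sum>j=2..n. (1/2 :: real) ^ j) = 1/2 - (1/2)^n" using True
    by (induction n rule: dec_induct) (simp_all add: power2_eq_square)
  thus ?thesis by simp
qed simp

text \<open>
  In the recurrence with \<open>K = k + 1\<close>, the term of index \<open>j\<close> lies \<open>j - 1\<close> strips to the right and carries a
  factor of size at most \<open>L ^ (j - 1) / j!\<close>; the factor \<open>2\<close> in \<open>(2 * L) ^ k\<close> makes the resulting series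
  in \<open>j\<close> small enough for the induction to close.
\<close>

lemma zeta_entire_strip_bound:
  fixes n k :: nat and R :: real
  assumes R: "R \<ge> 0"
  defines "L \<equiv> R + 2 * real n + 3"
  defines "M \<equiv> 4 * (1 + powr_sum (3/2)) * L\<^sup>2"
  assumes "k \<le> n" "1/2 - real k \<le> Re w" "Re w \<le> 1/2 + real n" "\<bar>Im w\<bar> \<le> R"
  shows "norm (zeta_entire w) \<le> M * (2 * L) ^ k"
  using assms(4-)
proof (induction k arbitrary: w rule: less_induct)
  case (less k w)
  define C where "C = powr_sum (3/2)"
  have C: "C \<ge> 0" unfolding C_def by (intro powr_sum) auto
  have L: "L \<ge> 3" using R by (simp add: L_def)
  have L2: "L\<^sup>2 \<ge> 1" using L by simp
  have "M = 4 * L\<^sup>2 + 4 * (C * L\<^sup>2)" by (simp add: M_def C_def algebra_simps)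
  moreover have "C * L\<^sup>2 \<ge> 0" using C by simp
  ultimately have M: "M \<ge> 4 * C * L\<^sup>2" "M \<ge> 4" using L2 by simp_all
  have nw: "norm (w - 1) \<le> R + real n + 1" "norm w \<le> R + real n + 1"
  proof -
    have "real k \<le> real n" using less.prems by simp
    hence "\<bar>Re w\<bar> \<le> real n + 1/2" "\<bar>Re w - 1\<bar> \<le> real n + 1/2 \<or> \<bar>Re w - 1\<bar> \<le> real n + 1" using less.prems by linarith+
    thus "norm (w - 1) \<le> R + real n + 1" "norm w \<le> R + real n + 1"
      using cmod_le[of "w - 1"] cmod_le[of w] less.prems by auto
  qed
  have p1: "(2 * L) ^ k \<ge> 1" using L by (intro one_le_power) auto
  show ?case
  proof (cases "Re w \<ge> 1/2")
    case True
    have "norm (zeta_entire w) \<le> 1 + norm (w - 1) * norm w * powr_sum (1 + 1/2)"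
      by (rule zeta_entire_right_bound) (use True in auto)
    also have "\<dots> = 1 + norm (w - 1) * norm w * C" by (simp add: C_def)
    also have "\<dots> \<le> 1 + L * L * C"
      using nw L R C by (intro add_left_mono mult_right_mono mult_mono) (auto simp: L_def)
    also have "\<dots> \<le> M * 1" using M C L2 by (simp add: power2_eq_square algebra_simps M_def C_def[symmetric])
    also have "\<dots> \<le> M * (2 * L) ^ k" using p1 M by (intro mult_left_mono) auto
    finally show ?thesis .
  next
    case False
    hence k: "k > 0" using less.prems by (cases k) auto
    have kn: "real k \<le> real n" using less.prems by simp
    \<comment> \<open>Taking K = k + 1 makes Re w + K at least 3/2, because Re w >= 1/2 - k; so one
      constant \<open>powr_sum (3/2)\<close> serves all strips.\<close>
    have "norm (zeta_entire w) \<le> 1 + (\<Sum>j=2..Suc k. norm (zeta_coeff (j - 1) (w - 1)) / fact j * norm (zeta_entire (w - 1 + of_nat j))) +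
           norm (zeta_coeff (Suc (Suc k)) (w - 1)) / fact (Suc k) * powr_sum (3/2)"
      by (rule zeta_entire_recurrence_bound) (use less.prems in auto)
    also have "(\<Sum>j=2..Suc k. norm (zeta_coeff (j - 1) (w - 1)) / fact j * norm (zeta_entire (w - 1 + of_nat j)))
       \<le> (\<Sum>j=2..Suc k. (1/2) ^ j * (M * (2 * L) ^ k))"
    proof (rule sum_mono)
      fix j assume j: "j \<in> {2..Suc k}"
      then obtain i where i: "j = Suc i" "i \<ge> 1" "i \<le> k" by (cases j) auto
      have 1: "norm (zeta_coeff i (w - 1)) \<le> L ^ i"
        by (rule norm_zeta_coeff_le) (use nw i kn in \<open>auto simp: L_def\<close>)
      have 2: "norm (zeta_entire (w - 1 + of_nat j)) \<le> M * (2 * L) ^ (k - i)"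
        by (rule less.IH) (use i less.prems False kn in \<open>auto simp: of_nat_diff\<close>)
      have f: "fact j \<ge> (2::real)" using fact_mono[of 2 j, where ?'a = real] j by simp
      have "norm (zeta_coeff (j - 1) (w - 1)) / fact j * norm (zeta_entire (w - 1 + of_nat j)) \<le>
         L ^ i / 2 * (M * (2 * L) ^ (k - i))"
        using 1 2 f i L by (intro mult_mono frac_le) auto
      also have "\<dots> = (1/2) ^ j * M * ((2 * L) ^ i * (2 * L) ^ (k - i))"
        using i by (simp add: power_mult_distrib field_simps)
      also have "(2 * L) ^ i * (2 * L) ^ (k - i) = (2 * L) ^ k" using i power_add[of "2 * L" i "k - i"] by simp
      finally show "norm (zeta_coeff (j - 1) (w - 1)) / fact j * norm (zeta_entire (w - 1 + of_nat j))
        \<le> (1/2) ^ j * (M * (2 * L) ^ k)" by simp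
    qed
    also have "\<dots> = (\<Sum>j=2..Suc k. (1/2) ^ j) * (M * (2 * L) ^ k)" by (rule sum_distrib_right [symmetric])
    also have "\<dots> \<le> 1/2 * (M * (2 * L) ^ k)"
      using M L by (intro mult_right_mono sum_half_power_le) auto
    also have "norm (zeta_coeff (Suc (Suc k)) (w - 1)) / fact (Suc k) * powr_sum (3/2) \<le> L ^ (Suc (Suc k)) / 1 * C"
      unfolding C_def[symmetric] using nw kn C L
      by (intro mult_right_mono frac_le norm_zeta_coeff_le) (auto simp: L_def fact_ge_1 simp del: fact_Suc power_Suc)
    also have "\<dots> = C * L\<^sup>2 * L ^ k" by (simp add: power2_eq_square)
    also have "\<dots> \<le> C * L\<^sup>2 * (2 * L) ^ k"
      using C L by (intro mult_left_mono power_mono) auto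
    also have "\<dots> \<le> M / 4 * (2 * L) ^ k" using M L by (intro mult_right_mono) auto
    \<comment> \<open>The budget M (2L)^k is shared out as 1/2 for the sum over j and 1/4 each for
      the constant 1 and the remainder, which explains the factor 4 in \<open>M\<close>.\<close>
    finally have "norm (zeta_entire w) \<le> 1 + 1/2 * (M * (2 * L) ^ k) + M / 4 * (2 * L) ^ k" by simp
    moreover have "1 \<le> M / 4 * (2 * L) ^ k" using M p1 mult_mono[of 1 "M/4" 1 "(2 * L) ^ k"] by auto
    moreover have "M / 4 * (2 * L) ^ k = 1/4 * (M * (2 * L) ^ k)" by simp
    ultimately show ?thesis by linarith
  qed
qed

text \<open>Reaching w takes max 0 (- Re w) + O(1) strips to the left of Re w = 1/2, and each strip
  costs a factor of order R. The powers of constants and the polynomial factors go into C R.\<close>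

lemma zeta_entire_growth:
  "\<exists>C>0. \<forall>R w. R \<ge> 2 \<and> norm w = R \<longrightarrow> norm (zeta_entire w) \<le> exp (max 0 (- Re w) * ln R + C * R)"
proof -
  define c where "c = 1 + powr_sum (3/2)"
  have c: "c \<ge> 1" using powr_sum(2)[of "3/2"] by (simp add: c_def)
  define C where "C = 256 * c + 20"
  have "norm (zeta_entire w) \<le> exp (max 0 (- Re w) * ln R + C * R)" if R: "R \<ge> 2" "norm w = R" for R w
  proof -
    define n where "n = nat \<lceil>R\<rceil> + 2"
    define k where "k = nat \<lceil>1/2 - Re w\<rceil>"
    define L where "L = R + 2 * real n + 3"
    define m where "m = max 0 (- Re w)"
    have rw: "\<bar>Re w\<bar> \<le> R" "\<bar>Im w\<bar> \<le> R" using R abs_Re_le_cmod abs_Im_le_cmod by auto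
    have k1: "real k \<ge> 1/2 - Re w" "real k \<le> m + 3/2" unfolding k_def m_def by linarith+
    have n: "real n \<ge> R + 2" "real n \<le> R + 3" unfolding n_def using R by linarith+
    have m: "m \<ge> 0" "m \<le> R" using rw by (auto simp: m_def)
    have kn: "k \<le> n" using k1 n m by linarith
    have L: "L \<le> 8 * R" "L \<ge> 1" using n R by (auto simp: L_def)
    have "norm (zeta_entire w) \<le> 4 * (1 + powr_sum (3/2)) * L\<^sup>2 * (2 * L) ^ k"
      unfolding L_def by (rule zeta_entire_strip_bound) (use R rw k1 n kn in auto)
    also have "\<dots> = 4 * c * (L\<^sup>2 * (2 * L) ^ k)" by (simp add: c_def)
    also have "\<dots> \<le> 4 * c * ((8 * R)\<^sup>2 * (16 * R) ^ k)"
      by (rule mult_left_mono, rule mult_mono; (rule power_mono)?) (use L c in auto)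
    also have "\<dots> = (256 * c) * R\<^sup>2 * (16 * R) ^ k" by (simp add: power_mult_distrib)
    also have "(256 * c) * R\<^sup>2 * (16 * R) ^ k \<le> (256 * c) * R\<^sup>2 * exp ((m + 3/2) * ln (16 * R))"
    proof (rule mult_left_mono)
      have "(16 * R) ^ k = (16 * R) powr real k" using R by (simp add: powr_realpow)
      also have "\<dots> \<le> (16 * R) powr (m + 3/2)" using k1 R by (intro powr_mono) auto
      also have "\<dots> = exp ((m + 3/2) * ln (16 * R))" using R by (simp add: powr_def)
      finally show "(16 * R) ^ k \<le> exp ((m + 3/2) * ln (16 * R))" .
    qed (use c in auto)
    also have "R\<^sup>2 = exp (2 * ln R)" using R by (simp add: exp_of_nat_mult [of 2, simplified])
    also have "256 * c = exp (ln (256 * c))" using c by simp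
    also have "exp (ln (256 * c)) * exp (2 * ln R) * exp ((m + 3/2) * ln (16 * R)) =
       exp (ln (256 * c) + 2 * ln R + (m + 3/2) * ln (16 * R))" by (simp add: exp_add)
    also have "\<dots> \<le> exp (m * ln R + C * R)"
    proof -
      have l16: "ln (16::real) \<le> 4"
      proof -
        have "ln (16::real) = 4 * ln 2" using ln_realpow[of 2 4] by simp
        thus ?thesis using ln_le_minus_one[of "2::real"] by simp
      qed
      have "ln (256 * c) \<le> 256 * c * R" using ln_le_minus_one[of "256 * c"] c R
         mult_left_mono[of 1 R "256 * c"] by (smt (verit))
      moreover have "2 * ln R \<le> 2 * R" using ln_le_minus_one[of R] R by simp
      moreover have "(m + 3/2) * ln (16 * R) = m * ln R + m * ln 16 + 3/2 * ln 16 + 3/2 * ln R"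
        using R by (simp add: ln_mult algebra_simps)
      moreover have "m * ln 16 \<le> R * 4" using m l16 by (intro mult_mono) auto
      moreover have "3/2 * ln 16 \<le> 6 * R" using l16 R by simp
      moreover have "3/2 * ln R \<le> 2 * R" using ln_le_minus_one[of R] R by simp
      ultimately show ?thesis using R by (simp add: C_def algebra_simps)
    qed
    finally show ?thesis by (simp add: m_def)
  qed
  thus ?thesis using c by (intro exI[of _ C]) (auto simp: C_def)
qed

text \<open>The condition Re s > -1 discards the trivial zeros, the first of which is -2, and F(1) =
  1 discards s = 1.\<close>

lemma zeta_entire_zero_RH:
  assumes "riemann_hypothesis" "zeta_entire s = 0" "Re s > -1"
  shows "Re s = 1/2"
proof -
  have s1: "s \<noteq> 1" using assms zeta_entire_1 by auto
  hence "riemann_zeta s = 0" using zeta_entire_riemann_zeta[OF s1] assms by auto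
  moreover have "s \<noteq> - 2 * of_nat (Suc k)" for k
    using assms(3) by auto
  ultimately have "s \<in> nontrivial_zeta_zeros" using s1 by (auto simp: nontrivial_zeta_zeros_def)
  thus ?thesis using assms(1) by (auto simp: riemann_hypothesis_def)
qed

section \<open>The Dirichlet series of the logarithmic derivative\<close>

lemma norm_dirichlet_term: "norm (1 / of_nat (Suc n) powr s :: complex) = real (Suc n) powr (- Re s)"
  using norm_powr_real_powr[of "of_nat (Suc n)" s]
  by (simp add: norm_divide powr_minus field_simps del: of_nat_Suc)

lemma summable_powr_Suc: "a > 1 \<Longrightarrow> summable (\<lambda>n. real (Suc n) powr (- a))"
  by (subst summable_Suc_iff) (simp add: summable_real_powr_iff)

lemma summable_ln_powr_Suc:
  assumes "a > 2"
  shows "summable (\<lambda>n. ln (real (Suc n)) * real (Suc n) powr (- a))"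
proof (rule summable_comparison_test_ev)
  show "\<forall>\<^sub>F n in sequentially. norm (ln (real (Suc n)) * real (Suc n) powr (- a)) \<le> real (Suc n) powr (- (a - 1))"
  proof (intro always_eventually allI)
    fix n
    have "ln (real (Suc n)) \<le> real (Suc n)" using ln_le_minus_one[of "real (Suc n)"] by simp
    hence "ln (real (Suc n)) * real (Suc n) powr (- a) \<le> real (Suc n) powr 1 * real (Suc n) powr (- a)"
      by (intro mult_right_mono) auto
    also have "\<dots> = real (Suc n) powr (- (a - 1))" by (subst powr_add [symmetric]) (simp add: algebra_simps)
    finally show "norm (ln (real (Suc n)) * real (Suc n) powr (- a)) \<le> real (Suc n) powr (- (a - 1))"
      by simp
  qed
  show "summable (\<lambda>n. real (Suc n) powr (- (a - 1)))" using assms by (intro summable_powr_Suc) auto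
qed

lemma has_sum_Suc_reindex: "(f has_sum S) {0<..} \<longleftrightarrow> ((\<lambda>n::nat. f (Suc n)) has_sum S) UNIV"
  using has_sum_reindex[of Suc UNIV f S] by (simp add: o_def image_Suc_lessThan greaterThan_0)

text \<open>For n >= 2 the term n^(-2) is at most 1 / ((n - 1/2) (n + 1/2)), which telescopes to
  2/3. A bound below 1 keeps zeta away from 0 on Re s >= 2 without the Euler product.\<close>

lemma norm_zeta_dirichlet_minus_1:
  assumes s: "Re s \<ge> 2"
  shows "norm (zeta_dirichlet s - 1) \<le> 2/3"
proof -
  define v where "v = (\<lambda>n::nat. 1 / of_nat n powr s :: complex)"
  have nv: "norm (v (Suc n)) = real (Suc n) powr (- Re s)" for n
    unfolding v_def norm_dirichlet_term ..
  have v_sums: "(\<lambda>n. v (Suc n)) sums zeta_dirichlet s" using zeta_dirichlet_sums[of s] s by (simp add: v_def)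
  hence "(\<lambda>n. v (Suc (Suc n))) sums (zeta_dirichlet s - v (Suc 0))" by (subst sums_Suc_iff) simp
  hence eq: "zeta_dirichlet s - 1 = (\<Sum>n. v (Suc (Suc n)))" by (simp add: sums_iff v_def)
  define b where "b = (\<lambda>n. 1 / (real n + 3/2))"
  have "b \<longlonglongrightarrow> 0" unfolding b_def by real_asymp
  from telescope_sums'[OF this] have b: "(\<lambda>n. b n - b (Suc n)) sums (2/3)" by (simp add: b_def)
  have "norm (\<Sum>n. v (Suc (Suc n))) \<le> (\<Sum>n. b n - b (Suc n))"
  proof (rule norm_suminf_le)
    fix n
    have "norm (v (Suc (Suc n))) \<le> real (Suc (Suc n)) powr (-2)" unfolding nv using s by (intro powr_mono) auto
    also have "\<dots> = 1 / (real n + 2)\<^sup>2" by (simp add: powr_minus powr_numeral divide_inverse)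
    also have "\<dots> \<le> 1 / ((real n + 3/2) * (real n + 5/2))"
      by (intro divide_left_mono mult_pos_pos) (auto simp: power2_eq_square algebra_simps add_pos_nonneg)
    also have "\<dots> = b n - b (Suc n)"
      by (simp add: b_def field_simps)
    finally show "norm (v (Suc (Suc n))) \<le> b n - b (Suc n)" .
  qed (use b in \<open>simp add: sums_iff\<close>)
  thus ?thesis using b by (simp add: eq sums_iff)
qed

text \<open>The divisor sum of \<Lambda> is ln, so the series of \<Lambda> times zeta is -zeta';
  dividing by zeta and writing zeta = F / (s - 1) gives the claim. With Re s > 2 the crude ln n <= n
  already gives absolute convergence, and Perron's formula will be used on Re s = 3.\<close>

lemma mangoldt_dirichlet_series:
  assumes s: "Re s > 2"
  shows "(\<lambda>n. mangoldt (Suc n) * (1 / of_nat (Suc n) powr s)) sums (1 / (s - 1) - deriv zeta_entire s / zeta_entire s)"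
    and "zeta_entire s \<noteq> 0"
proof -
  define S where "S = {s. Re s > 2}"
  have S: "open S" "s \<in> S" using s by (auto simp: S_def open_halfspace_Re_gt)
  define f where "f = (\<lambda>n s. 1 / of_nat (Suc n) powr s :: complex)"
  define f' where "f' = (\<lambda>n s. - of_real (ln (real (Suc n))) * (1 / of_nat (Suc n) powr s) :: complex)"
  obtain g g' where g: "\<And>x. x \<in> S \<Longrightarrow> (\<lambda>n. f n x) sums g x" "\<And>x. x \<in> S \<Longrightarrow> (\<lambda>n. f' n x) sums g' x"
     "\<And>x. x \<in> S \<Longrightarrow> (g has_field_derivative g' x) (at x)"
  proof (rule series_and_derivative_comparison[OF S(1), of "\<lambda>n. real (Suc n) powr (-2)" f f'])
    show "summable (\<lambda>n. real (Suc n) powr (-2))" by (rule summable_powr_Suc) auto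
    show "(f n has_field_derivative f' n x) (at x)" if "x \<in> S" for n x
    proof -
      have "f n = (\<lambda>s. of_nat (Suc n) powr (- s))"
        by (auto simp: f_def powr_minus divide_inverse)
      moreover have "((\<lambda>s. of_nat (Suc n) powr (- s)) has_field_derivative
         - (of_nat (Suc n) powr (- x) * Ln (of_nat (Suc n)))) (at x)"
      proof -
        have "((\<lambda>s. c powr (- s)) has_field_derivative - (c powr (- x) * Ln c)) (at x)" if "c \<noteq> 0" for c :: complex
          using that by (auto simp: powr_def intro!: derivative_eq_intros)
        thus ?thesis using of_nat_neq_0 by blast
      qed
      moreover have "Ln (of_nat (Suc n)) = of_real (ln (real (Suc n)))" by (subst Ln_of_nat) auto
      ultimately show ?thesis by (simp add: f'_def powr_minus divide_inverse mult_ac del: of_nat_Suc)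
    qed
    show "\<forall>\<^sub>F n in sequentially. \<forall>x\<in>S. norm (f n x) \<le> real (Suc n) powr (-2)"
      unfolding f_def norm_dirichlet_term
      by (intro always_eventually allI ballI powr_mono) (auto simp: S_def)
  qed (use that in blast)
  have gD: "g x = zeta_dirichlet x" if "x \<in> S" for x
    using g(1)[OF that] zeta_dirichlet_sums[of x] that sums_unique2 by (fastforce simp: S_def f_def)
  have FS: "zeta_entire x = (x - 1) * g x" if "x \<in> S" for x
    using zeta_entire_dirichlet[of x] gD[OF that] that by (auto simp: S_def)
  have dF: "deriv zeta_entire s = g s + (s - 1) * g' s"
  proof (rule DERIV_imp_deriv)
    have "((\<lambda>x. (x - 1) * g x) has_field_derivative g s + (s - 1) * g' s) (at s)"
      by (auto intro!: derivative_eq_intros g(3) S simp: algebra_simps)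
    thus "(zeta_entire has_field_derivative g s + (s - 1) * g' s) (at s)"
      by (rule has_field_derivative_transform_within_open[OF _ S]) (use FS in auto)
  qed
  define v where "v = (\<lambda>n::nat. 1 / of_nat n powr s :: complex)"
  define u where "u = (\<lambda>n::nat. mangoldt n * v n :: complex)"
  have nv: "norm (v (Suc n)) = real (Suc n) powr (- Re s)" for n
    unfolding v_def norm_dirichlet_term ..
  have nu: "norm (u (Suc n)) \<le> ln (real (Suc n)) * real (Suc n) powr (- Re s)" for n
    unfolding u_def norm_mult nv norm_mangoldt by (intro mult_right_mono mangoldt_le) auto
  have sv: "summable (\<lambda>n. norm (v (Suc n)))" unfolding nv using s by (intro summable_powr_Suc) auto
  have su: "summable (\<lambda>n. norm (u (Suc n)))"
    by (rule summable_comparison_test'[OF summable_ln_powr_Suc[OF s], of 0]) (use nu in auto)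
  define U where "U = (\<Sum>n. u (Suc n))"
  have U_sums: "(\<lambda>n. u (Suc n)) sums U" unfolding U_def
    by (rule summable_sums[OF summable_norm_cancel[OF su]])
  have v_sums: "(\<lambda>n. v (Suc n)) sums g s" using g(1)[OF S(2)] by (simp add: f_def v_def)
  have U: "(u has_sum U) {0<..}" unfolding has_sum_Suc_reindex
    by (rule norm_summable_imp_has_sum[OF su U_sums])
  have V: "(v has_sum g s) {0<..}" unfolding has_sum_Suc_reindex
    by (rule norm_summable_imp_has_sum[OF sv v_sums])
  have nvs: "(\<lambda>n. norm (v n)) summable_on {0<..}"
    using norm_summable_imp_summable_on[of "\<lambda>n. norm (v (Suc n))"] sv has_sum_Suc_reindex[of "\<lambda>n. norm (v n)"]
    by (auto simp: summable_on_def)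
  have nus: "(\<lambda>n. norm (u n)) summable_on {0<..}"
    using norm_summable_imp_summable_on[of "\<lambda>n. norm (u (Suc n))"] su has_sum_Suc_reindex[of "\<lambda>n. norm (u n)"]
    by (auto simp: summable_on_def)
  \<comment> \<open>Absolute summability over all pairs (m, n) is what permits regrouping the
    product of the two series by k = m n.\<close>
  have uv: "(\<lambda>(m, n). u m * v n) summable_on ({0<..} \<times> {0<..})"
  proof (rule abs_summable_summable)
    show "(\<lambda>x. norm (case x of (m, n) \<Rightarrow> u m * v n)) summable_on ({0<..} \<times> {0<..})"
      unfolding Infinite_Sum.abs_summable_on_Sigma_iff
    proof (intro conjI ballI)
      show "(\<lambda>n. norm (case (m, n) of (m, n) \<Rightarrow> u m * v n)) summable_on {0<..}" for m
        using summable_on_cmult_right[OF nvs, of "norm (u m)"] by (simp add: norm_mult)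
      show "(\<lambda>m. norm (infsum (\<lambda>n. norm (case (m, n) of (m, n) \<Rightarrow> u m * v n)) {0<..})) summable_on {0<..}"
        using summable_on_cmult_left[OF nus, of "infsum (\<lambda>n. norm (v n)) {0<..}"]
        by (simp add: norm_mult infsum_cmult_right' abs_mult infsum_nonneg)
    qed
  qed
  then obtain P where P: "((\<lambda>(m, n). u m * v n) has_sum P) ({0<..} \<times> {0<..})"
    by (auto simp: summable_on_def)
  have "((\<lambda>m. u m * g s) has_sum P) {0<..}"
    by (rule has_sum_SigmaD[OF P]) (use has_sum_cmult_right[OF V] in auto)
  moreover have "((\<lambda>m. u m * g s) has_sum (U * g s)) {0<..}"
    by (rule has_sum_cmult_left[OF U])
  ultimately have PU: "P = U * g s" by (rule has_sum_unique)
  have "((\<lambda>(k, m). u m * v (k div m)) has_sum P) (SIGMA k:{0<..}. {m. m dvd k})"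
    using P
    by (subst (asm) has_sum_reindex_bij_witness[where j = "\<lambda>(m, n). (m * n, m)" and i = "\<lambda>(k, m). (m, k div m)"
          and T = "SIGMA k:{0<..}. {m. m dvd k}" and h = "\<lambda>(k, m). u m * v (k div m)" and s' = P])
       (auto simp: dvd_def)
  hence "((\<lambda>k. \<Sum>m | m dvd k. u m * v (k div m)) has_sum P) {0<..}"
    by (rule has_sum_SigmaD) (auto intro!: has_sum_finite)
  hence "((\<lambda>n. \<Sum>m | m dvd Suc n. u m * v (Suc n div m)) has_sum P) UNIV"
    unfolding has_sum_Suc_reindex .
  moreover have "(\<Sum>m | m dvd Suc n. u m * v (Suc n div m)) = - f' n s" for n
  proof -
    have "(\<Sum>m | m dvd Suc n. u m * v (Suc n div m)) = (\<Sum>m | m dvd Suc n. mangoldt m * v (Suc n))"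
    proof (rule sum.cong[OF refl])
      fix m assume "m \<in> {m. m dvd Suc n}"
      then obtain k where k: "Suc n = m * k" by auto
      hence mk: "m > 0" "k > 0" by (auto intro!: Nat.gr0I)
      have "v m * v (Suc n div m) = v (Suc n)"
      proof -
        have "complex_of_nat (m * k) powr s = of_nat m powr s * of_nat k powr s"
          by (simp add: powr_times_real)
        thus ?thesis unfolding k using mk by (simp add: v_def del: of_nat_mult)
      qed
      thus "u m * v (Suc n div m) = mangoldt m * v (Suc n)" by (simp add: u_def)
    qed
    also have "\<dots> = of_real (ln (real (Suc n))) * v (Suc n)"
      by (subst sum_distrib_right [symmetric], subst mangoldt_sum) auto
    finally show ?thesis by (simp add: f'_def v_def)
  qed
  ultimately have "(\<lambda>n. - f' n s) sums P" using has_sum_imp_sums by fastforce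
  moreover have "(\<lambda>n. - f' n s) sums (- g' s)" using g(2)[OF S(2)] by (rule sums_minus)
  ultimately have Ug: "U * g s = - g' s" using PU sums_unique2 by blast
  have g0: "g s \<noteq> 0"
  proof -
    have "norm (g s - 1) \<le> 2/3" using norm_zeta_dirichlet_minus_1[of s] s gD[OF S(2)] by simp
    thus ?thesis by auto
  qed
  have s1: "s \<noteq> 1" using s by auto
  show F0: "zeta_entire s \<noteq> 0" using g0 s1 FS[OF S(2)] by simp
  have "deriv zeta_entire s / zeta_entire s = 1 / (s - 1) + g' s / g s"
    unfolding dF FS[OF S(2)] using g0 s1 by (simp add: field_simps)
  also have "g' s / g s = - U" using Ug g0 by (simp add: field_simps add_eq_0_iff)
  finally have "U = 1 / (s - 1) - deriv zeta_entire s / zeta_entire s" by simp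
  thus "(\<lambda>n. mangoldt (Suc n) * (1 / of_nat (Suc n) powr s)) sums (1 / (s - 1) - deriv zeta_entire s / zeta_entire s)"
    using U_sums by (simp add: u_def v_def)
qed

section \<open>Reciprocal sums over the zeros\<close>

lemma has_integral_real_derivative:
  assumes "a \<le> b" "\<And>t. t \<in> {a..b} \<Longrightarrow> (F has_real_derivative f t) (at t)"
  shows "(f has_integral (F b - F a)) {a..b}"
  using assms by (intro fundamental_theorem_of_calculus)
    (auto simp: has_real_derivative_iff_has_vector_derivative has_vector_derivative_at_within)

abbreviation zmult :: "complex \<Rightarrow> nat" where "zmult z \<equiv> nat (zorder zeta_entire z)"

abbreviation logderiv_zeta :: "complex \<Rightarrow> complex" where
  "logderiv_zeta s \<equiv> deriv zeta_entire s / zeta_entire s"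

abbreviation zero_term :: "real \<Rightarrow> complex \<Rightarrow> complex" where
  "zero_term x z \<equiv> of_nat (zmult z) * (of_real x powr z / z)"

lemma ln_ge_one: "x \<ge> 3 \<Longrightarrow> ln x \<ge> (1 :: real)"
  using exp_le by (subst ln_ge_iff) auto

lemma finite_zeta_zeros: "bounded K \<Longrightarrow> finite {z\<in>K. zeta_entire z = 0}"
  by (rule finite_zeros_entire[of _ 1]) (auto simp: zeta_entire_1 intro: zeta_entire_holomorphic)

lemma integral_neg_part_cos:
  "((\<lambda>t. max 0 (- cos (2 * pi * t))) has_integral (1 / pi)) {0..1}"
proof -
  have ge: "cos (2 * pi * t) \<ge> 0" if t: "0 \<le> t \<and> t \<le> 1/4 \<or> 3/4 \<le> t \<and> t \<le> 1" for t
  proof -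
    consider "0 \<le> t" "t \<le> 1/4" | "3/4 \<le> t" "t \<le> 1" using t by blast
    thus ?thesis
    proof cases
      case 1
      have "2 * pi * t \<le> pi / 2" using 1 mult_left_mono[of t "1/4" "2 * pi"] by simp
      thus ?thesis using 1 by (intro cos_ge_zero order.trans[OF _ mult_nonneg_nonneg[of "2 * pi" t]]) auto
    next
      case 2
      have "2 * pi * (1 - t) \<le> pi / 2" using 2 mult_left_mono[of "1 - t" "1/4" "2 * pi"] by simp
      hence "cos (2 * pi * (1 - t)) \<ge> 0"
        using 2 by (intro cos_ge_zero order.trans[OF _ mult_nonneg_nonneg[of "2 * pi" "1 - t"]]) auto
      also have "cos (2 * pi * (1 - t)) = cos (2 * pi - 2 * pi * t)" by (simp add: algebra_simps)
      also have "\<dots> = cos (2 * pi * t)" by (rule cos_2pi_minus)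
      finally show ?thesis .
    qed
  qed
  have le: "cos (2 * pi * t) \<le> 0" if "1/4 \<le> t" "t \<le> 3/4" for t
  proof -
    have "cos (2 * pi * t - pi) \<ge> 0"
    proof (rule cos_ge_zero)
      have "2 * pi * t \<le> 2 * pi * (3/4)" "2 * pi * (1/4) \<le> 2 * pi * t"
        using that by (auto intro: mult_left_mono)
      thus "- (pi / 2) \<le> 2 * pi * t - pi" "2 * pi * t - pi \<le> pi / 2" by linarith+
    qed
    thus ?thesis by (simp add: cos_diff)
  qed
  have z: "((\<lambda>t. max 0 (- cos (2 * pi * t))) has_integral 0) {a..b}" if "{a..b} \<subseteq> {0..1/4} \<union> {3/4..1}" for a b
    by (rule has_integral_eq[OF _ has_integral_0]) (use that ge in \<open>force simp: max_def\<close>)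
  have "((\<lambda>t. - cos (2 * pi * t)) has_integral (- sin (2 * pi * (3/4)) / (2 * pi) - (- sin (2 * pi * (1/4)) / (2 * pi)))) {1/4..3/4}"
    by (rule fundamental_theorem_of_calculus)
       (auto intro!: derivative_eq_intros simp flip: has_real_derivative_iff_has_vector_derivative)
  also have "2 * pi * (3/4) = 3 / 2 * pi" by simp
  also have "2 * pi * (1/4) = pi / 2" by simp
  also have "(- sin (3 / 2 * pi) / (2 * pi) - (- sin (pi / 2) / (2 * pi))) = 1 / pi"
    unfolding sin_3over2_pi sin_pi_half by (simp add: field_simps)
  finally have m: "((\<lambda>t. max 0 (- cos (2 * pi * t))) has_integral (1 / pi)) {1/4..3/4}"
    by (rule has_integral_eq[rotated]) (use le in auto)
  have "((\<lambda>t. max 0 (- cos (2 * pi * t))) has_integral (0 + 1 / pi)) {0..3/4}"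
    by (rule has_integral_combine[OF _ _ z m]) auto
  from has_integral_combine[OF _ _ this z[of "3/4" 1]]
  show ?thesis by auto
qed

lemma zeta_entire_0_RH: "riemann_hypothesis \<Longrightarrow> zeta_entire 0 \<noteq> 0"
  using zeta_entire_zero_RH[of 0] by auto

text \<open>Jensen's formula on a large circle.  The constant \<open>1/\<pi>\<close> is the mean of the negative part of the
  cosine, since \<open>ln |zeta_entire z|\<close> is at most \<open>max 0 (- Re z) * ln |z| + O(|z|)\<close>.\<close>

lemma zeta_zeros_log_sum:
  assumes RH: riemann_hypothesis
  shows "\<exists>C>0. \<forall>R\<ge>2.
    (\<Sum>z | z \<in> ball 0 R \<and> zeta_entire z = 0. real (zmult z) * ln (R / norm z)) \<le> R * ln R / pi + C * R"
proof -
  obtain C0 where C0: "C0 > 0"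
    "\<And>R w. R \<ge> 2 \<Longrightarrow> norm w = R \<Longrightarrow> norm (zeta_entire w) \<le> exp (max 0 (- Re w) * ln R + C0 * R)"
    using zeta_entire_growth by blast
  have F0: "zeta_entire 0 \<noteq> 0" using zeta_entire_0_RH[OF RH] .
  define C where "C = 2 * C0 + 2 + \<bar>ln (norm (zeta_entire 0))\<bar>"
  have "(\<Sum>z | z \<in> ball 0 R \<and> zeta_entire z = 0. real (zmult z) * ln (R / norm z)) \<le> R * ln R / pi + C * R"
    if R: "R \<ge> 2" for R
  proof -
    define W where "W = {z\<in>ball 0 (R+2). zeta_entire z = 0}"
    have W: "finite W" unfolding W_def by (intro finite_zeta_zeros) auto
    \<comment> \<open>Jensen's inequality needs a circle free of zeros, and only finitely many radii
      are bad. Enlarging R by less than 1 changes R ln R by O(R) only.\<close>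
    have "infinite ({R<..<R+1} - norm ` W)" using W by (intro Diff_infinite_finite) auto
    then obtain R' where R': "R < R'" "R' < R + 1" "R' \<notin> norm ` W"
      by (metis Diff_iff ex_in_conv finite.emptyI greaterThanLessThan_iff)
    define U where "U = (\<lambda>t. max 0 (- cos (2 * pi * t)) * (R' * ln R') + C0 * R')"
    have lnR': "ln R' > 0" using R R' by simp
    have J: "(\<Sum>z | z \<in> ball 0 R' \<and> zeta_entire z = 0. real (zmult z) * ln (R' / norm (z - 0)))
           \<le> integral {0..1} U - ln (norm (zeta_entire 0))"
    proof (rule jensen_inequality[OF zeta_entire_holomorphic F0])
      show "continuous_on {0..1} U" unfolding U_def by (intro continuous_intros)
      show "zeta_entire z \<noteq> 0" if "z \<in> sphere 0 R'" for z
        using R' that by (auto simp: W_def)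
      show "norm (zeta_entire (circlepath 0 R' t)) \<le> exp (U t)" if "t \<in> {0..1}" for t
      proof -
        have e: "exp (2 * of_real pi * \<i> * of_real t) = cis (2 * pi * t)"
          by (simp add: cis_conv_exp mult_ac)
        have "norm (circlepath 0 R' t) = R'" "Re (circlepath 0 R' t) = R' * cos (2 * pi * t)"
          unfolding circlepath e using R R' by (auto simp: norm_mult)
        hence "norm (zeta_entire (circlepath 0 R' t)) \<le> exp (max 0 (- (R' * cos (2 * pi * t))) * ln R' + C0 * R')"
          using C0(2)[of R' "circlepath 0 R' t"] R R' by auto
        also have "max 0 (- (R' * cos (2 * pi * t))) = R' * max 0 (- cos (2 * pi * t))"
          using R R' by (auto simp: max_def mult_le_0_iff zero_le_mult_iff)
        finally show ?thesis by (simp add: U_def mult_ac)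
      qed
    qed (use R R' in auto)
    have "(U has_integral (1 / pi * (R' * ln R') + C0 * R')) {0..1}"
      unfolding U_def
      using has_integral_add[OF has_integral_mult_left[OF integral_neg_part_cos, of "R' * ln R'"]
        has_integral_const_real[of "C0 * R'" 0 1]] by simp
    hence I: "integral {0..1} U = R' * ln R' / pi + C0 * R'" by (simp add: integral_unique)
    have "(\<Sum>z | z \<in> ball 0 R \<and> zeta_entire z = 0. real (zmult z) * ln (R / norm z)) \<le>
       (\<Sum>z | z \<in> ball 0 R' \<and> zeta_entire z = 0. real (zmult z) * ln (R' / norm (z - 0)))"
    proof (rule order.trans[OF sum_mono sum_mono2])
      fix z assume z: "z \<in> {z. z \<in> ball 0 R \<and> zeta_entire z = 0}"
      hence "norm z > 0" using F0 by auto
      thus "real (zmult z) * ln (R / norm z) \<le> real (zmult z) * ln (R' / norm (z - 0))"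
        using R R' by (intro mult_left_mono) (auto simp: divide_right_mono)
    next
      show "finite {z. z \<in> ball 0 R' \<and> zeta_entire z = 0}" using finite_zeta_zeros[of "ball 0 R'"] by simp
      show "{z. z \<in> ball 0 R \<and> zeta_entire z = 0} \<subseteq> {z. z \<in> ball 0 R' \<and> zeta_entire z = 0}" using R' by auto
      fix z assume "z \<in> {z. z \<in> ball 0 R' \<and> zeta_entire z = 0} - {z. z \<in> ball 0 R \<and> zeta_entire z = 0}"
      hence "norm z < R'" "norm z > 0" using F0 by auto
      thus "0 \<le> real (zmult z) * ln (R' / norm (z - 0))" by (intro mult_nonneg_nonneg) auto
    qed
    also have "\<dots> \<le> R' * ln R' / pi + C0 * R' - ln (norm (zeta_entire 0))" using J I by simp
    also have "R' * ln R' \<le> R * ln R + R + 2"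
    proof -
      have "ln R' \<le> ln (R + 1)" using R R' by simp
      also have "R + 1 = R * (1 + 1 / R)" using R by (simp add: field_simps)
      also have "ln (R * (1 + 1 / R)) = ln R + ln (1 + 1 / R)" using R by (intro ln_mult_pos add_pos_pos) auto
      also have "ln (1 + 1 / R) \<le> 1 / R" using R by (intro ln_add_one_self_le_self) auto
      finally have "R' * ln R' \<le> (R + 1) * (ln R + 1 / R)" using R R' lnR' by (intro mult_mono) auto
      also have "\<dots> = R * ln R + ln R + 1 + 1 / R" using R by (simp add: field_simps)
      also have "\<dots> \<le> R * ln R + R + 2"
      proof -
        have "1 / R \<le> 1" using R by simp
        thus ?thesis using ln_le_minus_one[of R] R by linarith
      qed
      finally show ?thesis .
    qed
    also have "(R * ln R + R + 2) / pi \<le> R * ln R / pi + (R + 2) / 1"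
      unfolding add_divide_distrib add.assoc using R pi_gt3
      by (intro add_left_mono add_mono divide_left_mono) auto
    also have "C0 * R' \<le> C0 * (2 * R)" using R R' C0 by (intro mult_left_mono) auto
    also have "R * ln R / pi + (R + 2) / 1 + C0 * (2 * R) - ln (norm (zeta_entire 0)) \<le> R * ln R / pi + C * R"
    proof -
      have "- ln (norm (zeta_entire 0)) \<le> \<bar>ln (norm (zeta_entire 0))\<bar> * R"
        using R mult_left_mono[of 1 R "\<bar>ln (norm (zeta_entire 0))\<bar>"] by linarith
      thus ?thesis using R by (simp add: C_def algebra_simps)
    qed
    finally show ?thesis by (simp add: divide_right_mono)
  qed
  thus ?thesis using C0(1) by (intro exI[of _ C]) (auto simp: C_def)
qed

lemma zeta_zero_norm_ge:
  assumes "riemann_hypothesis" "zeta_entire z = 0"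
  shows "norm z \<ge> 1/2"
proof (cases "Re z > -1")
  case True
  thus ?thesis using zeta_entire_zero_RH[OF assms] abs_Re_le_cmod[of z] by simp
next
  case False
  thus ?thesis using abs_Re_le_cmod[of z] by linarith
qed

text \<open>Extending the kernel by 0 below a gives all zeros the same interval of integration, so
  that a finite sum over zeros can be moved under the integral. An antiderivative above a is -(1 +
  ln (r / a)) / r.\<close>

lemma has_integral_log_kernel:
  fixes a b T :: real
  assumes "0 < b" "b \<le> a" "a \<le> T"
  shows "((\<lambda>r. if r \<le> a then 0 else ln (r / a) / r\<^sup>2) has_integral (1 / a - (1 + ln (T / a)) / T)) {b..T}"
proof -
  have 1: "((\<lambda>r. if r \<le> a then 0 else ln (r / a) / r\<^sup>2) has_integral 0) {b..a}"
    by (rule has_integral_eq[OF _ has_integral_0]) auto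
  have "((\<lambda>r. ln (r / a) / r\<^sup>2) has_integral (- (1 + ln (T / a)) / T - (- (1 + ln (a / a)) / a))) {a..T}"
  proof (rule has_integral_real_derivative)
    fix r assume r: "r \<in> {a..T}"
    thus "((\<lambda>r. - (1 + ln (r / a)) / r) has_real_derivative ln (r / a) / r\<^sup>2) (at r)"
      using assms by (auto intro!: derivative_eq_intros simp: field_simps power2_eq_square)
  qed (use assms in auto)
  hence 2: "((\<lambda>r. if r \<le> a then 0 else ln (r / a) / r\<^sup>2) has_integral (1 / a - (1 + ln (T / a)) / T)) {a..T}"
    by (rule has_integral_eq[rotated, THEN has_integral_eq_rhs]) (use assms in \<open>auto simp: diff_divide_distrib add_divide_distrib\<close>)
  from has_integral_combine[OF _ _ 1 2] show ?thesis using assms by simp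
qed

text \<open>Partial summation in integral form, using
  \<open>1 / |z| = \<integral> ln (r / |z|) / r\<^sup>2 dr + (1 + ln (T / |z|)) / T\<close> with \<open>r\<close> from \<open>|z|\<close> to \<open>T\<close>.\<close>

lemma zeta_zeros_reciprocal_sum:
  assumes RH: riemann_hypothesis
  shows "\<exists>C>0. \<forall>T\<ge>2.
    (\<Sum>z | z \<in> ball 0 T \<and> zeta_entire z = 0. real (zmult z) / norm z) \<le> (ln T)\<^sup>2 / (2 * pi) + C * (1 + ln T)"
proof -
  obtain C0 where C0': "C0 > 0" "\<forall>R\<ge>2.
    (\<Sum>z | z \<in> ball 0 R \<and> zeta_entire z = 0. real (zmult z) * ln (R / norm z)) \<le> R * ln R / pi + C0 * R"
    using zeta_zeros_log_sum[OF RH] by (elim exE conjE) (rule that)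
  note C0 = C0'(1) C0'(2)[rule_format]
  have fin: "finite {z. z \<in> ball 0 R \<and> zeta_entire z = 0}" for R :: real
    using finite_zeta_zeros[of "ball 0 R"] by simp
  have zpos: "norm z > 0" if "zeta_entire z = 0" for z
    using zeta_zero_norm_ge[OF RH that] by linarith
  define S0 where "S0 = (\<Sum>z | z \<in> ball 0 2 \<and> zeta_entire z = 0. real (zmult z) / norm z)"
  have S0: "S0 \<ge> 0" unfolding S0_def by (intro sum_nonneg) auto
  define C where "C = S0 + 4 * C0 + 1"
  have "(\<Sum>z | z \<in> ball 0 T \<and> zeta_entire z = 0. real (zmult z) / norm z) \<le> (ln T)\<^sup>2 / (2 * pi) + C * (1 + ln T)"
    if T: "T \<ge> 2" for T
  proof -
    \<comment> \<open>Zeros with |z| < 2 go into the constant \<open>S0\<close>, since the Jensen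
      bound is available from radius 2 on.\<close>
    define Z where "Z = {z. norm z < T \<and> norm z \<ge> 2 \<and> zeta_entire z = 0}"
    have Z: "finite Z" by (rule finite_subset[OF _ fin[of T]]) (auto simp: Z_def)
    have lnT: "ln T \<ge> 0" using T by simp
    define \<phi> where "\<phi> = (\<lambda>z r. if r \<le> norm (z::complex) then 0 else ln (r / norm z) / r\<^sup>2)"
    have \<phi>: "(\<phi> z has_integral (1 / norm z - (1 + ln (T / norm z)) / T)) {2..T}" if "z \<in> Z" for z
      unfolding \<phi>_def by (rule has_integral_log_kernel) (use that in \<open>auto simp: Z_def\<close>)
    have I1: "((\<lambda>r. \<Sum>z\<in>Z. real (zmult z) * \<phi> z r) has_integral
        (\<Sum>z\<in>Z. real (zmult z) * (1 / norm z - (1 + ln (T / norm z)) / T))) {2..T}"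
      by (intro has_integral_sum Z has_integral_mult_right \<phi>)
    \<comment> \<open>The Jensen bound r ln r / pi, integrated against dr / r^2, produces the main
      term (ln T)^2 / (2 pi).\<close>
    have I2: "((\<lambda>r. ln r / (pi * r) + C0 / r) has_integral
       ((ln T)\<^sup>2 / (2 * pi) + C0 * ln T - ((ln 2)\<^sup>2 / (2 * pi) + C0 * ln 2))) {2..T}"
    proof (rule has_integral_real_derivative)
      fix r assume r: "r \<in> {2..T}"
      thus "((\<lambda>r. (ln r)\<^sup>2 / (2 * pi) + C0 * ln r) has_real_derivative ln r / (pi * r) + C0 / r) (at r)"
        by (auto intro!: derivative_eq_intros simp: field_simps)
    qed (use T in auto)
    have "(\<Sum>z\<in>Z. real (zmult z) * (1 / norm z - (1 + ln (T / norm z)) / T)) \<le>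
        (ln T)\<^sup>2 / (2 * pi) + C0 * ln T - ((ln 2)\<^sup>2 / (2 * pi) + C0 * ln 2)"
    proof (rule has_integral_le[OF I1 I2])
      fix r assume r: "r \<in> {2..T}"
      have "(\<Sum>z\<in>Z. real (zmult z) * \<phi> z r) = (\<Sum>z | z \<in> Z \<and> norm z < r. real (zmult z) * ln (r / norm z)) / r\<^sup>2"
        unfolding sum_divide_distrib by (rule sum.mono_neutral_cong_right) (use Z in \<open>auto simp: \<phi>_def\<close>)
      also have "\<dots> \<le> (\<Sum>z | z \<in> ball 0 r \<and> zeta_entire z = 0. real (zmult z) * ln (r / norm z)) / r\<^sup>2"
        by (intro divide_right_mono sum_mono2 fin) (use zpos in \<open>auto simp: Z_def\<close>)
      also have "\<dots> \<le> (r * ln r / pi + C0 * r) / r\<^sup>2"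
        using C0(2)[of r] r by (intro divide_right_mono) auto
      also have "\<dots> = ln r / (pi * r) + C0 / r" using r by (simp add: field_simps power2_eq_square)
      finally show "(\<Sum>z\<in>Z. real (zmult z) * \<phi> z r) \<le> ln r / (pi * r) + C0 / r" .
    qed
    also have "\<dots> \<le> (ln T)\<^sup>2 / (2 * pi) + C0 * ln T"
    proof -
      have "C0 * ln 2 \<ge> 0" "(ln 2)\<^sup>2 / (2 * pi) \<ge> 0" using C0(1) by simp_all
      thus ?thesis by linarith
    qed
    finally have 1: "(\<Sum>z\<in>Z. real (zmult z) * (1 / norm z - (1 + ln (T / norm z)) / T)) \<le> (ln T)\<^sup>2 / (2 * pi) + C0 * ln T" .
    \<comment> \<open>Since 1 + ln (T / |z|) = ln (E / |z|), the boundary term is bounded by the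
      same Jensen sum at radius E; divided by T it is only O(1 + ln T).\<close>
    define E where "E = exp 1 * T"
    have E: "E \<ge> T" "E \<le> 3 * T" "E \<ge> 2" "ln E = 1 + ln T"
    proof -
      have "1 * T \<le> exp 1 * T" using T by (intro mult_right_mono) auto
      thus "E \<ge> T" "E \<ge> 2" using T unfolding E_def by linarith+
      show "E \<le> 3 * T" unfolding E_def using T exp_le by (intro mult_right_mono) auto
      show "ln E = 1 + ln T" using T by (simp add: E_def ln_mult)
    qed
    have "(\<Sum>z\<in>Z. real (zmult z) * (1 + ln (T / norm z))) = (\<Sum>z\<in>Z. real (zmult z) * ln (E / norm z))"
    proof (rule sum.cong[OF refl])
      fix z assume "z \<in> Z"
      hence "norm z > 0" using zpos by (auto simp: Z_def)
      thus "real (zmult z) * (1 + ln (T / norm z)) = real (zmult z) * ln (E / norm z)"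
        using T by (simp add: ln_div E_def ln_mult)
    qed
    also have "\<dots> \<le> (\<Sum>z | z \<in> ball 0 E \<and> zeta_entire z = 0. real (zmult z) * ln (E / norm z))"
      by (intro sum_mono2 fin) (use zpos E in \<open>auto simp: Z_def\<close>)
    also have "\<dots> \<le> E * ln E / pi + C0 * E" by (rule C0(2)[OF E(3)])
    also have "\<dots> \<le> 3 * T * (1 + ln T) / 3 + C0 * (3 * T)"
      unfolding E(4) using E(2) C0(1) T lnT pi_gt3
      by (intro add_mono frac_le mult_right_mono mult_left_mono mult_nonneg_nonneg) auto
    finally have "(\<Sum>z\<in>Z. real (zmult z) * (1 + ln (T / norm z))) / T \<le> (3 * T * (1 + ln T) / 3 + C0 * (3 * T)) / T"
      using T by (intro divide_right_mono) auto
    hence 2: "(\<Sum>z\<in>Z. real (zmult z) * (1 + ln (T / norm z))) / T \<le> 1 + ln T + 3 * C0"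
      using T by (simp add: field_simps)
    have "(\<Sum>z | z \<in> ball 0 T \<and> zeta_entire z = 0. real (zmult z) / norm z) = S0 + (\<Sum>z\<in>Z. real (zmult z) / norm z)"
    proof -
      have "{z. z \<in> ball 0 T \<and> zeta_entire z = 0} = {z. z \<in> ball 0 2 \<and> zeta_entire z = 0} \<union> Z"
        using T by (auto simp: Z_def)
      moreover have "{z. z \<in> ball 0 2 \<and> zeta_entire z = 0} \<inter> Z = {}" by (auto simp: Z_def)
      ultimately show ?thesis unfolding S0_def using sum.union_disjoint[OF fin[of 2] Z] by simp
    qed
    also have "(\<Sum>z\<in>Z. real (zmult z) / norm z) = (\<Sum>z\<in>Z. real (zmult z) * (1 / norm z - (1 + ln (T / norm z)) / T)) +
       (\<Sum>z\<in>Z. real (zmult z) * (1 + ln (T / norm z))) / T"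
      unfolding sum_divide_distrib sum.distrib [symmetric] by (intro sum.cong) (auto simp: algebra_simps)
    finally have "(\<Sum>z | z \<in> ball 0 T \<and> zeta_entire z = 0. real (zmult z) / norm z) \<le>
      S0 + ((ln T)\<^sup>2 / (2 * pi) + C0 * ln T) + (1 + ln T + 3 * C0)" using 1 2 by linarith
    moreover have "S0 * ln T \<ge> 0" "C0 * ln T \<ge> 0" using S0 C0(1) lnT by auto
    moreover have "C * (1 + ln T) = S0 + S0 * ln T + 4 * C0 + 4 * (C0 * ln T) + 1 + ln T"
      by (simp add: C_def algebra_simps)
    ultimately show ?thesis using C0(1) by linarith
  qed
  thus ?thesis using S0 C0 by (intro exI[of _ C]) (auto simp: C_def)
qed

section \<open>The logarithmic derivative in the critical strip\<close>

text \<open>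
  The disc of radius \<open>9/5\<close> about \<open>2 + it\<close> stays to the right of the trivial zeros and contains the part
  of the critical line with ordinates within \<open>1/2\<close> of \<open>t\<close>.
\<close>

definition local_zeros :: "real \<Rightarrow> complex set" where
  "local_zeros t = {z \<in> cball (Complex 2 t) (9/5). zeta_entire z = 0}"

text \<open>\<open>local_log_deriv\<close> is applied about 2 + it with radii 17/10 < 9/5 < 19/10.
  The outer circle stays in Re s >= 1/10, where F grows polynomially, and |F(2 + it)| >= 1/3, so M
  is of order ln (|t| + 3). The inner disc reaches the point 2/5 + it, at distance 8/5.\<close>

lemma zeta_entire_local:
  "\<exists>C>0. \<forall>t. (\<Sum>z\<in>local_zeros t. real (zmult z)) \<le> C * ln (\<bar>t\<bar> + 3) \<and>
    (\<forall>s\<in>cball (Complex 2 t) (17/10). zeta_entire s \<noteq> 0 \<longrightarrow>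
      norm (logderiv_zeta s - (\<Sum>z\<in>local_zeros t. of_nat (zmult z) / (s - z))) \<le> C * ln (\<bar>t\<bar> + 3))"
proof -
  define p where "p = powr_sum (1 + 1/10)"
  have p: "p \<ge> 0" unfolding p_def by (intro powr_sum) auto
  define A where "A = ln (3 * (1 + 4 * p)) + 2"
  have A: "A \<ge> 2" using p by (simp add: A_def)
  define D where "D = 16 * (9/5) / (9/5 - 17/10 :: real)\<^sup>2 + 1 / ((19/10 - 9/5) * ln (19/10 / (9/5)))"
  define D' where "D' = 1 / ln (19/10 / (9/5) :: real)"
  have l0: "ln (19/10 / (9/5) :: real) > 0" by simp
  have DD: "D > 0" "D' > 0" using l0 unfolding D_def D'_def by (auto intro!: add_pos_pos)
  define C where "C = A * (D + D')"
  have "(\<Sum>z\<in>local_zeros t. real (zmult z)) \<le> C * ln (\<bar>t\<bar> + 3) \<and>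
    (\<forall>s\<in>cball (Complex 2 t) (17/10). zeta_entire s \<noteq> 0 \<longrightarrow>
      norm (logderiv_zeta s - (\<Sum>z\<in>local_zeros t. of_nat (zmult z) / (s - z))) \<le> C * ln (\<bar>t\<bar> + 3))" for t
  proof -
    define a where "a = Complex 2 t"
    define L where "L = ln (\<bar>t\<bar> + 3)"
    have L: "L \<ge> 1" unfolding L_def by (intro ln_ge_one) auto
    define M where "M = A * L"
    have M: "M > 0" using A L by (simp add: M_def)
    have Fa: "norm (zeta_entire a) \<ge> 1/3"
    proof -
      have "norm (zeta_dirichlet a) \<ge> 1 - 2/3"
        using norm_zeta_dirichlet_minus_1[of a] norm_triangle_ineq2[of 1 "1 - zeta_dirichlet a"]
        by (auto simp: a_def norm_minus_commute)
      moreover have "norm (a - 1) \<ge> 1" using abs_Re_le_cmod[of "a - 1"] by (simp add: a_def)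
      ultimately have "1 * (1/3) \<le> norm (a - 1) * norm (zeta_dirichlet a)" by (intro mult_mono) auto
      thus ?thesis using zeta_entire_dirichlet[of a] by (simp add: a_def norm_mult)
    qed
    hence Fa0: "zeta_entire a \<noteq> 0" by auto
    have bd: "\<forall>s\<in>sphere a (19/10). norm (zeta_entire s) \<le> norm (zeta_entire a) * exp M"
    proof
      fix s assume s: "s \<in> sphere a (19/10)"
      have d: "norm (s - a) = 19/10" using s by (simp add: dist_norm norm_minus_commute)
      have "\<bar>Re s - 2\<bar> \<le> 19/10" using abs_Re_le_cmod[of "s - a"] d by (simp add: a_def)
      hence re: "Re s \<ge> 1/10" by linarith
      have na: "norm a \<le> 2 + \<bar>t\<bar>" "norm (a - 1) \<le> 1 + \<bar>t\<bar>"
        using cmod_le[of a] cmod_le[of "a - 1"] by (auto simp: a_def)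
      have ns: "norm s \<le> 2 * (\<bar>t\<bar> + 3)" "norm (s - 1) \<le> 2 * (\<bar>t\<bar> + 3)"
        using na d norm_triangle_ineq[of "s - a" a] norm_triangle_ineq[of "s - a" "a - 1"] by auto
      have "norm (zeta_entire s) \<le> 1 + norm (s - 1) * norm s * p"
        unfolding p_def by (rule zeta_entire_right_bound) (use re in auto)
      also have "\<dots> \<le> 1 + (2 * (\<bar>t\<bar> + 3)) * (2 * (\<bar>t\<bar> + 3)) * p"
        using ns p by (intro add_left_mono mult_right_mono mult_mono) auto
      also have "\<dots> \<le> (1 + 4 * p) * (\<bar>t\<bar> + 3)\<^sup>2"
      proof -
        have *: "1 + (2 * y) * (2 * y) * p \<le> (1 + 4 * p) * y\<^sup>2" if "y \<ge> 1" for y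
          using one_le_power[OF that, of 2] by (simp add: algebra_simps power2_eq_square)
        show ?thesis by (rule *) simp
      qed
      also have "\<dots> = 1/3 * exp (ln (3 * (1 + 4 * p)) + 2 * L)"
        using p by (simp add: exp_add L_def exp_double)
      also have "\<dots> \<le> norm (zeta_entire a) * exp M"
      proof (intro mult_mono)
        have "ln (3 * (1 + 4 * p)) * 1 \<le> ln (3 * (1 + 4 * p)) * L" using p L by (intro mult_left_mono) auto
        thus "exp (ln (3 * (1 + 4 * p)) + 2 * L) \<le> exp M" by (simp add: M_def A_def algebra_simps)
      qed (use Fa in auto)
      finally show "norm (zeta_entire s) \<le> norm (zeta_entire a) * exp M" .
    qed
    have r: "0 < (17/10::real)" "17/10 < (9/5::real)" "9/5 < (19/10::real)" by auto
    note loc = local_log_deriv[OF zeta_entire_holomorphic Fa0 r M bd, folded local_zeros_def[of t, folded a_def] D_def, unfolded local_zeros_def[of t, folded a_def, symmetric]]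
    have "(\<Sum>z\<in>local_zeros t. real (zmult z)) * ln (19/10 / (9/5)) \<le> M" using loc(1) by simp
    hence "(\<Sum>z\<in>local_zeros t. real (zmult z)) \<le> M * D'"
      using l0 unfolding D'_def by (simp add: field_simps)
    also have "\<dots> \<le> C * L" unfolding M_def C_def using A L DD by (simp add: mult_ac)
    finally have 1: "(\<Sum>z\<in>local_zeros t. real (zmult z)) \<le> C * L" .
    have "M * D \<le> C * L" unfolding M_def C_def using A L DD by (simp add: mult_ac)
    hence 2: "norm (logderiv_zeta s - (\<Sum>z\<in>local_zeros t. of_nat (zmult z) / (s - z))) \<le> C * L"
      if "s \<in> cball a (17/10)" "zeta_entire s \<noteq> 0" for s
      using loc(2)[OF that] by linarith
    show ?thesis using 1 2 by (auto simp: L_def a_def)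
  qed
  moreover have "C > 0" using A DD by (simp add: C_def)
  ultimately show ?thesis by blast
qed

lemma finite_local_zeros [simp]: "finite (local_zeros t)"
  unfolding local_zeros_def by (intro finite_zeta_zeros) auto

lemma zmult_pos: "zeta_entire z = 0 \<Longrightarrow> zmult z \<ge> 1"
  using zorder_exist_zero[OF zeta_entire_holomorphic, of UNIV z] zeta_entire_1
  by (metis One_nat_def Suc_leI UNIV_I connected_UNIV nat_0_less_mult_iff open_UNIV zero_less_nat_eq zero_neq_one)

text \<open>The centre is at distance 3/2 from the critical line and (9/5)^2 - (3/2)^2 = 99/100, so
  the disc meets the line in ordinates within 1 of t; in particular, as the next lemma uses, it
  covers those within 1/2.\<close>

lemma local_zeros_RH:
  assumes RH: riemann_hypothesis and z: "z \<in> local_zeros t"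
  shows "Re z = 1/2" "\<bar>Im z - t\<bar> < 1" "zeta_entire z = 0"
proof -
  have d: "norm (z - Complex 2 t) \<le> 9/5" and z0: "zeta_entire z = 0"
    using z by (auto simp: local_zeros_def dist_norm norm_minus_commute)
  have "\<bar>Re z - 2\<bar> \<le> 9/5" using abs_Re_le_cmod[of "z - Complex 2 t"] d by simp
  thus re: "Re z = 1/2" using zeta_entire_zero_RH[OF RH z0] by linarith
  have "(norm (z - Complex 2 t))\<^sup>2 \<le> (9/5)\<^sup>2" using d by (intro power_mono) auto
  hence "(Im z - t)\<^sup>2 < 1" unfolding cmod_power2 using re by (simp add: power2_eq_square)
  thus "\<bar>Im z - t\<bar> < 1" by (simp add: abs_square_less_1)
  show "zeta_entire z = 0" by fact
qed

lemma critical_zero_in_local_zeros: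
  assumes "zeta_entire z = 0" "Re z = 1/2" "\<bar>Im z - t\<bar> \<le> 1/2"
  shows "z \<in> local_zeros t"
proof -
  have "(Im z - t)\<^sup>2 \<le> (1/2)\<^sup>2" using assms(3) by (metis abs_le_square_iff abs_of_nonneg zero_le_divide_1_iff zero_le_numeral)
  moreover have "(norm (z - Complex 2 t))\<^sup>2 = (-3/2)\<^sup>2 + (Im z - t)\<^sup>2" by (simp add: cmod_power2 assms(2))
  moreover have "(1/2)\<^sup>2 + (-3/2)\<^sup>2 \<le> (9/5 :: real)\<^sup>2" by (simp add: power2_eq_square)
  ultimately have "(norm (z - Complex 2 t))\<^sup>2 \<le> (9/5)\<^sup>2" by linarith
  hence "norm (z - Complex 2 t) \<le> 9/5" by (rule power2_le_imp_le) auto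
  thus ?thesis using assms(1) by (simp add: local_zeros_def dist_norm norm_minus_commute)
qed

section \<open>The logarithmic derivative on the edges of the contour\<close>

lemma norm_sum_poles_le:
  assumes "\<And>z. z \<in> Z \<Longrightarrow> norm (s - z) \<ge> d" "d > 0"
  shows "norm (\<Sum>z\<in>Z. of_nat (m z) / (s - z) :: complex) \<le> (\<Sum>z\<in>Z. real (m z)) / d"
  unfolding sum_divide_distrib
proof (rule order.trans[OF norm_sum sum_mono])
  fix z assume "z \<in> Z"
  from assms(1)[OF this] show "norm (of_nat (m z) / (s - z)) \<le> real (m z) / d"
    unfolding norm_divide norm_of_nat using assms(2) by (intro frac_le) auto
qed

text \<open>The line Re s = 2/5 keeps distance 1/10 from the critical line, so every zero in the
  window costs at most 10 times its multiplicity.\<close>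

lemma zeta_log_deriv_left_line:
  assumes RH: riemann_hypothesis
  shows "\<exists>C>0. \<forall>t. zeta_entire (Complex (2/5) t) \<noteq> 0 \<and>
     norm (logderiv_zeta (Complex (2/5) t)) \<le> C * ln (\<bar>t\<bar> + 3)"
proof -
  obtain C where C: "C > 0" "\<And>t. (\<Sum>z\<in>local_zeros t. real (zmult z)) \<le> C * ln (\<bar>t\<bar> + 3)"
    "\<And>t s. s\<in>cball (Complex 2 t) (17/10) \<Longrightarrow> zeta_entire s \<noteq> 0 \<Longrightarrow>
      norm (logderiv_zeta s - (\<Sum>z\<in>local_zeros t. of_nat (zmult z) / (s - z))) \<le> C * ln (\<bar>t\<bar> + 3)"
    using zeta_entire_local by blast
  have "zeta_entire (Complex (2/5) t) \<noteq> 0 \<and>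
     norm (logderiv_zeta (Complex (2/5) t)) \<le> (11 * C) * ln (\<bar>t\<bar> + 3)" for t
  proof -
    define s where "s = Complex (2/5) t"
    have nz: "zeta_entire s \<noteq> 0" using zeta_entire_zero_RH[OF RH, of s] by (auto simp: s_def)
    have "s - Complex 2 t = of_real (-8/5)" by (simp add: s_def complex_eq_iff)
    hence "norm (s - Complex 2 t) = \<bar>-8/5\<bar>" by (simp only: norm_of_real)
    hence sb: "s \<in> cball (Complex 2 t) (17/10)" by (simp add: dist_norm norm_minus_commute)
    have "norm (\<Sum>z\<in>local_zeros t. of_nat (zmult z) / (s - z)) \<le> (\<Sum>z\<in>local_zeros t. real (zmult z)) / (1/10)"
    proof (rule norm_sum_poles_le)
      fix z assume "z \<in> local_zeros t"
      from local_zeros_RH(1)[OF RH this] show "norm (s - z) \<ge> 1/10"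
        using abs_Re_le_cmod[of "s - z"] by (simp add: s_def)
    qed auto
    also have "\<dots> \<le> 10 * (C * ln (\<bar>t\<bar> + 3))" using C(2)[of t] by simp
    finally have "norm (logderiv_zeta s) \<le> C * ln (\<bar>t\<bar> + 3) + 10 * (C * ln (\<bar>t\<bar> + 3))"
      using C(3)[OF sb nz] norm_triangle_ineq2[of "logderiv_zeta s" "\<Sum>z\<in>local_zeros t. of_nat (zmult z) / (s - z)"]
      by linarith
    thus ?thesis using nz by (simp add: s_def)
  qed
  thus ?thesis using C(1) by (intro exI[of _ "11 * C"]) auto
qed

text \<open>Cut [N, N + 1] into k cells of width 1/k. Fewer than k points leave some cell empty, and
  T is its midpoint. Points below N are assigned to cell 0 by \<open>nat\<close>, which at worst
  rules out a cell that was free.\<close>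

lemma pigeonhole_gap:
  fixes V :: "real set" and k :: nat
  assumes V: "finite V" and k: "card V < k"
  obtains T where "N \<le> T" "T \<le> N + 1" "\<And>v. v \<in> V \<Longrightarrow> \<bar>v - T\<bar> \<ge> 1 / (2 * real k)"
proof -
  have k0: "real k > 0" using k by simp
  define g where "g = (\<lambda>v. nat \<lfloor>(v - N) * real k\<rfloor>)"
  have "card (g ` V) < card {..<k}" using card_image_le[OF V, of g] k by simp
  hence "\<not> {..<k} \<subseteq> g ` V" using card_mono[of "g ` V" "{..<k}"] V by (meson finite_imageI leD)
  then obtain i where i: "i < k" "i \<notin> g ` V" by auto
  define T where "T = N + (real i + 1/2) / real k"
  have "\<bar>v - T\<bar> \<ge> 1 / (2 * real k)" if "v \<in> V" for v
  proof (rule ccontr)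
    assume "\<not> \<bar>v - T\<bar> \<ge> 1 / (2 * real k)"
    hence "\<bar>v - T\<bar> * real k < 1 / (2 * real k) * real k" using k0 by (intro mult_strict_right_mono) auto
    hence "\<bar>(v - T) * real k\<bar> < 1/2" using k0 by (simp add: abs_mult)
    moreover have "(v - T) * real k = (v - N) * real k - (real i + 1/2)"
      using k0 by (simp add: T_def field_simps)
    ultimately have "\<bar>(v - N) * real k - (real i + 1/2)\<bar> < 1/2" by simp
    hence "real i < (v - N) * real k" "(v - N) * real k < real i + 1" by linarith+
    hence "\<lfloor>(v - N) * real k\<rfloor> = int i" by (intro floor_unique) auto
    hence "g v = i" by (simp add: g_def)
    thus False using i that by blast
  qed
  moreover have "(real i + 1/2) / real k \<le> 1" using i k0 by (simp add: divide_le_eq)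
  hence "T \<le> N + 1" by (simp add: T_def)
  moreover have "N \<le> T" using k0 by (simp add: T_def)
  ultimately show ?thesis using that by blast
qed

text \<open>Only O(ln N) zeros have |Im z| near N, so some T has a gap of order 1 / ln N to all of
  them. The poles then contribute at most their number divided by the gap, which is where the square
  of the logarithm comes from.\<close>

lemma zeta_log_deriv_good_height:
  assumes RH: riemann_hypothesis
  shows "\<exists>C>0. \<forall>N\<ge>2. \<exists>T. N \<le> T \<and> T \<le> N + 1 \<and>
    (\<forall>s. \<bar>Im s\<bar> = T \<and> 2/5 \<le> Re s \<and> Re s \<le> 3 \<longrightarrow>
       zeta_entire s \<noteq> 0 \<and> norm (logderiv_zeta s) \<le> C * (ln (N + 6))\<^sup>2)"
proof -
  obtain C where C: "C > 0" "\<And>t. (\<Sum>z\<in>local_zeros t. real (zmult z)) \<le> C * ln (\<bar>t\<bar> + 3)"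
    "\<And>t s. s\<in>cball (Complex 2 t) (17/10) \<Longrightarrow> zeta_entire s \<noteq> 0 \<Longrightarrow>
      norm (logderiv_zeta s - (\<Sum>z\<in>local_zeros t. of_nat (zmult z) / (s - z))) \<le> C * ln (\<bar>t\<bar> + 3)"
    using zeta_entire_local by blast
  define C' where "C' = C + 2 * (6 * C + 2) * C"
  have "\<exists>T. N \<le> T \<and> T \<le> N + 1 \<and>
    (\<forall>s. \<bar>Im s\<bar> = T \<and> 2/5 \<le> Re s \<and> Re s \<le> 3 \<longrightarrow>
       zeta_entire s \<noteq> 0 \<and> norm (logderiv_zeta s) \<le> C' * (ln (N + 6))\<^sup>2)"
    if N: "N \<ge> 2" for N
  proof -
    define l where "l = ln (N + 6)"
    have l: "l \<ge> 1" unfolding l_def using N by (intro ln_ge_one) auto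
    \<comment> \<open>Six windows of half-width 1/2 cover N - 1 <= |Im z| <= N + 2, hence all
      critical zeros within 1 of height T or -T. Passing to |Im z| in \<open>V\<close> lets a single
      T be good for both horizontal edges.\<close>
    define I where "I = {N - 1/2, N + 1/2, N + 3/2, - (N - 1/2), - (N + 1/2), - (N + 3/2)}"
    define W where "W = (\<Union>t\<in>I. local_zeros t)"
    define V where "V = (\<lambda>z. \<bar>Im z\<bar>) ` W"
    have fW: "finite W" by (auto simp: W_def I_def)
    have "card (local_zeros t) \<le> nat \<lfloor>C * l\<rfloor>" if "t \<in> I" for t
    proof -
      have "real (card (local_zeros t)) = (\<Sum>z\<in>local_zeros t. 1)" by simp
      also have "\<dots> \<le> (\<Sum>z\<in>local_zeros t. real (zmult z))"
        using zmult_pos by (intro sum_mono) (force simp: local_zeros_def)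
      also have "\<dots> \<le> C * ln (\<bar>t\<bar> + 3)" by (rule C(2))
      also have "\<dots> \<le> C * l" unfolding l_def using that N C(1)
        by (intro mult_left_mono) (auto simp: I_def)
      finally show ?thesis by (simp add: le_nat_floor)
    qed
    hence "card W \<le> (\<Sum>t\<in>I. nat \<lfloor>C * l\<rfloor>)"
      unfolding W_def by (intro order.trans[OF card_UN_le sum_mono]) (auto simp: I_def)
    also have "\<dots> = card I * nat \<lfloor>C * l\<rfloor>" by simp
    also have "\<dots> \<le> 6 * nat \<lfloor>C * l\<rfloor>"
      unfolding I_def by (intro mult_right_mono order.trans[OF card_insert_le_m1] ) auto
    finally have "card V \<le> 6 * nat \<lfloor>C * l\<rfloor>"
      unfolding V_def using card_image_le[OF fW, of "\<lambda>z. \<bar>Im z\<bar>"] by linarith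
    hence cV: "card V < 6 * nat \<lfloor>C * l\<rfloor> + 1" by simp
    define k where "k = 6 * nat \<lfloor>C * l\<rfloor> + 1"
    have kl: "real k \<le> (6 * C + 2) * l"
    proof -
      have "real (nat \<lfloor>C * l\<rfloor>) \<le> C * l" using C l by (simp add: of_nat_nat)
      hence "real k \<le> 6 * (C * l) + 1" by (simp add: k_def)
      thus ?thesis using l by (simp add: algebra_simps)
    qed
    obtain T where T: "N \<le> T" "T \<le> N + 1" "\<And>v. v \<in> V \<Longrightarrow> \<bar>v - T\<bar> \<ge> 1 / (2 * real k)"
      using pigeonhole_gap[of V k N] fW cV unfolding k_def V_def by (metis finite_imageI)
    have sT: "zeta_entire s \<noteq> 0 \<and> norm (logderiv_zeta s) \<le> C' * (ln (N + 6))\<^sup>2"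
      if s: "\<bar>Im s\<bar> = T" "2/5 \<le> Re s" "Re s \<le> 3" for s
    proof -
      define t where "t = Im s"
      have ds: "norm (s - z) \<ge> 1 / (2 * real k)" if z: "zeta_entire z = 0" "Re z = 1/2" "\<bar>Im z - t\<bar> < 1" for z
      proof -
        have "z \<in> W"
        proof -
          have "\<exists>j\<in>{-1/2, 1/2, 3/2}. \<bar>\<bar>Im z\<bar> - (N + j)\<bar> \<le> 1/2"
          proof -
            have aux: "\<exists>j\<in>{-1/2, 1/2, 3/2}. \<bar>y - (N + j)\<bar> \<le> 1/2" if "y > N - 1" "y < N + 2" for y
            proof -
              have "\<bar>y - (N + -1/2)\<bar> \<le> 1/2 \<or> \<bar>y - (N + 1/2)\<bar> \<le> 1/2 \<or> \<bar>y - (N + 3/2)\<bar> \<le> 1/2"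
                using that by linarith
              thus ?thesis by blast
            qed
            have "\<bar>Im z\<bar> > N - 1" "\<bar>Im z\<bar> < N + 2" using z s T unfolding t_def by linarith+
            thus ?thesis by (rule aux)
          qed
          then obtain j where j: "j \<in> {-1/2, 1/2, 3/2}" "\<bar>\<bar>Im z\<bar> - (N + j)\<bar> \<le> 1/2" ..
          define u where "u = (if Im z \<ge> 0 then N + j else - (N + j))"
          have "\<bar>Im z - u\<bar> \<le> 1/2"
          proof (cases "Im z \<ge> 0")
            case True
            hence "\<bar>Im z\<bar> = Im z" "u = N + j" by (auto simp: u_def)
            thus ?thesis using j(2) by linarith
          next
            case False
            hence "\<bar>Im z\<bar> = - Im z" "u = - (N + j)" by (auto simp: u_def)
            thus ?thesis using j(2) by linarith
          qed
          hence "z \<in> local_zeros u" by (rule critical_zero_in_local_zeros[OF z(1,2)])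
          moreover have "u \<in> I" using j(1) by (auto simp: u_def I_def)
          ultimately show ?thesis by (auto simp: W_def)
        qed
        hence "\<bar>\<bar>Im z\<bar> - T\<bar> \<ge> 1 / (2 * real k)" by (intro T) (auto simp: V_def)
        also have "\<bar>\<bar>Im z\<bar> - T\<bar> \<le> \<bar>Im (s - z)\<bar>" using s by simp
        also have "\<dots> \<le> norm (s - z)" by (rule abs_Im_le_cmod)
        finally show ?thesis .
      qed
      have k0: "1 / (2 * real k) > 0" by (simp add: k_def)
      have nz: "zeta_entire s \<noteq> 0"
      proof
        assume "zeta_entire s = 0"
        moreover from this have "Re s = 1/2" using zeta_entire_zero_RH[OF RH] s by auto
        ultimately show False using ds[of s] k0 by (simp add: t_def)
      qed
      have "s - Complex 2 t = of_real (Re s - 2)" by (simp add: complex_eq_iff t_def)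
      hence "norm (s - Complex 2 t) = \<bar>Re s - 2\<bar>" by (simp only: norm_of_real)
      moreover have "\<bar>Re s - 2\<bar> \<le> 17/10" using s by linarith
      ultimately have sb: "s \<in> cball (Complex 2 t) (17/10)" by (simp add: dist_norm norm_minus_commute)
      have lt: "C * ln (\<bar>t\<bar> + 3) \<le> C * l" unfolding l_def t_def using s T N C(1) by (intro mult_left_mono) auto
      hence SC: "(\<Sum>z\<in>local_zeros t. real (zmult z)) \<le> C * l" using C(2)[of t] by linarith
      have "norm (\<Sum>z\<in>local_zeros t. of_nat (zmult z) / (s - z)) \<le> (\<Sum>z\<in>local_zeros t. real (zmult z)) / (1 / (2 * real k))"
        by (rule norm_sum_poles_le[OF ds k0]) (use local_zeros_RH[OF RH] in auto)
      also have "\<dots> = (\<Sum>z\<in>local_zeros t. real (zmult z)) * (2 * real k)" by simp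
      also have "\<dots> \<le> (C * l) * (2 * ((6 * C + 2) * l))"
        using SC kl l C(1) by (intro mult_mono) auto
      finally have "norm (\<Sum>z\<in>local_zeros t. of_nat (zmult z) / (s - z)) \<le> (C * l) * (2 * ((6 * C + 2) * l))" .
      hence "norm (logderiv_zeta s) \<le> C * l + (C * l) * (2 * ((6 * C + 2) * l))"
        using C(3)[OF sb nz] lt norm_triangle_ineq2[of "logderiv_zeta s" "\<Sum>z\<in>local_zeros t. of_nat (zmult z) / (s - z)"]
        by linarith
      also have "\<dots> \<le> C * l\<^sup>2 + (C * l) * (2 * ((6 * C + 2) * l))" using C(1) l by (simp add: power2_eq_square)
      finally show ?thesis using nz by (simp add: C'_def l_def power2_eq_square algebra_simps)
    qed
    show ?thesis using T(1,2) sT by blast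
  qed
  moreover have "C' > 0" using C(1) by (auto simp: C'_def intro!: add_pos_pos mult_pos_pos)
  ultimately show ?thesis by blast
qed

section \<open>Perron's formula for the truncated kernel\<close>

lemma norm_contour_integral_linepath_le:
  assumes f: "continuous_on (closed_segment a b) f"
    and g: "(g has_integral I) {0..1}" "\<And>t. t \<in> {0..1} \<Longrightarrow> norm (f (linepath a b t)) * norm (b - a) \<le> g t"
  shows "norm (contour_integral (linepath a b) f) \<le> I"
proof -
  have c: "continuous_on {0..1} (\<lambda>t. f (linepath a b t) * (b - a))"
    by (intro continuous_intros continuous_on_compose2[OF f]) (auto simp: linepath_image_01)
  have "contour_integral (linepath a b) f = integral {0..1} (\<lambda>t. f (linepath a b t) * (b - a))"
    unfolding contour_integral_integral by (simp add: vector_derivative_linepath_at)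
  also have "norm \<dots> \<le> integral {0..1} g"
    by (rule integral_norm_bound_integral)
       (use g c in \<open>auto intro!: integrable_continuous_real has_integral_integrable[OF g(1)] simp: norm_mult\<close>)
  also have "\<dots> = I" using g(1) by (rule integral_unique)
  finally show ?thesis .
qed

text \<open>Opposite edges are given the same orientation, rightwards or upwards, so that one
  estimate covers both; hence the two minus signs.\<close>

lemma contour_integral_rectpath:
  assumes c: "continuous_on (path_image (rectpath a1 a3)) f" and le: "Re a1 \<le> Re a3" "Im a1 \<le> Im a3"
  defines "a2 \<equiv> Complex (Re a3) (Im a1)" and "a4 \<equiv> Complex (Re a1) (Im a3)"
  shows "contour_integral (rectpath a1 a3) f = contour_integral (linepath a1 a2) f + contour_integral (linepath a2 a3) f
           - contour_integral (linepath a4 a3) f - contour_integral (linepath a1 a4) f"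
    and "closed_segment a1 a2 \<subseteq> path_image (rectpath a1 a3)" "closed_segment a2 a3 \<subseteq> path_image (rectpath a1 a3)"
    "closed_segment a4 a3 \<subseteq> path_image (rectpath a1 a3)" "closed_segment a1 a4 \<subseteq> path_image (rectpath a1 a3)"
proof -
  have "path_image (rectpath a1 a3) = closed_segment a1 a2 \<union> closed_segment a2 a3 \<union> closed_segment a3 a4 \<union> closed_segment a4 a1"
    by (simp add: rectpath_def Let_def path_image_join Un_assoc a2_def a4_def)
  thus sub: "closed_segment a1 a2 \<subseteq> path_image (rectpath a1 a3)" "closed_segment a2 a3 \<subseteq> path_image (rectpath a1 a3)"
    "closed_segment a4 a3 \<subseteq> path_image (rectpath a1 a3)" "closed_segment a1 a4 \<subseteq> path_image (rectpath a1 a3)"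
    by (auto simp: closed_segment_commute)
  note c' = continuous_on_subset[OF c sub(1)] continuous_on_subset[OF c sub(2)]
     continuous_on_subset[OF c sub(3)] continuous_on_subset[OF c sub(4)]
  have c'': "continuous_on (closed_segment a3 a4) f" "continuous_on (closed_segment a4 a1) f"
    using c'(3,4) by (auto simp: closed_segment_commute)
  have "contour_integral (rectpath a1 a3) f = contour_integral (linepath a1 a2) f + contour_integral (linepath a2 a3) f
           + contour_integral (linepath a3 a4) f + contour_integral (linepath a4 a1) f"
    unfolding rectpath_def Let_def a2_def[symmetric] a4_def[symmetric]
    using contour_integrable_continuous_linepath[OF c'(1)] contour_integrable_continuous_linepath[OF c'(2)]
      contour_integrable_continuous_linepath[OF c''(1)] contour_integrable_continuous_linepath[OF c''(2)]
    by (simp add: contour_integrable_joinI valid_path_join)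
  thus "contour_integral (rectpath a1 a3) f = contour_integral (linepath a1 a2) f + contour_integral (linepath a2 a3) f
           - contour_integral (linepath a4 a3) f - contour_integral (linepath a1 a4) f"
    using contour_integral_reverse_linepath[OF c''(1)] contour_integral_reverse_linepath[OF c''(2)] by simp
qed

lemma norm_powr_of_real: "y > 0 \<Longrightarrow> norm (of_real y powr s :: complex) = y powr Re s"
  using norm_powr_real_powr[of "of_real y" s] by simp

lemma continuous_on_powr_div:
  "y > 0 \<Longrightarrow> 0 \<notin> A \<Longrightarrow> continuous_on A (\<lambda>s. of_real y powr s / s :: complex)"
  by (intro holomorphic_on_imp_continuous_on holomorphic_intros) auto

text \<open>Bounding |s| below by |\<tau>| leaves y powr Re s, which is integrated exactly.
  Numerator and ln y change sign together, so y < 1 is covered too.\<close>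

lemma perron_horizontal:
  fixes y a b \<tau> :: real
  assumes y: "y > 0" "y \<noteq> 1" and ab: "a < b" and \<tau>: "\<tau> \<noteq> 0"
  shows "norm (contour_integral (linepath (Complex a \<tau>) (Complex b \<tau>)) (\<lambda>s. of_real y powr s / s))
           \<le> (y powr b - y powr a) / (ln y * \<bar>\<tau>\<bar>)"
proof (rule norm_contour_integral_linepath_le)
  show "continuous_on (closed_segment (Complex a \<tau>) (Complex b \<tau>)) (\<lambda>s. of_real y powr s / s)"
    using y \<tau> by (intro continuous_on_powr_div) (auto simp: closed_segment_same_Im)
  define g where "g = (\<lambda>t. (b - a) * y powr (a + t * (b - a)) / \<bar>\<tau>\<bar>)"
  have "(g has_integral (y powr (a + 1 * (b - a)) / (ln y * \<bar>\<tau>\<bar>) - y powr (a + 0 * (b - a)) / (ln y * \<bar>\<tau>\<bar>))) {0..1}"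
  proof (rule has_integral_real_derivative)
    fix t :: real
    show "((\<lambda>t. y powr (a + t * (b - a)) / (ln y * \<bar>\<tau>\<bar>)) has_real_derivative g t) (at t)"
      unfolding g_def using y \<tau> by (auto intro!: derivative_eq_intros simp: field_simps)
  qed auto
  thus "(g has_integral (y powr b - y powr a) / (ln y * \<bar>\<tau>\<bar>)) {0..1}" by (simp add: diff_divide_distrib)
  fix t :: real assume t: "t \<in> {0..1}"
  define s where "s = linepath (Complex a \<tau>) (Complex b \<tau>) t"
  have s: "Re s = a + t * (b - a)" "Im s = \<tau>"
    by (auto simp: s_def linepath_def algebra_simps)
  have "norm s \<ge> \<bar>\<tau>\<bar>" using abs_Im_le_cmod[of s] s by simp
  hence "norm (of_real y powr s / s) \<le> y powr (a + t * (b - a)) / \<bar>\<tau>\<bar>"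
    unfolding norm_divide norm_powr_of_real[OF y(1)] s(1) using \<tau> by (intro divide_left_mono mult_pos_pos) auto
  moreover have "norm (Complex b \<tau> - Complex a \<tau>) = b - a"
  proof -
    have "Complex b \<tau> - Complex a \<tau> = of_real (b - a)" by (simp add: complex_eq_iff)
    thus ?thesis using ab by (simp only: norm_of_real)
  qed
  ultimately show "norm (of_real y powr linepath (Complex a \<tau>) (Complex b \<tau>) t / linepath (Complex a \<tau>) (Complex b \<tau>) t)
       * norm (Complex b \<tau> - Complex a \<tau>) \<le> g t"
    unfolding s_def[symmetric] g_def using ab mult_left_mono[of "norm (of_real y powr s / s)" "y powr (a + t * (b - a)) / \<bar>\<tau>\<bar>" "b - a"]
    by (simp add: mult_ac)
qed

text \<open>The length bound is enough, because this edge is moved off to infinity.\<close>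

lemma perron_vertical:
  fixes y a T :: real
  assumes y: "y > 0" and a: "a \<noteq> 0" and T: "T > 0"
  shows "norm (contour_integral (linepath (Complex a (-T)) (Complex a T)) (\<lambda>s. of_real y powr s / s))
           \<le> y powr a / \<bar>a\<bar> * (2 * T)"
proof -
  have "norm (contour_integral (linepath (Complex a (-T)) (Complex a T)) (\<lambda>s. of_real y powr s / s))
      \<le> y powr a / \<bar>a\<bar> * norm (Complex a T - Complex a (-T))"
  proof (rule contour_integral_bound_linepath)
    show "(\<lambda>s. of_real y powr s / s) contour_integrable_on linepath (Complex a (- T)) (Complex a T)"
      using y a by (intro contour_integrable_continuous_linepath continuous_on_powr_div) (auto simp: closed_segment_same_Re)
    show "norm (of_real y powr s / s) \<le> y powr a / \<bar>a\<bar>" if "s \<in> closed_segment (Complex a (- T)) (Complex a T)" for s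
    proof -
      have s: "Re s = a" using that by (auto simp: closed_segment_same_Re)
      have "norm s \<ge> \<bar>a\<bar>" using abs_Re_le_cmod[of s] s by simp
      thus ?thesis unfolding norm_divide norm_powr_of_real[OF y(1)] s(1) using a
        by (intro divide_left_mono mult_pos_pos) auto
    qed
  qed auto
  also have "norm (Complex a T - Complex a (-T)) = 2 * T"
  proof -
    have "Complex a T - Complex a (-T) = \<i> * of_real (2 * T)" by (simp add: complex_eq_iff)
    hence "norm (Complex a T - Complex a (-T)) = \<bar>2 * T\<bar>" by (simp only: norm_mult norm_of_real) simp
    thus ?thesis using T by simp
  qed
  finally show ?thesis .
qed

text \<open>The segment is closed by a rectangle, to the left if y > 1, where the pole at 0 is
  enclosed, and to the right if y < 1, where none is. The far edge contributes at most 2T / A and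
  disappears as A grows.\<close>

lemma perron_kernel:
  fixes y c T :: real
  assumes y: "y > 0" "y \<noteq> 1" and c: "c > 0" and T: "T > 0"
  shows "norm (contour_integral (linepath (Complex c (-T)) (Complex c T)) (\<lambda>s. of_real y powr s / s)
            - (if y > 1 then 2 * pi * \<i> else 0)) \<le> 2 * y powr c / (T * \<bar>ln y\<bar>)"
proof -
  define f where "f = (\<lambda>s::complex. of_real y powr s / s)"
  define I where "I = contour_integral (linepath (Complex c (-T)) (Complex c T)) f"
  let ?P = "\<lambda>a b. contour_integral (linepath a b) f"
  define K where "K = norm (I - (if y > 1 then 2 * pi * \<i> else 0))"
  define L where "L = 2 * y powr c / (T * \<bar>ln y\<bar>)"
  have bound: "K \<le> L + 2 * T / A" if A: "A > c" for A
  proof (cases "y > 1")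
    case True
    hence lny: "ln y > 0" by simp
    define a1 where "a1 = Complex (-A) (-T)"
    define a3 where "a3 = Complex c T"
    have le: "Re a1 \<le> Re a3" "Im a1 \<le> Im a3" using A c T by (auto simp: a1_def a3_def)
    have z: "0 \<in> box a1 a3" using A c T by (auto simp: in_box_complex_iff a1_def a3_def)
    have pi0: "0 \<notin> path_image (rectpath a1 a3)"
      using z path_image_rectpath_inter_box[OF le] by auto
    have "((\<lambda>w. of_real y powr w / (w - 0)) has_contour_integral
        (2 * pi * \<i> * winding_number (rectpath a1 a3) 0 * of_real y powr 0)) (rectpath a1 a3)"
      by (rule Cauchy_integral_formula_convex_simple[of UNIV])
         (use pi0 y in \<open>auto intro!: holomorphic_intros\<close>)
    hence "contour_integral (rectpath a1 a3) f = 2 * pi * \<i>"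
      using y by (simp add: f_def winding_number_rectpath[OF z] contour_integral_unique)
    moreover have "continuous_on (path_image (rectpath a1 a3)) f"
      unfolding f_def using y pi0 by (intro continuous_on_powr_div)
    note contour_integral_rectpath(1)[OF this le]
    ultimately have "I - 2 * pi * \<i> = ?P (Complex (-A) T) (Complex c T)
      + ?P (Complex (-A) (-T)) (Complex (-A) T) - ?P (Complex (-A) (-T)) (Complex c (-T))"
      by (simp add: I_def a1_def a3_def algebra_simps)
    hence "K = norm (?P (Complex (-A) T) (Complex c T)
      + ?P (Complex (-A) (-T)) (Complex (-A) T) - ?P (Complex (-A) (-T)) (Complex c (-T)))"
      using True by (simp add: K_def)
    also have "\<dots> \<le> norm (?P (Complex (-A) T) (Complex c T))
      + norm (?P (Complex (-A) (-T)) (Complex (-A) T))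
      + norm (?P (Complex (-A) (-T)) (Complex c (-T)))"
      by (rule order.trans[OF norm_triangle_ineq4 add_right_mono[OF norm_triangle_ineq]])
    also have "\<dots> \<le> y powr c / (ln y * T) + 2 * T / A + y powr c / (ln y * T)"
    proof (intro add_mono)
      have "(y powr c - y powr (-A)) / (ln y * T) \<le> y powr c / (ln y * T)"
        using lny T by (intro divide_right_mono) auto
      thus "norm (?P (Complex (-A) T) (Complex c T)) \<le> y powr c / (ln y * T)"
        "norm (?P (Complex (-A) (-T)) (Complex c (-T))) \<le> y powr c / (ln y * T)"
        using perron_horizontal[OF y, of "-A" c T] perron_horizontal[OF y, of "-A" c "-T"] A c T by (auto simp: f_def)
      have "y powr (-A) \<le> y powr 0" using True A c by (intro powr_mono) auto
      hence "y powr (-A) / A * (2 * T) \<le> 1 / A * (2 * T)" using A c T y by (intro mult_right_mono divide_right_mono) auto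
      thus "norm (?P (Complex (-A) (-T)) (Complex (-A) T)) \<le> 2 * T / A"
        using perron_vertical[OF y(1) _ T, of "-A"] A c by (auto simp: f_def)
    qed
    also have "\<dots> = L + 2 * T / A" using lny by (simp add: L_def mult.commute)
    finally show ?thesis .
  next
    case False
    hence y1: "y < 1" using y by auto
    hence lny: "ln y < 0" using y by simp
    define a1 where "a1 = Complex c (-T)"
    define a3 where "a3 = Complex A T"
    have le: "Re a1 \<le> Re a3" "Im a1 \<le> Im a3" using A c T by (auto simp: a1_def a3_def)
    have sub: "path_image (rectpath a1 a3) \<subseteq> {s. Re s > 0}"
      using path_image_rectpath_subset_cbox[OF le] c by (auto simp: in_cbox_complex_iff a1_def)
    have "(f has_contour_integral 0) (rectpath a1 a3)"
      by (rule Cauchy_theorem_convex_simple[of _ "{s. Re s > 0}"])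
         (use sub y in \<open>auto simp: f_def convex_halfspace_Re_gt intro!: holomorphic_intros\<close>)
    hence "contour_integral (rectpath a1 a3) f = 0" by (rule contour_integral_unique)
    moreover have "continuous_on (path_image (rectpath a1 a3)) f"
      unfolding f_def using y sub by (intro continuous_on_powr_div) auto
    note contour_integral_rectpath(1)[OF this le]
    ultimately have "I = ?P (Complex c (-T)) (Complex A (-T))
       + ?P (Complex A (-T)) (Complex A T) - ?P (Complex c T) (Complex A T)"
      by (simp add: I_def a1_def a3_def algebra_simps)
    hence "K = norm (?P (Complex c (-T)) (Complex A (-T))
       + ?P (Complex A (-T)) (Complex A T) - ?P (Complex c T) (Complex A T))"
      using False by (simp add: K_def)
    also have "\<dots> \<le> norm (?P (Complex c (-T)) (Complex A (-T)))
       + norm (?P (Complex A (-T)) (Complex A T)) + norm (?P (Complex c T) (Complex A T))"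
      by (rule order.trans[OF norm_triangle_ineq4 add_right_mono[OF norm_triangle_ineq]])
    also have "\<dots> \<le> y powr c / (\<bar>ln y\<bar> * T) + 2 * T / A + y powr c / (\<bar>ln y\<bar> * T)"
    proof (intro add_mono)
      have "(y powr A - y powr c) / (ln y * T) = (- (y powr c - y powr A)) / (- (\<bar>ln y\<bar> * T))"
        using lny by simp
      also have "\<dots> = (y powr c - y powr A) / (\<bar>ln y\<bar> * T)" by (rule minus_divide_divide)
      also have "\<dots> \<le> y powr c / (\<bar>ln y\<bar> * T)"
        using T by (intro divide_right_mono) auto
      finally show "norm (?P (Complex c (-T)) (Complex A (-T))) \<le> y powr c / (\<bar>ln y\<bar> * T)"
        "norm (?P (Complex c T) (Complex A T)) \<le> y powr c / (\<bar>ln y\<bar> * T)"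
        using perron_horizontal[OF y, of c A T] perron_horizontal[OF y, of c A "-T"] A c T by (auto simp: f_def)
      have "y powr A \<le> 1" using y1 y A c by (intro powr_le1) auto
      hence "y powr A / A * (2 * T) \<le> 1 / A * (2 * T)" using A c T y by (intro mult_right_mono divide_right_mono) auto
      thus "norm (?P (Complex A (-T)) (Complex A T)) \<le> 2 * T / A"
        using perron_vertical[OF y(1) _ T, of "A"] A c by (auto simp: f_def)
    qed
    also have "\<dots> = L + 2 * T / A" by (simp add: L_def mult.commute)
    finally show ?thesis .
  qed
  have "((\<lambda>A. L + 2 * T / A) \<longlongrightarrow> L + 0) at_top"
    by (intro tendsto_intros tendsto_divide_0[OF tendsto_const] filterlim_at_top_imp_at_infinity filterlim_ident)
  moreover have "\<forall>\<^sub>F A in at_top. K \<le> L + 2 * T / A"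
    using eventually_gt_at_top[of c] by eventually_elim (rule bound)
  ultimately have "K \<le> L + 0" by (rule tendsto_lowerbound) auto
  thus ?thesis by (simp add: K_def L_def I_def f_def)
qed

section \<open>The explicit formula\<close>

text \<open>Here ln n <= n is too weak; ln n <= 2 sqrt n saves the half power needed at exponent
  2.\<close>

lemma summable_ln_over_square: "summable (\<lambda>n. ln (real (Suc n)) * real (Suc n) powr (-2))"
proof (rule summable_comparison_test')
  show "summable (\<lambda>n. 2 * real (Suc n) powr (- (3/2)))" by (intro summable_mult summable_powr_Suc) auto
  fix n :: nat
  have "ln (real (Suc n)) = 2 * ln (real (Suc n) powr (1/2))" by (simp add: ln_powr)
  also have "ln (real (Suc n) powr (1/2)) \<le> real (Suc n) powr (1/2)"
    using ln_le_minus_one[of "real (Suc n) powr (1/2)"] by simp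
  finally have "ln (real (Suc n)) * real (Suc n) powr (-2) \<le> (2 * real (Suc n) powr (1/2)) * real (Suc n) powr (-2)"
    by (intro mult_right_mono) auto
  also have "\<dots> = 2 * real (Suc n) powr (- (3/2))" by (simp add: powr_add [symmetric] mult.assoc)
  finally show "norm (ln (real (Suc n)) * real (Suc n) powr (-2)) \<le> 2 * real (Suc n) powr (- (3/2))" by simp
qed

lemma of_real_divide_powr:
  assumes "x > 0" "y > 0"
  shows "of_real (x / y) powr s = (of_real x powr s / of_real y powr s :: complex)"
proof -
  have "of_real x powr s = (of_real (x / y) * of_real y :: complex) powr s" using assms by simp
  also have "\<dots> = of_real (x / y) powr s * of_real y powr s" using assms by (intro powr_times_real) auto
  finally show ?thesis using assms by simp
qed

text \<open>From ln (a / b) >= (a - b) / a for the larger number a. The product in the denominator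
  gives away a factor, but makes the bound symmetric and avoids a case distinction later.\<close>

lemma abs_ln_ratio_ge:
  fixes x y d :: real
  assumes "x \<ge> 1" "y \<ge> 1" "d > 0" "\<bar>x - y\<bar> \<ge> d"
  shows "\<bar>ln (x / y)\<bar> \<ge> d / (x * y)"
proof -
  have *: "\<bar>ln (a / b)\<bar> \<ge> d / (a * b)" if "a \<ge> 1" "b \<ge> 1" "a - b \<ge> d" for a b :: real
  proof -
    have "ln (b / a) \<le> b / a - 1" using that by (intro ln_le_minus_one) auto
    moreover have "ln (b / a) = - ln (a / b)" using that by (simp add: ln_div)
    ultimately have "ln (a / b) \<ge> (a - b) / a" using that by (simp add: field_simps)
    moreover have "d / (a * b) \<le> (a - b) / a"
    proof -
      have "d / (a * b) \<le> d / (a * 1)" using that assms by (intro divide_left_mono mult_left_mono) auto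
      also have "\<dots> \<le> (a - b) / a" using that by (simp add: divide_right_mono)
      finally show ?thesis .
    qed
    ultimately show ?thesis by linarith
  qed
  show ?thesis
  proof (cases "x \<ge> y")
    case True
    thus ?thesis using *[of x y] assms by auto
  next
    case False
    have "ln (y / x) = - ln (x / y)" using assms by (simp add: ln_div)
    thus ?thesis using *[of y x] assms False by (simp add: mult.commute)
  qed
qed

text \<open>The first factor is -zeta'(s)/zeta(s), with the pole at 1 split off from the poles at
  the zeros.\<close>

definition perron_integrand :: "real \<Rightarrow> complex \<Rightarrow> complex" where
  "perron_integrand x s = (1 / (s - 1) - logderiv_zeta s) * (of_real x powr s / s)"

text \<open>The Dirichlet series converges uniformly on the segment and is integrated term by term;
  the n-th term is Perron's kernel at y = x / n, and the distance of x from the integers keeps ln y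
  away from 0.\<close>

lemma perron_psi:
  assumes x: "x \<ge> 1" and T: "T > 0" and d: "d > 0" "\<And>n::nat. \<bar>x - real n\<bar> \<ge> d"
  shows "norm (contour_integral (linepath (Complex 3 (-T)) (Complex 3 T)) (perron_integrand x)
           - 2 * pi * \<i> * of_real (chebyshev_psi x))
         \<le> 2 * x ^ 4 / (T * d) * (\<Sum>n. ln (real (Suc n)) * real (Suc n) powr (-2))"
proof -
  define S where "S = closed_segment (Complex 3 (-T)) (Complex 3 T)"
  have S: "Re s = 3" if "s \<in> S" for s using that by (auto simp: S_def closed_segment_same_Re)
  define f where "f = (\<lambda>n s. mangoldt (Suc n) * (of_real (x / real (Suc n)) powr s / s) :: complex)"
  have feq: "f n s = mangoldt (Suc n) * (1 / of_nat (Suc n) powr s) * (of_real x powr s / s)" for n s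
    using of_real_divide_powr[of x "real (Suc n)" s] x by (simp add: f_def del: of_nat_Suc)
  have sums: "(\<lambda>n. f n s) sums perron_integrand x s" if "s \<in> S" for s
    unfolding feq perron_integrand_def by (intro sums_mult2 mangoldt_dirichlet_series) (use S[OF that] in auto)
  have bd: "norm (f n s) \<le> ln (real (Suc n)) * real (Suc n) powr (-3) * (x powr 3 / 3)" if "s \<in> S" for n s
  proof -
    have "norm s \<ge> 3" using S[OF that] abs_Re_le_cmod[of s] by simp
    hence "norm (of_real x powr s / s) \<le> x powr 3 / 3"
      unfolding norm_divide norm_powr_of_real[OF less_le_trans[OF zero_less_one x]] S[OF that] by (intro frac_le) auto
    moreover have "norm (mangoldt (Suc n) * (1 / of_nat (Suc n) powr s) :: complex) \<le> ln (real (Suc n)) * real (Suc n) powr (-3)"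
      unfolding norm_mult norm_dirichlet_term norm_mangoldt S[OF that] by (intro mult_right_mono mangoldt_le) auto
    ultimately show ?thesis unfolding feq norm_mult[of "_ * _" "_ / _"] by (intro mult_mono) auto
  qed
  have "uniform_limit S (\<lambda>N w. \<Sum>n<N. f n w) (\<lambda>w. \<Sum>n. f n w) sequentially"
    by (rule Weierstrass_m_test[OF bd]) (use summable_ln_powr_Suc[of 3] in \<open>auto intro!: summable_mult2\<close>)
  moreover have "(\<Sum>n. f n w) = perron_integrand x w" if "w \<in> S" for w
    using sums[OF that] by (simp add: sums_iff)
  ultimately have ul: "uniform_limit S (\<lambda>N w. \<Sum>n<N. f n w) (perron_integrand x) sequentially"
    by (subst (asm) uniform_limit_cong'[where g = "\<lambda>N w. \<Sum>n<N. f n w" and i = "perron_integrand x"]) auto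
  have cont0: "continuous_on S (\<lambda>s. of_real (x / real (Suc n)) powr s / s :: complex)" for n
    by (intro continuous_on_powr_div) (use x S[of 0] in \<open>auto simp del: of_nat_Suc\<close>)
  have cont: "continuous_on S (f n)" for n
    unfolding f_def by (intro continuous_on_mult continuous_on_const cont0)
  obtain J where J: "(perron_integrand x has_contour_integral J) (linepath (Complex 3 (-T)) (Complex 3 T))"
    "(\<lambda>n. contour_integral (linepath (Complex 3 (-T)) (Complex 3 T)) (f n)) sums J"
    by (rule contour_integral_sums_linepath[OF ul[unfolded S_def] cont[unfolded S_def]]) (rule that)
  define P where "P = (\<lambda>n. if x / real (Suc n) > 1 then 2 * pi * \<i> else 0 :: complex)"
  have "(\<lambda>n. mangoldt (Suc n) * P n) sums (\<Sum>n | x / real (Suc n) > 1. mangoldt (Suc n) * P n)"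
  proof (rule sums_finite)
    have "n < nat \<lceil>x\<rceil>" if "x / real (Suc n) > 1" for n
    proof -
      have "real (Suc n) < x" using that by (simp add: less_divide_eq)
      thus ?thesis by simp linarith
    qed
    hence "{n. x / real (Suc n) > 1} \<subseteq> {..<nat \<lceil>x\<rceil>}" by blast
    thus "finite {n. x / real (Suc n) > 1}" by (rule finite_subset) simp
  qed (auto simp: P_def)
  also have "(\<Sum>n | x / real (Suc n) > 1. mangoldt (Suc n) * P n) = (\<Sum>n | 1 \<le> n \<and> real n \<le> x. mangoldt n * (2 * pi * \<i>))"
  proof (rule sum.reindex_bij_witness[of _ "\<lambda>n. n - 1" Suc])
    fix n assume n: "n \<in> {n. 1 \<le> n \<and> real n \<le> x}"
    \<comment> \<open>The kernel counts n < x while \<open>chebyshev_psi\<close> counts n <= x; they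
      agree because x is not an integer.\<close>
    have "real n \<noteq> x" using d(2)[of n] d(1) by auto
    thus "n - 1 \<in> {n. x / real (Suc n) > 1}" using n by (auto simp: less_divide_eq)
  qed (auto simp: P_def less_divide_eq)
  also have "\<dots> = 2 * pi * \<i> * of_real (chebyshev_psi x)"
    unfolding chebyshev_psi_def by (simp add: sum_distrib_left mult_ac)
  finally have Psum: "(\<lambda>n. mangoldt (Suc n) * P n) sums (2 * pi * \<i> * of_real (chebyshev_psi x))" .
  define D where "D = (\<lambda>n. contour_integral (linepath (Complex 3 (-T)) (Complex 3 T)) (f n) - mangoldt (Suc n) * P n)"
  have Dsum: "D sums (J - 2 * pi * \<i> * of_real (chebyshev_psi x))"
    unfolding D_def by (rule sums_diff[OF J(2) Psum])
  have Db: "norm (D n) \<le> 2 * x ^ 4 / (T * d) * (ln (real (Suc n)) * real (Suc n) powr (-2))" for n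
  proof -
    define y where "y = x / real (Suc n)"
    have y: "y > 0" "y \<noteq> 1" using x d(1) d(2)[of "Suc n"] by (auto simp: y_def simp del: of_nat_Suc)
    have ly: "\<bar>ln y\<bar> \<ge> d / (x * real (Suc n))"
      unfolding y_def by (rule abs_ln_ratio_ge) (use x d in \<open>auto simp del: of_nat_Suc simp: Suc_le_eq\<close>)
    have "contour_integral (linepath (Complex 3 (-T)) (Complex 3 T)) (f n) =
       mangoldt (Suc n) * contour_integral (linepath (Complex 3 (-T)) (Complex 3 T)) (\<lambda>s. of_real y powr s / s)"
      unfolding f_def y_def
      by (intro contour_integral_lmul contour_integrable_continuous_linepath cont0[unfolded S_def])
    hence "D n = mangoldt (Suc n) * (contour_integral (linepath (Complex 3 (-T)) (Complex 3 T)) (\<lambda>s. of_real y powr s / s)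
        - (if y > 1 then 2 * pi * \<i> else 0))"
      unfolding D_def P_def y_def[symmetric] by (simp add: algebra_simps)
    hence "norm (D n) = mangoldt (Suc n) * norm (contour_integral (linepath (Complex 3 (-T)) (Complex 3 T)) (\<lambda>s. of_real y powr s / s)
        - (if y > 1 then 2 * pi * \<i> else 0))" by (simp only: norm_mult norm_mangoldt)
    also have "\<dots> \<le> ln (real (Suc n)) * (2 * y powr 3 / (T * \<bar>ln y\<bar>))"
      by (intro mult_mono mangoldt_le perron_kernel y T) auto
    also have "\<dots> \<le> ln (real (Suc n)) * (2 * y powr 3 / (T * (d / (x * real (Suc n)))))"
    proof (intro mult_left_mono divide_left_mono mult_pos_pos)
      show "0 < d / (x * real (Suc n))" using d x by (intro divide_pos_pos mult_pos_pos) auto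
      thus "0 < \<bar>ln y\<bar>" using ly by linarith
    qed (use ly T in auto)
    \<comment> \<open>The factor n lost in 1 / |ln y| leaves n^(-2) of the n^(-3) gained on Re s =
      3, still summable against ln n.\<close>
    also have "2 * y powr 3 / (T * (d / (x * real (Suc n)))) = 2 * x ^ 4 / (T * d) * (1 / (real (Suc n))\<^sup>2)"
      using x d T by (simp add: y_def powr_numeral power_divide field_simps power2_eq_square power4_eq_xxxx power3_eq_cube del: of_nat_Suc)
    also have "1 / (real (Suc n))\<^sup>2 = real (Suc n) powr (-2)"
      by (simp add: powr_minus powr_numeral divide_inverse)
    finally show ?thesis by (simp only: mult_ac)
  qed
  have "norm (J - 2 * pi * \<i> * of_real (chebyshev_psi x)) = norm (suminf D)" using Dsum by (simp add: sums_iff)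
  also have "\<dots> \<le> (\<Sum>n. 2 * x ^ 4 / (T * d) * (ln (real (Suc n)) * real (Suc n) powr (-2)))"
    by (rule norm_suminf_le[OF Db summable_mult[OF summable_ln_over_square]])
  also have "\<dots> = 2 * x ^ 4 / (T * d) * (\<Sum>n. ln (real (Suc n)) * real (Suc n) powr (-2))"
    by (rule suminf_mult[OF summable_ln_over_square])
  also have "J = contour_integral (linepath (Complex 3 (-T)) (Complex 3 T)) (perron_integrand x)"
    using J(1) by (simp add: contour_integral_unique)
  finally show ?thesis .
qed

section \<open>Shifting the contour past the critical line\<close>

definition critical_zeros :: "real \<Rightarrow> complex set" where
  "critical_zeros T = {z. zeta_entire z = 0 \<and> Re z = 1/2 \<and> \<bar>Im z\<bar> < T}"

lemma finite_critical_zeros [simp]: "finite (critical_zeros T)"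
proof (rule finite_subset)
  show "critical_zeros T \<subseteq> {z\<in>ball 0 (1 + \<bar>T\<bar>). zeta_entire z = 0}"
  proof
    fix z assume z: "z \<in> critical_zeros T"
    hence "norm z < 1 + \<bar>T\<bar>" using cmod_le[of z] by (auto simp: critical_zeros_def)
    thus "z \<in> {z\<in>ball 0 (1 + \<bar>T\<bar>). zeta_entire z = 0}" using z by (auto simp: critical_zeros_def)
  qed
  show "finite {z\<in>ball 0 (1 + \<bar>T\<bar>). zeta_entire z = 0}" by (intro finite_zeta_zeros) auto
qed

abbreviation zero_sum :: "real \<Rightarrow> real \<Rightarrow> complex" where
  "zero_sum T x \<equiv> \<Sum>z\<in>critical_zeros T. zero_term x z"

text \<open>The pole at 1 contributes x by Cauchy's formula, and the argument principle with weight
  x^s / s contributes the zeros with multiplicity. The edge Re s = 2/5 leaves the critical line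
  inside and the pole at 0 outside.\<close>

lemma contour_integral_perron_rectangle:
  assumes RH: riemann_hypothesis and T: "T > 0" and x: "x > 0"
    and nz: "\<And>s. \<bar>Im s\<bar> = T \<Longrightarrow> 2/5 \<le> Re s \<Longrightarrow> Re s \<le> 3 \<Longrightarrow> zeta_entire s \<noteq> 0"
  shows "continuous_on (path_image (rectpath (Complex (2/5) (-T)) (Complex 3 T))) (perron_integrand x)"
    and "contour_integral (rectpath (Complex (2/5) (-T)) (Complex 3 T)) (perron_integrand x) =
           2 * pi * \<i> * (of_real x - zero_sum T x)"
proof -
  define a1 a3 where "a1 = Complex (2/5) (-T)" and "a3 = Complex 3 T"
  define h where "h = (\<lambda>s::complex. of_real x powr s / s)"
  have le: "Re a1 \<le> Re a3" "Im a1 \<le> Im a3" using T by (auto simp: a1_def a3_def)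
  define P where "P = path_image (rectpath a1 a3)"
  have Peq: "P = cbox a1 a3 - box a1 a3" unfolding P_def by (rule path_image_rectpath_cbox_minus_box[OF le])
  have P: "zeta_entire s \<noteq> 0" "s \<noteq> 1" "s \<noteq> 0" if "s \<in> P" for s
  proof -
    have s: "2/5 \<le> Re s" "Re s \<le> 3" "\<bar>Im s\<bar> \<le> T" "Re s = 2/5 \<or> Re s = 3 \<or> \<bar>Im s\<bar> = T"
      using that unfolding Peq by (auto simp: in_cbox_complex_iff in_box_complex_iff a1_def a3_def abs_le_iff)
    show "s \<noteq> 1" "s \<noteq> 0" using s T by auto
    show "zeta_entire s \<noteq> 0"
    proof (cases "\<bar>Im s\<bar> = T")
      case False
      thus ?thesis using zeta_entire_zero_RH[OF RH, of s] s by auto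
    qed (use nz s in auto)
  qed
  have dF: "deriv zeta_entire holomorphic_on A" for A
    by (rule holomorphic_on_subset[OF holomorphic_deriv[OF zeta_entire_holomorphic open_UNIV]]) auto
  have c1: "continuous_on P (\<lambda>s. deriv zeta_entire s * h s / zeta_entire s)"
    unfolding h_def by (intro holomorphic_on_imp_continuous_on holomorphic_intros dF zeta_entire_holomorphic) (use P x in auto)
  have c2: "continuous_on P (\<lambda>s. h s / (s - 1))"
    unfolding h_def by (intro holomorphic_on_imp_continuous_on holomorphic_intros) (use P x in auto)
  have Eeq: "perron_integrand x = (\<lambda>s. h s / (s - 1) - deriv zeta_entire s * h s / zeta_entire s)"
    by (auto simp: perron_integrand_def h_def algebra_simps)
  show "continuous_on (path_image (rectpath (Complex (2/5) (-T)) (Complex 3 T))) (perron_integrand x)"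
    unfolding Eeq a1_def[symmetric] a3_def[symmetric] P_def[symmetric] by (intro continuous_on_diff c1 c2)
  define H where "H = {s. Re s > 0}"
  have H: "open H" "convex H" unfolding H_def by (auto intro: open_halfspace_Re_gt convex_halfspace_Re_gt)
  have hH: "h holomorphic_on A" if "A \<subseteq> H" for A
    unfolding h_def by (intro holomorphic_intros) (use that x in \<open>auto simp: H_def\<close>)
  have z1: "1 \<in> box a1 a3" using T by (auto simp: in_box_complex_iff a1_def a3_def)
  have PH: "P \<subseteq> H" unfolding Peq by (auto simp: in_cbox_complex_iff H_def a1_def)
  have i2: "((\<lambda>w. h w / (w - 1)) has_contour_integral (2 * pi * \<i> * winding_number (rectpath a1 a3) 1 * h 1)) (rectpath a1 a3)"
  proof (rule Cauchy_integral_formula_convex_simple[OF H(2) hH])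
    show "1 \<in> interior H" using H by (simp add: interior_open) (simp add: H_def)
    show "path_image (rectpath a1 a3) \<subseteq> H - {1}" using PH P(2) by (auto simp: P_def)
  qed auto
  \<comment> \<open>The argument principle needs an open set around the closed rectangle. Zeros of F
    in \<open>S\<close> beyond the rectangle have winding number 0.\<close>
  define S where "S = box (Complex (1/5) (-T-1)) (Complex 4 (T+1))"
  have SH: "S \<subseteq> H" by (auto simp: S_def in_box_complex_iff H_def)
  have cS: "cbox a1 a3 \<subseteq> S" by (auto simp: S_def in_box_complex_iff in_cbox_complex_iff a1_def a3_def)
  have finS: "finite {w\<in>S. zeta_entire w = 0}" unfolding S_def by (intro finite_zeta_zeros) auto
  have "contour_integral (rectpath a1 a3) (\<lambda>s. deriv zeta_entire s * h s / zeta_entire s) =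
     2 * pi * \<i> * (\<Sum>p\<in>{w\<in>S. zeta_entire w = 0 \<or> w \<in> {}}. winding_number (rectpath a1 a3) p * h p * zorder zeta_entire p)"
  proof (rule argument_principle)
    show "open S" "connected S" by (auto simp: S_def intro: convex_connected)
    show "zeta_entire holomorphic_on S - {}" by (rule zeta_entire_holomorphic)
    show "h holomorphic_on S" by (rule hH[OF SH])
    show "path_image (rectpath a1 a3) \<subseteq> S - {w\<in>S. zeta_entire w = 0 \<or> w \<in> {}}"
      using P(1) cS Peq by (auto simp: P_def)
    show "\<forall>z. z \<notin> S \<longrightarrow> winding_number (rectpath a1 a3) z = 0"
      using winding_number_rectpath_outside[OF le] cS by blast
  qed (use finS in auto)
  also have "(\<Sum>p\<in>{w\<in>S. zeta_entire w = 0 \<or> w \<in> {}}. winding_number (rectpath a1 a3) p * h p * zorder zeta_entire p)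
     = (\<Sum>z\<in>critical_zeros T. of_nat (zmult z) * h z)"
  proof (rule sum.mono_neutral_cong_right)
    show "critical_zeros T \<subseteq> {w\<in>S. zeta_entire w = 0 \<or> w \<in> {}}"
      by (auto simp: critical_zeros_def S_def in_box_complex_iff)
    have crit: "Re z = 1/2" if "z \<in> S" "zeta_entire z = 0" for z
      using zeta_entire_zero_RH[OF RH that(2)] that(1) SH by (force simp: H_def)
    show "\<forall>p\<in>{w\<in>S. zeta_entire w = 0 \<or> w \<in> {}} - critical_zeros T.
       winding_number (rectpath a1 a3) p * h p * zorder zeta_entire p = 0"
    proof
      fix p assume p: "p \<in> {w\<in>S. zeta_entire w = 0 \<or> w \<in> {}} - critical_zeros T"
      hence p': "Re p = 1/2" "zeta_entire p = 0" using crit by auto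
      hence "\<bar>Im p\<bar> \<ge> T" using p by (auto simp: critical_zeros_def)
      moreover have "\<bar>Im p\<bar> \<noteq> T" using nz[of p] p' by auto
      ultimately have "p \<notin> cbox a1 a3" by (auto simp: in_cbox_complex_iff a1_def a3_def)
      thus "winding_number (rectpath a1 a3) p * h p * zorder zeta_entire p = 0"
        using winding_number_rectpath_outside[OF le] by simp
    qed
    fix z assume z: "z \<in> critical_zeros T"
    hence "z \<in> box a1 a3" by (auto simp: critical_zeros_def in_box_complex_iff a1_def a3_def)
    moreover have "zorder zeta_entire z \<ge> 0"
      using zmult_pos[of z] z by (auto simp: critical_zeros_def)
    ultimately show "winding_number (rectpath a1 a3) z * h z * zorder zeta_entire z = of_nat (zmult z) * h z"
      by (simp add: winding_number_rectpath)
  qed (use finS in auto)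
  finally have i1: "contour_integral (rectpath a1 a3) (\<lambda>s. deriv zeta_entire s * h s / zeta_entire s)
     = 2 * pi * \<i> * (\<Sum>z\<in>critical_zeros T. of_nat (zmult z) * h z)" .
  have int1: "(\<lambda>s. deriv zeta_entire s * h s / zeta_entire s) contour_integrable_on rectpath a1 a3"
    using c1 unfolding P_def rectpath_def Let_def
    by (auto simp: path_image_join intro!: contour_integrable_joinI contour_integrable_continuous_linepath valid_path_join
          elim!: continuous_on_subset)
  have "contour_integral (rectpath a1 a3) (perron_integrand x) =
     contour_integral (rectpath a1 a3) (\<lambda>w. h w / (w - 1)) - contour_integral (rectpath a1 a3) (\<lambda>s. deriv zeta_entire s * h s / zeta_entire s)"
    unfolding Eeq by (rule contour_integral_diff[OF has_contour_integral_integrable[OF i2] int1])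
  also have "contour_integral (rectpath a1 a3) (\<lambda>w. h w / (w - 1)) = 2 * pi * \<i> * of_real x"
    using contour_integral_unique[OF i2] winding_number_rectpath[OF z1] x by (simp add: h_def)
  finally show "contour_integral (rectpath (Complex (2/5) (-T)) (Complex 3 T)) (perron_integrand x) =
           2 * pi * \<i> * (of_real x - zero_sum T x)"
    unfolding i1 by (simp add: a1_def a3_def h_def algebra_simps)
qed

lemma norm_perron_integrand_le:
  assumes "x \<ge> 1" "norm (logderiv_zeta s) \<le> B" "norm (s - 1) \<ge> b" "b > 0"
  shows "norm (perron_integrand x s) \<le> (1 / b + B) * (x powr Re s / norm s)"
proof -
  have "norm (1 / (s - 1)) \<le> 1 / b" using assms by (simp add: norm_divide frac_le)
  hence "norm (1 / (s - 1) - logderiv_zeta s) \<le> 1 / b + B"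
    using assms(2) norm_triangle_ineq4 by (smt (verit))
  thus ?thesis unfolding perron_integrand_def norm_mult using assms(1)
    by (intro mult_mono) (auto simp: norm_divide norm_powr_of_real order.trans[OF norm_ge_zero])
qed

lemma arsinh_le: "t \<ge> 0 \<Longrightarrow> arsinh t \<le> ln (2 * t + 1)" for t :: real
proof -
  assume t: "t \<ge> 0"
  have "sqrt (t\<^sup>2 + 1) \<le> t + 1" using t by (intro real_le_lsqrt) (auto simp: power2_eq_square algebra_simps)
  moreover have "t + sqrt (t\<^sup>2 + 1) > 0" using t by (intro add_nonneg_pos) (auto intro: add_nonneg_pos)
  ultimately show ?thesis using t unfolding arsinh_real_def by (subst ln_le_cancel_iff) auto
qed

text \<open>T depends on N only, not on x or d, since x will range over an interval while the zeros
  stay fixed. The three errors come from truncating Perron's integral, from the horizontal edges and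
  from the edge Re s = 2/5, whose power x^(2/5) stays below sqrt x.\<close>

lemma explicit_formula:
  assumes RH: riemann_hypothesis
  shows "\<exists>C>0. \<forall>N\<ge>2. \<exists>T. N \<le> T \<and> T \<le> N + 1 \<and> (\<forall>x d. 1 \<le> x \<longrightarrow> d > 0 \<longrightarrow> (\<forall>n::nat. \<bar>x - real n\<bar> \<ge> d) \<longrightarrow>
     norm (of_real (chebyshev_psi x) - (of_real x - zero_sum T x))
       \<le> C * (x ^ 4 / (T * d) + x ^ 3 * (ln (N + 6))\<^sup>2 / T + x powr (2/5) * (ln (N + 6))\<^sup>2))"
proof -
  obtain C1 where C1: "C1 > 0" "\<forall>N\<ge>2. \<exists>T. N \<le> T \<and> T \<le> N + 1 \<and>
    (\<forall>s. \<bar>Im s\<bar> = T \<and> 2/5 \<le> Re s \<and> Re s \<le> 3 \<longrightarrow>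
       zeta_entire s \<noteq> 0 \<and> norm (logderiv_zeta s) \<le> C1 * (ln (N + 6))\<^sup>2)"
    using zeta_log_deriv_good_height[OF RH] by (elim exE conjE) (rule that)
  obtain C2 where C2: "C2 > 0" "\<forall>t. zeta_entire (Complex (2/5) t) \<noteq> 0 \<and>
     norm (logderiv_zeta (Complex (2/5) t)) \<le> C2 * ln (\<bar>t\<bar> + 3)"
    using zeta_log_deriv_left_line[OF RH] by (elim exE conjE) (rule that)
  define S0 where "S0 = (\<Sum>n. ln (real (Suc n)) * real (Suc n) powr (-2))"
  have S0: "S0 \<ge> 0" unfolding S0_def by (intro suminf_nonneg summable_ln_over_square) auto
  define C where "C = 2 * S0 + 6 * (1 + C1) + 10 * (2 + C2)"
  have C: "C \<ge> 2 * S0" "C \<ge> 6 * (1 + C1)" "C \<ge> 10 * (2 + C2)" "C > 0" using S0 C1 C2 by (auto simp: C_def)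
  have "\<exists>T. N \<le> T \<and> T \<le> N + 1 \<and> (\<forall>x d. 1 \<le> x \<longrightarrow> d > 0 \<longrightarrow> (\<forall>n::nat. \<bar>x - real n\<bar> \<ge> d) \<longrightarrow>
     norm (of_real (chebyshev_psi x) - (of_real x - zero_sum T x))
       \<le> C * (x ^ 4 / (T * d) + x ^ 3 * (ln (N + 6))\<^sup>2 / T + x powr (2/5) * (ln (N + 6))\<^sup>2))"
    if N: "N \<ge> 2" for N
  proof -
    obtain T where T: "N \<le> T" "T \<le> N + 1" "\<And>s. \<bar>Im s\<bar> = T \<Longrightarrow> 2/5 \<le> Re s \<Longrightarrow> Re s \<le> 3 \<Longrightarrow> zeta_entire s \<noteq> 0"
       "\<And>s. \<bar>Im s\<bar> = T \<Longrightarrow> 2/5 \<le> Re s \<Longrightarrow> Re s \<le> 3 \<Longrightarrow> norm (logderiv_zeta s) \<le> C1 * (ln (N + 6))\<^sup>2"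
      using C1(2) N by meson
    have T0: "T \<ge> 2" "T > 0" using T N by auto
    define l where "l = ln (N + 6)"
    have l: "l \<ge> 1" unfolding l_def using N by (intro ln_ge_one) auto
    hence l2: "l\<^sup>2 \<ge> 1" by (simp add: one_le_power)
    have main: "norm (of_real (chebyshev_psi x) - (of_real x - zero_sum T x))
       \<le> C * (x ^ 4 / (T * d) + x ^ 3 * l\<^sup>2 / T + x powr (2/5) * l\<^sup>2)"
      if x: "1 \<le> x" and d: "d > 0" "\<And>n::nat. \<bar>x - real n\<bar> \<ge> d" for x d
    proof -
      define E where "E = perron_integrand x"
      define Z where "Z = of_real x - zero_sum T x"
      define R where "R = contour_integral (linepath (Complex 3 (-T)) (Complex 3 T)) E"
      define I1 where "I1 = contour_integral (linepath (Complex (2/5) (-T)) (Complex 3 (-T))) E"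
      define I2 where "I2 = contour_integral (linepath (Complex (2/5) T) (Complex 3 T)) E"
      define I3 where "I3 = contour_integral (linepath (Complex (2/5) (-T)) (Complex (2/5) T)) E"
      have x0: "x > 0" using x by simp
      note rect = contour_integral_perron_rectangle[OF RH T0(2) x0 T(3)]
      have le: "Re (Complex (2/5) (-T)) \<le> Re (Complex 3 T)" "Im (Complex (2/5) (-T)) \<le> Im (Complex 3 T)" using T0 by auto
      note dec = contour_integral_rectpath[OF rect(1) le, simplified]
      have ER: "R = 2 * pi * \<i> * Z - I1 + I2 + I3"
        using dec(1) rect(2) by (simp add: R_def I1_def I2_def I3_def E_def Z_def algebra_simps)
      have psi: "norm (R - 2 * pi * \<i> * of_real (chebyshev_psi x)) \<le> 2 * x ^ 4 / (T * d) * S0"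
        unfolding R_def E_def S0_def by (rule perron_psi[OF x T0(2) d])
      have hor: "norm (contour_integral (linepath (Complex (2/5) \<tau>) (Complex 3 \<tau>)) E) \<le> ((1 + C1 * l\<^sup>2) * (x ^ 3 / T)) * 3"
        if \<tau>: "\<bar>\<tau>\<bar> = T" and sub: "closed_segment (Complex (2/5) \<tau>) (Complex 3 \<tau>) \<subseteq> path_image (rectpath (Complex (2/5) (-T)) (Complex 3 T))" for \<tau>
      proof -
        have b: "norm (E s) \<le> (1 + C1 * l\<^sup>2) * (x ^ 3 / T)" if "s \<in> closed_segment (Complex (2/5) \<tau>) (Complex 3 \<tau>)" for s
        proof -
          have s: "Im s = \<tau>" "2/5 \<le> Re s" "Re s \<le> 3"
            using that by (auto simp: closed_segment_same_Im closed_segment_eq_real_ivl)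
          have ns: "norm s \<ge> T" "norm (s - 1) \<ge> 1"
            using abs_Im_le_cmod[of s] abs_Im_le_cmod[of "s - 1"] s \<tau> T0 by auto
          have "norm (E s) \<le> (1 / 1 + C1 * l\<^sup>2) * (x powr Re s / norm s)"
            unfolding E_def l_def by (rule norm_perron_integrand_le[OF x T(4)]) (use s \<tau> ns in auto)
          also have "\<dots> \<le> (1 + C1 * l\<^sup>2) * (x powr 3 / T)"
            using ns T0 x s C1(1) by (intro mult_mono frac_le powr_mono) auto
          finally show ?thesis using x by (simp add: powr_numeral)
        qed
        have "norm (contour_integral (linepath (Complex (2/5) \<tau>) (Complex 3 \<tau>)) E) \<le>
          ((1 + C1 * l\<^sup>2) * (x ^ 3 / T)) * norm (Complex 3 \<tau> - Complex (2/5) \<tau>)"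
        proof (rule contour_integral_bound_linepath[OF _ _ b])
          show "E contour_integrable_on linepath (Complex (2/5) \<tau>) (Complex 3 \<tau>)"
            unfolding E_def by (rule contour_integrable_continuous_linepath[OF continuous_on_subset[OF rect(1) sub]])
          show "0 \<le> (1 + C1 * l\<^sup>2) * (x ^ 3 / T)" using C1(1) x T0 by (intro mult_nonneg_nonneg) auto
        qed auto
        also have "\<dots> \<le> ((1 + C1 * l\<^sup>2) * (x ^ 3 / T)) * 3"
          using cmod_le[of "Complex 3 \<tau> - Complex (2/5) \<tau>"] C1(1) x T0
          by (intro mult_left_mono mult_nonneg_nonneg) auto
        finally show ?thesis .
      qed
      have h12: "norm I1 \<le> ((1 + C1 * l\<^sup>2) * (x ^ 3 / T)) * 3" "norm I2 \<le> ((1 + C1 * l\<^sup>2) * (x ^ 3 / T)) * 3"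
        unfolding I1_def I2_def by (rule hor[OF _ dec(2)] hor[OF _ dec(4)]; use T0 in simp)+
      have h3: "norm I3 \<le> 5 * (2 + C2) * (x powr (2/5) * l\<^sup>2) * 2"
      proof -
        define B where "B = (2 + C2) * l * x powr (2/5) * (5/2)"
        have B: "B \<ge> 0" using C2(1) l x by (simp add: B_def)
        have cont: "continuous_on {-T..T} (\<lambda>t. E (Complex (2/5) t))"
        proof (rule continuous_on_compose2[OF rect(1)[folded E_def]])
          have "Complex (2/5) = (\<lambda>t. of_real (2/5) + \<i> * of_real t)" by (auto simp: complex_eq_iff)
          thus "continuous_on {-T..T} (Complex (2/5))" by (simp only:) (intro continuous_intros)
          have "Complex (2/5) ` {-T..T} \<subseteq> closed_segment (Complex (2/5) (-T)) (Complex (2/5) T)"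
            using T0 by (auto simp: closed_segment_same_Re closed_segment_eq_real_ivl)
          thus "Complex (2/5) ` {-T..T} \<subseteq> path_image (rectpath (Complex (2/5) (-T)) (Complex 3 T))"
            using dec by auto
        qed
        \<comment> \<open>On the left edge |s| is at least 2/5 sqrt (t^2 + 1), whose reciprocal has
          the antiderivative arsinh up to a constant; this yields a logarithm of T instead of a
          power.\<close>
        have bi: "((\<lambda>t. B / sqrt (t\<^sup>2 + 1)) has_integral (B * arsinh T - B * arsinh (-T))) {-T..T}"
        proof (rule has_integral_real_derivative)
          fix t :: real
          show "((\<lambda>t. B * arsinh t) has_real_derivative B / sqrt (t\<^sup>2 + 1)) (at t)"
            by (auto intro!: derivative_eq_intros)
        qed (use T0 in auto)
        have pb: "norm (E (Complex (2/5) t)) \<le> B / sqrt (t\<^sup>2 + 1)" if t: "t \<in> {-T..T}" for t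
        proof -
          define s where "s = Complex (2/5) t"
          have "ln (\<bar>t\<bar> + 3) \<le> l" unfolding l_def using t T N by (subst ln_le_cancel_iff) auto
          hence "C2 * ln (\<bar>t\<bar> + 3) \<le> C2 * l" using C2(1) by (intro mult_left_mono) auto
          hence F: "norm (logderiv_zeta s) \<le> C2 * l"
            using spec[OF C2(2), of t] unfolding s_def by linarith
          have "norm (s - 1) \<ge> 1/2" using abs_Re_le_cmod[of "s - 1"] by (simp add: s_def)
          from norm_perron_integrand_le[OF x F this]
          have "norm (E s) \<le> (2 + C2 * l) * (x powr (2/5) / norm s)" by (simp add: E_def s_def)
          also have "\<dots> \<le> ((2 + C2) * l) * (x powr (2/5) / (2/5 * sqrt (t\<^sup>2 + 1)))"
          proof (intro mult_mono divide_left_mono mult_pos_pos)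
            show "2 + C2 * l \<le> (2 + C2) * l" using l by (simp add: algebra_simps)
            have "(2/5 * sqrt (t\<^sup>2 + 1))\<^sup>2 = (2/5)\<^sup>2 * (t\<^sup>2 + 1)" by (simp add: power_mult_distrib power_divide)
            also have "\<dots> \<le> (norm s)\<^sup>2" unfolding cmod_power2 s_def by (simp add: power2_eq_square)
            finally show "2/5 * sqrt (t\<^sup>2 + 1) \<le> norm s" by (rule power2_le_imp_le) auto
            show "norm s > 0" using abs_Re_le_cmod[of s] by (auto simp: s_def)
            show "sqrt (t\<^sup>2 + 1) > 0" by (auto intro: add_nonneg_pos)
          qed (use l C2(1) in auto)
          also have "\<dots> = B / sqrt (t\<^sup>2 + 1)" by (simp add: B_def)
          finally show ?thesis by (simp add: s_def)
        qed
        have "I3 = \<i> * integral {-T..T} (\<lambda>t. E (Complex (2/5) t))"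
          unfolding I3_def by (rule contour_integral_linepath_same_Re) (use T0 in simp_all)
        hence "norm I3 = norm (integral {-T..T} (\<lambda>t. E (Complex (2/5) t)))" by (simp only: norm_mult norm_ii mult_1)
        also have "\<dots> \<le> integral {-T..T} (\<lambda>t. B / sqrt (t\<^sup>2 + 1))"
          by (rule integral_norm_bound_integral[OF integrable_continuous_real[OF cont] has_integral_integrable[OF bi] pb])
        also have "\<dots> = B * (2 * arsinh T)" using integral_unique[OF bi] by (simp add: arsinh_minus_real)
        also have "\<dots> \<le> B * (2 * (2 * l))"
        proof -
          have "arsinh T \<le> ln (2 * T + 1)" using T0 by (intro arsinh_le) auto
          also have "\<dots> \<le> ln ((N + 6)\<^sup>2)"
          proof (subst ln_le_cancel_iff)
            have "(N + 6)\<^sup>2 = N * N + 12 * N + 36" by (simp add: power2_eq_square algebra_simps)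
            thus "2 * T + 1 \<le> (N + 6)\<^sup>2" using T(2) N zero_le_square[of N] by linarith
          qed (use T0 N in auto)
          also have "\<dots> = 2 * l" using N by (simp add: l_def ln_realpow)
          finally show ?thesis using B by (intro mult_left_mono) auto
        qed
        also have "\<dots> = 5 * (2 + C2) * (x powr (2/5) * l\<^sup>2) * 2" by (simp add: B_def power2_eq_square)
        finally show ?thesis .
      qed
      have "2 * pi * \<i> * (of_real (chebyshev_psi x) - Z) = - (R - 2 * pi * \<i> * of_real (chebyshev_psi x)) - I1 + I2 + I3"
        using ER by (simp add: algebra_simps)
      hence "norm (2 * pi * \<i> * (of_real (chebyshev_psi x) - Z)) \<le> norm (R - 2 * pi * \<i> * of_real (chebyshev_psi x)) + norm I1 + norm I2 + norm I3"
        by (smt (verit) norm_minus_cancel norm_triangle_ineq norm_triangle_ineq4)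
      also have "norm (2 * pi * \<i> * (of_real (chebyshev_psi x) - Z)) = 2 * pi * norm (of_real (chebyshev_psi x) - Z)"
        by (simp add: norm_mult)
      finally have "2 * pi * norm (of_real (chebyshev_psi x) - Z) \<le> 2 * x ^ 4 / (T * d) * S0 + ((1 + C1 * l\<^sup>2) * (x ^ 3 / T)) * 3
           + ((1 + C1 * l\<^sup>2) * (x ^ 3 / T)) * 3 + 5 * (2 + C2) * (x powr (2/5) * l\<^sup>2) * 2"
        using psi h12 h3 by linarith
      also have "\<dots> = 2 * S0 * (x ^ 4 / (T * d)) + 6 * (1 + C1 * l\<^sup>2) * (x ^ 3 / T) + 10 * (2 + C2) * (x powr (2/5) * l\<^sup>2)"
        by (simp add: algebra_simps)
      also have "\<dots> \<le> C * (x ^ 4 / (T * d)) + C * l\<^sup>2 * (x ^ 3 / T) + C * (x powr (2/5) * l\<^sup>2)"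
      proof (intro add_mono mult_right_mono C)
        have "6 * (1 + C1 * l\<^sup>2) \<le> 6 * (1 + C1) * l\<^sup>2" using l2 by (simp add: algebra_simps)
        also have "\<dots> \<le> C * l\<^sup>2" using C by (intro mult_right_mono) auto
        finally show "6 * (1 + C1 * l\<^sup>2) \<le> C * l\<^sup>2" .
      qed (use T0 d x in auto)
      also have "\<dots> = C * (x ^ 4 / (T * d) + x ^ 3 * l\<^sup>2 / T + x powr (2/5) * l\<^sup>2)" by (simp add: algebra_simps)
      finally have fin: "2 * pi * norm (of_real (chebyshev_psi x) - Z) \<le> C * (x ^ 4 / (T * d) + x ^ 3 * l\<^sup>2 / T + x powr (2/5) * l\<^sup>2)" .
      have "1 * norm (of_real (chebyshev_psi x) - Z) \<le> 2 * pi * norm (of_real (chebyshev_psi x) - Z)"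
        using pi_gt3 by (intro mult_right_mono) auto
      thus ?thesis using fin unfolding Z_def by linarith
    qed
    show ?thesis
      using T(1,2) main by (intro exI[of _ T]) (auto simp: l_def)
  qed
  thus ?thesis using C(4) by (intro exI[of _ C]) auto
qed

section \<open>Mean square of a sum over zeros\<close>

lemma sum_inverse_Suc_le: "n \<ge> 1 \<Longrightarrow> (\<Sum>k<n. 1 / (real k + 1)) \<le> 1 + ln (real n)"
proof (induction n rule: dec_induct)
  case (step n)
  have "ln (real n / real (Suc n)) \<le> real n / real (Suc n) - 1"
    using step by (intro ln_le_minus_one) auto
  also have "\<dots> = - (1 / (real n + 1))" by (simp add: field_simps)
  finally have "1 / (real n + 1) \<le> ln (real (Suc n)) - ln (real n)"
    using step by (simp add: ln_div)
  thus ?case using step by simp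
qed simp

text \<open>Zeros with k <= |Im z - u| < k + 1 lie in the two windows about u + k + 1/2 and u - k -
  1/2, which hold O(ln T) zeros. The harmonic sum over k supplies the second logarithm.\<close>

lemma critical_zeros_kernel_sum:
  assumes RH: riemann_hypothesis
  shows "\<exists>C>0. \<forall>T\<ge>2. \<forall>u. \<bar>u\<bar> \<le> T \<longrightarrow>
    (\<Sum>z\<in>critical_zeros T. real (zmult z) / (1 + \<bar>Im z - u\<bar>)) \<le> C * (ln (T + 6))\<^sup>2"
proof -
  obtain C0 where C0': "C0 > 0" "\<forall>t. (\<Sum>z\<in>local_zeros t. real (zmult z)) \<le> C0 * ln (\<bar>t\<bar> + 3) \<and>
    (\<forall>s\<in>cball (Complex 2 t) (17/10). zeta_entire s \<noteq> 0 \<longrightarrow>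
      norm (logderiv_zeta s - (\<Sum>z\<in>local_zeros t. of_nat (zmult z) / (s - z))) \<le> C0 * ln (\<bar>t\<bar> + 3))"
    using zeta_entire_local by (elim exE conjE) (rule that)
  have C0: "(\<Sum>z\<in>local_zeros t. real (zmult z)) \<le> C0 * ln (\<bar>t\<bar> + 3)" for t using C0'(2) by blast
  have "(\<Sum>z\<in>critical_zeros T. real (zmult z) / (1 + \<bar>Im z - u\<bar>)) \<le> (12 * C0) * (ln (T + 6))\<^sup>2"
    if T: "T \<ge> 2" and u: "\<bar>u\<bar> \<le> T" for T u
  proof -
    define l where "l = ln (T + 6)"
    have l: "l \<ge> 1" unfolding l_def using T by (intro ln_ge_one) auto
    have l2: "ln y \<le> 2 * l" if "0 < y" "y \<le> 3 * T + 5" for y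
    proof -
      have "(T + 6)\<^sup>2 = T * T + 12 * T + 36" by (simp add: power2_eq_square algebra_simps)
      hence "y \<le> (T + 6)\<^sup>2" using that T zero_le_square[of T] by linarith
      hence "ln y \<le> ln ((T + 6)\<^sup>2)" using that T by (subst ln_le_cancel_iff) auto
      thus ?thesis using T by (simp add: l_def ln_realpow)
    qed
    define g where "g = (\<lambda>z. nat \<lfloor>\<bar>Im z - u\<bar>\<rfloor>)"
    define M where "M = nat \<lfloor>2 * T\<rfloor>"
    have "(\<Sum>z\<in>critical_zeros T. real (zmult z) / (1 + \<bar>Im z - u\<bar>)) =
       (\<Sum>k\<in>{..<Suc M}. \<Sum>z | z \<in> critical_zeros T \<and> g z = k. real (zmult z) / (1 + \<bar>Im z - u\<bar>))"
    proof (rule sum.group [symmetric])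
      show "g ` critical_zeros T \<subseteq> {..<Suc M}"
      proof safe
        fix z assume "z \<in> critical_zeros T"
        hence "\<bar>Im z - u\<bar> \<le> 2 * T" using u by (auto simp: critical_zeros_def)
        thus "g z < Suc M" unfolding g_def M_def less_Suc_eq_le by (intro nat_mono floor_mono)
      qed
    qed auto
    also have "\<dots> \<le> (\<Sum>k\<in>{..<Suc M}. (4 * C0 * l) * (1 / (real k + 1)))"
    proof (rule sum_mono)
      fix k assume k: "k \<in> {..<Suc M}"
      have kT: "real k \<le> 2 * T" using k T unfolding M_def by simp linarith
      define t1 where "t1 = u + (real k + 1/2)"
      define t2 where "t2 = u - (real k + 1/2)"
      have fib: "\<bar>Im z - u\<bar> \<ge> real k" "\<bar>Im z - u\<bar> \<le> real k + 1" if "g z = k" for z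
        using that unfolding g_def by linarith+
      have sub: "{z. z \<in> critical_zeros T \<and> g z = k} \<subseteq> local_zeros t1 \<union> local_zeros t2"
      proof
        fix z assume z: "z \<in> {z. z \<in> critical_zeros T \<and> g z = k}"
        have "\<bar>Im z - t1\<bar> \<le> 1/2 \<or> \<bar>Im z - t2\<bar> \<le> 1/2"
          using fib[of z] z unfolding t1_def t2_def mem_Collect_eq by linarith
        moreover have "zeta_entire z = 0" "Re z = 1/2" using z by (auto simp: critical_zeros_def)
        ultimately show "z \<in> local_zeros t1 \<union> local_zeros t2" using critical_zero_in_local_zeros by blast
      qed
      have tb: "(\<Sum>z\<in>local_zeros t. real (zmult z)) \<le> 2 * C0 * l" if "t = t1 \<or> t = t2" for t
      proof -
        have "\<bar>t\<bar> + 3 \<le> 3 * T + 5" using that u kT unfolding t1_def t2_def by linarith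
        hence "C0 * ln (\<bar>t\<bar> + 3) \<le> C0 * (2 * l)" using C0'(1) by (intro mult_left_mono l2) auto
        thus ?thesis using C0[of t] by simp
      qed
      have "(\<Sum>z | z \<in> critical_zeros T \<and> g z = k. real (zmult z) / (1 + \<bar>Im z - u\<bar>)) \<le>
         (\<Sum>z | z \<in> critical_zeros T \<and> g z = k. real (zmult z) / (real k + 1))"
        by (intro sum_mono divide_left_mono) (use fib in \<open>auto intro!: mult_pos_pos add_pos_nonneg\<close>)
      also have "\<dots> = (\<Sum>z | z \<in> critical_zeros T \<and> g z = k. real (zmult z)) / (real k + 1)"
        by (rule sum_divide_distrib [symmetric])
      also have "\<dots> \<le> (\<Sum>z\<in>local_zeros t1 \<union> local_zeros t2. real (zmult z)) / (real k + 1)"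
        by (intro divide_right_mono sum_mono2 sub) auto
      also have "\<dots> \<le> (2 * C0 * l + 2 * C0 * l) / (real k + 1)"
      proof (intro divide_right_mono)
        have "(\<Sum>z\<in>local_zeros t1 \<union> local_zeros t2. real (zmult z)) \<le>
          (\<Sum>z\<in>local_zeros t1. real (zmult z)) + (\<Sum>z\<in>local_zeros t2. real (zmult z))"
          by (subst sum_Un) (auto intro: sum_nonneg)
        thus "(\<Sum>z\<in>local_zeros t1 \<union> local_zeros t2. real (zmult z)) \<le> 2 * C0 * l + 2 * C0 * l"
          using tb[of t1] tb[of t2] by linarith
      qed auto
      finally show "(\<Sum>z | z \<in> critical_zeros T \<and> g z = k. real (zmult z) / (1 + \<bar>Im z - u\<bar>)) \<le> (4 * C0 * l) * (1 / (real k + 1))"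
        by simp
    qed
    also have "\<dots> = (4 * C0 * l) * (\<Sum>k<Suc M. 1 / (real k + 1))" by (rule sum_distrib_left [symmetric])
    also have "\<dots> \<le> (4 * C0 * l) * (3 * l)"
    proof (rule mult_left_mono)
      have "(\<Sum>k<Suc M. 1 / (real k + 1)) \<le> 1 + ln (real (Suc M))" by (rule sum_inverse_Suc_le) simp
      also have "ln (real (Suc M)) \<le> 2 * l"
      proof (rule l2)
        have "real M \<le> 2 * T" unfolding M_def using T by simp
        thus "real (Suc M) \<le> 3 * T + 5" using T by simp
      qed simp
      finally show "(\<Sum>k<Suc M. 1 / (real k + 1)) \<le> 3 * l" using l by linarith
    qed (use C0'(1) l in auto)
    finally show ?thesis by (simp add: l_def power2_eq_square)
  qed
  thus ?thesis using C0'(1) by (intro exI[of _ "12 * C0"]) auto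
qed

section \<open>Cross terms and their quadratic form\<close>

lemma cnj_of_real_powr: "x > 0 \<Longrightarrow> cnj (of_real x powr s) = (of_real x powr cnj s :: complex)"
  by (simp add: powr_def exp_cnj Ln_of_real)

text \<open>On the critical line the product of one power of x with the conjugate of another is x^(1
  + i \<Delta>), \<Delta> being the difference of the ordinates. The factor 1 / (1 + |\<Delta>|)
  expresses that distinct zeros are nearly orthogonal.\<close>

lemma has_integral_powr_1_plus_imag:
  fixes X \<Delta> :: real
  assumes X: "X \<ge> 1"
  shows "((\<lambda>x. of_real x powr (1 + \<i> * of_real \<Delta>)) has_integral
     (of_real X powr (2 + \<i> * of_real \<Delta>) - 1) / (2 + \<i> * of_real \<Delta>)) {1..X}"
    and "norm ((of_real X powr (2 + \<i> * of_real \<Delta>) - 1) / (2 + \<i> * of_real \<Delta>) :: complex) \<le> 4 * X\<^sup>2 / (1 + \<bar>\<Delta>\<bar>)"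
proof -
  define s where "s = 2 + \<i> * complex_of_real \<Delta>"
  have s: "Re s = 2" "Im s = \<Delta>" by (simp_all add: s_def)
  have s0: "s \<noteq> 0" using s by auto
  have "((\<lambda>x. of_real x powr (s - 1)) has_integral (of_real X powr s / s - of_real 1 powr s / s)) {1..X}"
  proof (rule fundamental_theorem_of_calculus[OF X])
    fix x assume x: "x \<in> {1..X}"
    have "((\<lambda>w. w powr s / s) has_field_derivative of_real x powr (s - 1)) (at (of_real x))"
      using x s0 by (auto intro!: derivative_eq_intros simp: complex_nonpos_Reals_iff)
    thus "((\<lambda>x. of_real x powr s / s) has_vector_derivative of_real x powr (s - 1)) (at x within {1..X})"
      by (rule has_vector_derivative_real_field)
  qed
  moreover have "s - 1 = 1 + \<i> * of_real \<Delta>" by (simp add: s_def)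
  ultimately show "((\<lambda>x. of_real x powr (1 + \<i> * of_real \<Delta>)) has_integral
     (of_real X powr (2 + \<i> * of_real \<Delta>) - 1) / (2 + \<i> * of_real \<Delta>)) {1..X}"
    by (simp add: diff_divide_distrib s_def)
  have "norm (of_real X powr s - 1) \<le> norm (of_real X powr s :: complex) + norm (1::complex)" by (rule norm_triangle_ineq4)
  also have "norm (of_real X powr s :: complex) = X\<^sup>2" using X by (simp add: norm_powr_of_real s powr_numeral)
  also have "X\<^sup>2 + norm (1::complex) \<le> 2 * X\<^sup>2" using one_le_power[OF X, of 2] by simp
  finally have n: "norm (of_real X powr s - 1) \<le> 2 * X\<^sup>2" .
  have "2 \<le> norm s" "\<bar>\<Delta>\<bar> \<le> norm s" using abs_Re_le_cmod[of s] abs_Im_le_cmod[of s] by (simp_all add: s)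
  moreover have "(1 + t) / 2 \<le> n" if "2 \<le> n" "t \<le> n" for t n :: real using that by simp
  ultimately have "(1 + \<bar>\<Delta>\<bar>) / 2 \<le> norm s" by blast
  hence "norm ((of_real X powr s - 1) / s) \<le> 2 * X\<^sup>2 / ((1 + \<bar>\<Delta>\<bar>) / 2)"
    unfolding norm_divide using n by (intro frac_le) (auto intro: add_pos_nonneg)
  thus "norm ((of_real X powr (2 + \<i> * of_real \<Delta>) - 1) / (2 + \<i> * of_real \<Delta>) :: complex) \<le> 4 * X\<^sup>2 / (1 + \<bar>\<Delta>\<bar>)"
    by (simp add: s_def)
qed

text \<open>This is Schur's test: b z * b w is at most half the sum of the squares, and by symmetry
  both halves reduce to row sums of the kernel.\<close>

lemma symmetric_double_sum_le:
  fixes b m :: "'a \<Rightarrow> real" and k :: "'a \<Rightarrow> 'a \<Rightarrow> real"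
  assumes W: "finite W" and m: "\<And>z. z \<in> W \<Longrightarrow> m z \<ge> 0" and k: "\<And>z w. k z w = k w z" "\<And>z w. k z w \<ge> 0"
    and D: "\<And>z. z \<in> W \<Longrightarrow> (\<Sum>w\<in>W. m w * k z w) \<le> D"
  shows "(\<Sum>z\<in>W. \<Sum>w\<in>W. (m z * b z) * (m w * b w) * k z w) \<le> D * (\<Sum>z\<in>W. m z * (b z)\<^sup>2)"
proof -
  have "(\<Sum>z\<in>W. \<Sum>w\<in>W. (m z * b z) * (m w * b w) * k z w) \<le>
     (\<Sum>z\<in>W. \<Sum>w\<in>W. (m z * (b z)\<^sup>2 * (m w * k z w)) / 2 + (m w * (b w)\<^sup>2 * (m z * k w z)) / 2)"
  proof (intro sum_mono)
    fix z w assume zw: "z \<in> W" "w \<in> W"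
    have "b z * b w \<le> ((b z)\<^sup>2 + (b w)\<^sup>2) / 2" using sum_squares_bound[of "b z" "b w"] by simp
    hence "(m z * m w * k z w) * (b z * b w) \<le> (m z * m w * k z w) * (((b z)\<^sup>2 + (b w)\<^sup>2) / 2)"
      using m zw k(2) by (intro mult_left_mono mult_nonneg_nonneg) auto
    thus "(m z * b z) * (m w * b w) * k z w \<le> (m z * (b z)\<^sup>2 * (m w * k z w)) / 2 + (m w * (b w)\<^sup>2 * (m z * k w z)) / 2"
      using k(1)[of w z] by (simp add: algebra_simps add_divide_distrib)
  qed
  also have "\<dots> = (\<Sum>z\<in>W. \<Sum>w\<in>W. m z * (b z)\<^sup>2 * (m w * k z w)) / 2 + (\<Sum>z\<in>W. \<Sum>w\<in>W. m w * (b w)\<^sup>2 * (m z * k w z)) / 2"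
    by (simp add: sum.distrib sum_divide_distrib)
  also have "(\<Sum>z\<in>W. \<Sum>w\<in>W. m w * (b w)\<^sup>2 * (m z * k w z)) = (\<Sum>z\<in>W. \<Sum>w\<in>W. m z * (b z)\<^sup>2 * (m w * k z w))"
    by (rule sum.swap)
  also have "(\<Sum>z\<in>W. \<Sum>w\<in>W. m z * (b z)\<^sup>2 * (m w * k z w)) / 2 + (\<Sum>z\<in>W. \<Sum>w\<in>W. m z * (b z)\<^sup>2 * (m w * k z w)) / 2
     = (\<Sum>z\<in>W. m z * (b z)\<^sup>2 * (\<Sum>w\<in>W. m w * k z w))"
    by (simp add: sum_distrib_left)
  also have "\<dots> \<le> (\<Sum>z\<in>W. m z * (b z)\<^sup>2 * D)"
    by (intro sum_mono mult_left_mono D mult_nonneg_nonneg m) auto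
  finally show ?thesis by (simp add: sum_distrib_left mult_ac)
qed

text \<open>Expand the square, integrate each cross term and apply Schur's test with b z = 1 / |z|.
  The result keeps the weights 1 / |z|^2, whose tail is small.\<close>

lemma mean_square_zero_sum:
  fixes W :: "complex set" and m :: "complex \<Rightarrow> nat" and X D :: real
  assumes W: "finite W" "\<And>z. z \<in> W \<Longrightarrow> Re z = 1/2" and X: "X \<ge> 1"
    and D: "\<And>z. z \<in> W \<Longrightarrow> (\<Sum>w\<in>W. real (m w) / (1 + \<bar>Im z - Im w\<bar>)) \<le> D"
  obtains I where "((\<lambda>x. (norm (\<Sum>z\<in>W. of_nat (m z) * (of_real x powr z / z)))\<^sup>2) has_integral I) {1..X}"
    "I \<le> 4 * X\<^sup>2 * D * (\<Sum>z\<in>W. real (m z) / (norm z)\<^sup>2)"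
proof -
  define a where "a = (\<lambda>z. of_nat (m z) / z)"
  define J where "J = (\<lambda>\<Delta>. (of_real X powr (2 + \<i> * of_real \<Delta>) - 1) / (2 + \<i> * of_real \<Delta>) :: complex)"
  define Q where "Q = (\<Sum>z\<in>W. \<Sum>w\<in>W. a z * cnj (a w) * J (Im z - Im w))"
  have "((\<lambda>x. \<Sum>z\<in>W. \<Sum>w\<in>W. a z * cnj (a w) * of_real x powr (1 + \<i> * of_real (Im z - Im w))) has_integral Q) {1..X}"
    unfolding Q_def J_def by (intro has_integral_sum W has_integral_mult_right has_integral_powr_1_plus_imag X)
  moreover have "(\<Sum>z\<in>W. \<Sum>w\<in>W. a z * cnj (a w) * of_real x powr (1 + \<i> * of_real (Im z - Im w))) =
     of_real ((norm (\<Sum>z\<in>W. of_nat (m z) * (of_real x powr z / z)))\<^sup>2)" if x: "x \<in> {1..X}" for x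
  proof -
    have x0: "x > 0" using x by auto
    have "of_real ((norm (\<Sum>z\<in>W. of_nat (m z) * (of_real x powr z / z)))\<^sup>2) =
      (\<Sum>z\<in>W. a z * of_real x powr z) * cnj (\<Sum>z\<in>W. a z * of_real x powr z)"
      unfolding complex_norm_square a_def by simp
    also have "\<dots> = (\<Sum>z\<in>W. \<Sum>w\<in>W. (a z * of_real x powr z) * cnj (a w * of_real x powr w))"
      by (simp add: sum_product)
    also have "\<dots> = (\<Sum>z\<in>W. \<Sum>w\<in>W. a z * cnj (a w) * of_real x powr (1 + \<i> * of_real (Im z - Im w)))"
    proof (intro sum.cong refl)
      fix z w assume zw: "z \<in> W" "w \<in> W"
      have "z + cnj w = 1 + \<i> * of_real (Im z - Im w)" using W(2)[OF zw(1)] W(2)[OF zw(2)] by (simp add: complex_eq_iff)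
      hence "of_real x powr (1 + \<i> * of_real (Im z - Im w)) = (of_real x powr z * of_real x powr cnj w :: complex)"
        by (metis powr_add)
      thus "(a z * of_real x powr z) * cnj (a w * of_real x powr w) = a z * cnj (a w) * of_real x powr (1 + \<i> * of_real (Im z - Im w))"
        by (simp only: complex_cnj_mult cnj_of_real_powr[OF x0] mult_ac)
    qed
    finally show ?thesis by simp
  qed
  ultimately have "((\<lambda>x. complex_of_real ((norm (\<Sum>z\<in>W. of_nat (m z) * (of_real x powr z / z)))\<^sup>2)) has_integral Q) {1..X}"
    using has_integral_eq[of "{1..X}"] by (metis (no_types, lifting))
  from has_integral_linear[OF this bounded_linear_Re]
  have I: "((\<lambda>x. (norm (\<Sum>z\<in>W. of_nat (m z) * (of_real x powr z / z)))\<^sup>2) has_integral Re Q) {1..X}" by (simp add: o_def)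
  have "Re Q \<le> norm Q" by (rule complex_Re_le_cmod)
  also have "\<dots> \<le> (\<Sum>z\<in>W. \<Sum>w\<in>W. (real (m z) * (1 / norm z)) * (real (m w) * (1 / norm w)) * (4 * X\<^sup>2 / (1 + \<bar>Im z - Im w\<bar>)))"
    unfolding Q_def
  proof (rule order.trans[OF norm_sum sum_mono], rule order.trans[OF norm_sum sum_mono])
    fix z w assume zw: "z \<in> W" "w \<in> W"
    have "norm (a z * cnj (a w) * J (Im z - Im w)) = (real (m z) * (1 / norm z)) * (real (m w) * (1 / norm w)) * norm (J (Im z - Im w))"
      by (simp add: a_def norm_mult norm_divide)
    also have "\<dots> \<le> (real (m z) * (1 / norm z)) * (real (m w) * (1 / norm w)) * (4 * X\<^sup>2 / (1 + \<bar>Im z - Im w\<bar>))"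
      unfolding J_def by (intro mult_left_mono has_integral_powr_1_plus_imag(2) X) auto
    finally show "norm (a z * cnj (a w) * J (Im z - Im w)) \<le> (real (m z) * (1 / norm z)) * (real (m w) * (1 / norm w)) * (4 * X\<^sup>2 / (1 + \<bar>Im z - Im w\<bar>))" .
  qed
  also have "\<dots> \<le> (4 * X\<^sup>2 * D) * (\<Sum>z\<in>W. real (m z) * (1 / norm z)\<^sup>2)"
  proof (rule symmetric_double_sum_le[OF W(1)])
    fix z assume "z \<in> W"
    from mult_left_mono[OF D[OF this], of "4 * X\<^sup>2"]
    show "(\<Sum>w\<in>W. real (m w) * (4 * X\<^sup>2 / (1 + \<bar>Im z - Im w\<bar>))) \<le> 4 * X\<^sup>2 * D"
      by (simp add: sum_distrib_left mult_ac)
  qed (auto simp: abs_minus_commute)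
  also have "(\<Sum>z\<in>W. real (m z) * (1 / norm z)\<^sup>2) = (\<Sum>z\<in>W. real (m z) / (norm z)\<^sup>2)"
    by (simp add: power_divide)
  finally show ?thesis by (rule that[OF I])
qed

text \<open>Continuity makes the set compact, which settles its measurability.\<close>

lemma markov_inequality_interval:
  fixes f :: "real \<Rightarrow> real"
  assumes f: "continuous_on {a..b} f" "(f has_integral I) {a..b}" "\<And>x. x \<in> {a..b} \<Longrightarrow> f x \<ge> 0" and c: "c > 0"
  shows "{x\<in>{a..b}. f x \<ge> c} \<in> lmeasurable" "measure lebesgue {x\<in>{a..b}. f x \<ge> c} \<le> I / c"
proof -
  define B where "B = {x\<in>{a..b}. f x \<ge> c}"
  have "closed B" unfolding B_def by (intro continuous_on_closed_Collect_le continuous_on_const f) auto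
  moreover have "bounded B" by (rule bounded_subset[of "{a..b}"]) (auto simp: B_def)
  ultimately have "compact B" by (simp add: compact_eq_bounded_closed)
  hence B: "B \<in> lmeasurable" by (rule lmeasurable_compact)
  thus "{x\<in>{a..b}. f x \<ge> c} \<in> lmeasurable" by (simp add: B_def)
  have "(indicator B has_integral measure lebesgue B) UNIV" using B by (simp add: lmeasurable_iff_has_integral)
  hence "((\<lambda>x. c * indicator B x) has_integral c * measure lebesgue B) UNIV" by (rule has_integral_mult_right)
  moreover have "((\<lambda>x. if x \<in> {a..b} then f x else 0) has_integral I) UNIV"
    using f(2) by (subst has_integral_restrict_UNIV)
  ultimately have "c * measure lebesgue B \<le> I"
    by (rule has_integral_le) (use f(3) in \<open>auto simp: indicator_def B_def\<close>)
  thus "measure lebesgue {x\<in>{a..b}. f x \<ge> c} \<le> I / c" using c by (simp add: B_def field_simps)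
qed

section \<open>The exceptional set\<close>

text \<open>One factor 1 / |z| is traded for 1 / \<open>T\<^sub>0\<close>; the other is summed by
  the reciprocal sum and costs only logarithms.\<close>

lemma critical_zeros_tail_sum_le:
  assumes "T\<^sub>0 > 0"
  shows "(\<Sum>z | z \<in> critical_zeros T \<and> norm z \<ge> T\<^sub>0. real (zmult z) / (norm z)\<^sup>2) \<le>
    (\<Sum>z | z \<in> ball 0 (T + 1) \<and> zeta_entire z = 0. real (zmult z) / norm z) / T\<^sub>0"
proof -
  have "(\<Sum>z | z \<in> critical_zeros T \<and> norm z \<ge> T\<^sub>0. real (zmult z) / (norm z)\<^sup>2) \<le>
     (\<Sum>z | z \<in> critical_zeros T \<and> norm z \<ge> T\<^sub>0. (real (zmult z) / norm z) / T\<^sub>0)"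
  proof (rule sum_mono)
    fix z assume z: "z \<in> {z. z \<in> critical_zeros T \<and> norm z \<ge> T\<^sub>0}"
    have "(real (zmult z) / norm z) / norm z \<le> (real (zmult z) / norm z) / T\<^sub>0"
      using z assms by (intro divide_left_mono) (auto intro!: mult_pos_pos simp del: zero_less_norm_iff)
    thus "real (zmult z) / (norm z)\<^sup>2 \<le> (real (zmult z) / norm z) / T\<^sub>0" by (simp add: power2_eq_square)
  qed
  also have "\<dots> = (\<Sum>z | z \<in> critical_zeros T \<and> norm z \<ge> T\<^sub>0. real (zmult z) / norm z) / T\<^sub>0"
    by (rule sum_divide_distrib [symmetric])
  also have "\<dots> \<le> (\<Sum>z | z \<in> ball 0 (T + 1) \<and> zeta_entire z = 0. real (zmult z) / norm z) / T\<^sub>0"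
  proof (intro divide_right_mono sum_mono2)
    show "finite {z. z \<in> ball 0 (T + 1) \<and> zeta_entire z = 0}" using finite_zeta_zeros[of "ball 0 (T + 1)"] by simp
    show "{z. z \<in> critical_zeros T \<and> norm z \<ge> T\<^sub>0} \<subseteq> {z. z \<in> ball 0 (T + 1) \<and> zeta_entire z = 0}"
    proof safe
      fix z assume z: "z \<in> critical_zeros T"
      thus "zeta_entire z = 0" by (simp add: critical_zeros_def)
      show "z \<in> ball 0 (T + 1)" using z cmod_le[of z] by (simp add: critical_zeros_def)
    qed
  qed (use assms in auto)
  finally show ?thesis .
qed

lemma norm_zero_term: "x > 0 \<Longrightarrow> Re z = 1/2 \<Longrightarrow>
    norm (of_nat (m z) * (of_real x powr z / z) :: complex) = x powr (1/2) * (real (m z) / norm z)"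
  by (simp only: norm_mult norm_divide norm_of_nat norm_powr_of_real) simp

text \<open>No cancellation between low zeros is exploited, so the leading constant of the
  reciprocal sum is compared with \<epsilon> directly.\<close>

lemma low_zero_sum_bound:
  assumes x: "x > 0"
  shows "norm (\<Sum>z | z \<in> critical_zeros T \<and> norm z < T\<^sub>0. zero_term x z :: complex)
     \<le> x powr (1/2) * (\<Sum>z | z \<in> ball 0 T\<^sub>0 \<and> zeta_entire z = 0. real (zmult z) / norm z)"
proof -
  have "norm (\<Sum>z | z \<in> critical_zeros T \<and> norm z < T\<^sub>0. zero_term x z :: complex)
     \<le> (\<Sum>z | z \<in> critical_zeros T \<and> norm z < T\<^sub>0. x powr (1/2) * (real (zmult z) / norm z))"
  proof (rule order.trans[OF norm_sum sum_mono])
    fix z assume "z \<in> {z. z \<in> critical_zeros T \<and> norm z < T\<^sub>0}"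
    hence "Re z = 1/2" by (simp add: critical_zeros_def)
    thus "norm (zero_term x z :: complex) \<le> x powr (1/2) * (real (zmult z) / norm z)"
      by (rule eq_refl[OF norm_zero_term[OF x]])
  qed
  also have "\<dots> = x powr (1/2) * (\<Sum>z | z \<in> critical_zeros T \<and> norm z < T\<^sub>0. real (zmult z) / norm z)"
    by (rule sum_distrib_left [symmetric])
  also have "\<dots> \<le> x powr (1/2) * (\<Sum>z | z \<in> ball 0 T\<^sub>0 \<and> zeta_entire z = 0. real (zmult z) / norm z)"
  proof (intro mult_left_mono sum_mono2)
    show "finite {z. z \<in> ball 0 T\<^sub>0 \<and> zeta_entire z = 0}" using finite_zeta_zeros[of "ball 0 T\<^sub>0"] by simp
  qed (auto simp: critical_zeros_def)
  finally show ?thesis .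
qed

text \<open>These neighbourhoods are discarded because the error in the explicit formula has the
  factor 1/d. Finitely many suffice: every integer beyond \<lceil>X\<rceil> is at distance at least
  1 from x <= X.\<close>

lemma near_integers_measure:
  fixes X d :: real
  assumes X: "X \<ge> 1" and d: "0 < d" "d \<le> 1"
  defines "A \<equiv> (\<Union>n\<in>{..nat \<lceil>X\<rceil>}. {real n - d..real n + d})"
  shows "A \<in> sets lebesgue" "measure lebesgue A \<le> (X + 2) * (2 * d)"
    and "\<And>x n. x \<le> X \<Longrightarrow> x \<notin> A \<Longrightarrow> \<bar>x - real n\<bar> \<ge> d"
proof -
  show "A \<in> sets lebesgue" unfolding A_def by (intro sets.finite_UN) auto
  have "measure lebesgue A \<le> (\<Sum>n\<in>{..nat \<lceil>X\<rceil>}. measure lebesgue {real n - d..real n + d})"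
    unfolding A_def by (rule measure_UNION_le) auto
  also have "\<dots> = (\<Sum>n\<in>{..nat \<lceil>X\<rceil>}. 2 * d)"
    using d by (intro sum.cong) (auto simp: measure_completion)
  also have "\<dots> = (real (nat \<lceil>X\<rceil>) + 1) * (2 * d)" by simp
  also have "\<dots> \<le> (X + 2) * (2 * d)" using X d by (intro mult_right_mono) linarith+
  finally show "measure lebesgue A \<le> (X + 2) * (2 * d)" .
  fix x n assume x: "x \<le> X" "x \<notin> A"
  show "\<bar>x - real n\<bar> \<ge> d"
  proof (cases "n \<le> nat \<lceil>X\<rceil>")
    case True
    hence "x \<notin> {real n - d..real n + d}" using x(2) unfolding A_def by blast
    thus ?thesis by auto
  next
    case False
    hence "real n \<ge> X + 1" using X by linarith
    thus ?thesis using x(1) d by linarith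
  qed
qed

theorem mainTheorem2:
  assumes "riemann_hypothesis"
  shows "\<exists>c\<^sub>0 > (0::real).
    \<forall>\<epsilon>::real. 0 < \<epsilon> \<and> \<epsilon> < c\<^sub>0 \<longrightarrow>
    (\<forall>c'::real. c' < sqrt (2 * pi) \<longrightarrow>
      (\<exists>K::real. \<forall>\<^sub>F X::real in at_top.
        measure lebesgue {x. 0 < x \<and> x \<le> X \<and>
            \<bar>chebyshev_psi x - x\<bar> \<ge> \<epsilon> * X powr (1 / 2) * (ln X)\<^sup>2}
          \<le> K * X powr (1 - c' * \<epsilon> powr (1 / 2))))"
proof -
  note RH = assms
  define S where "S = (\<lambda>\<epsilon> X. {x. 0 < x \<and> x \<le> X \<and> \<bar>chebyshev_psi x - x\<bar> \<ge> \<epsilon> * X powr (1 / 2) * (ln X)\<^sup>2})"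
  obtain C3 where C3: "C3 > 0" "\<forall>N\<ge>2. \<exists>T. N \<le> T \<and> T \<le> N + 1 \<and> (\<forall>x d. 1 \<le> x \<longrightarrow> d > 0 \<longrightarrow> (\<forall>n::nat. \<bar>x - real n\<bar> \<ge> d) \<longrightarrow>
     norm (of_real (chebyshev_psi x) - (of_real x - zero_sum T x))
       \<le> C3 * (x ^ 4 / (T * d) + x ^ 3 * (ln (N + 6))\<^sup>2 / T + x powr (2/5) * (ln (N + 6))\<^sup>2))"
    using explicit_formula[OF RH] by (elim exE conjE) (rule that)
  obtain C4 where C4': "C4 > 0" "\<forall>T\<ge>2.
    (\<Sum>z | z \<in> ball 0 T \<and> zeta_entire z = 0. real (zmult z) / norm z) \<le> (ln T)\<^sup>2 / (2 * pi) + C4 * (1 + ln T)"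
    using zeta_zeros_reciprocal_sum[OF RH] by (elim exE conjE) (rule that)
  note C4 = C4'(1) C4'(2)[rule_format]
  obtain C5 where C5: "C5 > 0" "\<forall>T\<ge>2. \<forall>u. \<bar>u\<bar> \<le> T \<longrightarrow>
    (\<Sum>z\<in>critical_zeros T. real (zmult z) / (1 + \<bar>Im z - u\<bar>)) \<le> C5 * (ln (T + 6))\<^sup>2"
    using critical_zeros_kernel_sum[OF RH] by (elim exE conjE) (rule that)
  \<comment> \<open>\<delta> is the split exponent and \<kappa> the exponent to be saved. The strict
    \<kappa> < \<delta> leaves a power X^(\<delta> - \<kappa>) that absorbs all logarithms, hence
    the constant 1.\<close>
  have key: "\<forall>\<^sub>F X in at_top. measure lebesgue (S \<epsilon> X) \<le> 1 * X powr (1 - \<kappa>)"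
    if \<epsilon>: "0 < \<epsilon>" and \<delta>: "0 < \<delta>" "\<delta>\<^sup>2 / (2 * pi) < \<epsilon>" and \<kappa>: "\<kappa> < \<delta>" "\<kappa> < 1" for \<epsilon> \<delta> \<kappa> :: real
  proof -
    define \<eta> where "\<eta> = \<epsilon> - \<delta>\<^sup>2 / (2 * pi)"
    have \<eta>: "\<eta> > 0" using \<delta> by (simp add: \<eta>_def)
    define p where "p = 1 - \<kappa>"
    define q where "q = \<delta> - \<kappa>"
    have pq: "p > 0" "q > 0" using \<kappa> by (auto simp: p_def q_def)
    \<comment> \<open>With height X^10 and distance X^(-4) the three errors are of order X^(-2),
      X^(-7) and X^(2/5) up to logarithms, all negligible against sqrt X.\<close>
    define err where "err = (\<lambda>X::real. C3 * (X ^ 4 / (X ^ 10 * (1 / X ^ 4)) + X ^ 3 * (ln (X ^ 10 + 6))\<^sup>2 / X ^ 10 + X powr (2/5) * (ln (X ^ 10 + 6))\<^sup>2))"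
    define G where "G = (\<lambda>X::real. 4 * (C5 * (ln (X ^ 10 + 7))\<^sup>2) * ((ln (X ^ 10 + 2))\<^sup>2 / (2 * pi) + C4 * (1 + ln (X ^ 10 + 2))))"
    have ev1: "\<forall>\<^sub>F X in at_top. X powr (1/2) * (C4 * (1 + \<delta> * ln X)) + err X + X powr (1/2) \<le> \<eta> * X powr (1/2) * (ln X)\<^sup>2"
      unfolding err_def using \<eta> \<delta>(1) C4(1) C3(1) by real_asymp
    have ev2: "\<forall>\<^sub>F X in at_top. X powr \<delta> \<ge> 2" using \<delta>(1) by real_asymp
    \<comment> \<open>The summand 1 is the measure of {0..1}, which is simply discarded; absorbing
      it takes p > 0, that is \<kappa> < 1.\<close>
    have ev3: "\<forall>\<^sub>F X in at_top. 1 + (X + 2) * (2 * (1 / X ^ 4)) \<le> X powr p / 2" using pq by real_asymp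
    have ev4: "\<forall>\<^sub>F X in at_top. G X \<le> X powr q / 2" unfolding G_def using pq C4(1) C5(1) by real_asymp
    show ?thesis
      using ev1 ev2 ev3 ev4 eventually_ge_at_top[of 2]
    proof eventually_elim
      case (elim X)
      define N where "N = X ^ 10"
      have X: "X \<ge> 2" "X \<ge> 1" "X > 0" using elim by auto
      have N: "N \<ge> 2" using X one_le_power[of X 9] mult_mono[of 2 X 1 "X ^ 9"] by (simp add: N_def power_Suc[symmetric] eval_nat_numeral)
      obtain T where T: "N \<le> T" "T \<le> N + 1" "\<And>x d. 1 \<le> x \<Longrightarrow> d > 0 \<Longrightarrow> \<forall>n::nat. \<bar>x - real n\<bar> \<ge> d \<Longrightarrow>
         norm (of_real (chebyshev_psi x) - (of_real x - zero_sum T x))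
         \<le> C3 * (x ^ 4 / (T * d) + x ^ 3 * (ln (N + 6))\<^sup>2 / T + x powr (2/5) * (ln (N + 6))\<^sup>2)"
        using C3(2) N by meson
      have T2: "T \<ge> 2" using T N by auto
      define T\<^sub>0 where "T\<^sub>0 = X powr \<delta>"
      have T\<^sub>0: "T\<^sub>0 \<ge> 2" "T\<^sub>0 > 0" "ln T\<^sub>0 = \<delta> * ln X" using elim X by (auto simp: T\<^sub>0_def ln_powr)
      define W where "W = {z. z \<in> critical_zeros T \<and> norm z \<ge> T\<^sub>0}"
      define V where "V = {z. z \<in> critical_zeros T \<and> norm z < T\<^sub>0}"
      have W: "finite W" "\<And>z. z \<in> W \<Longrightarrow> Re z = 1/2" by (auto simp: W_def critical_zeros_def intro: finite_subset[OF _ finite_critical_zeros[of T]])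
      have V: "finite V" by (rule finite_subset[OF _ finite_critical_zeros[of T]]) (auto simp: V_def)
      define D where "D = C5 * (ln (X ^ 10 + 7))\<^sup>2"
      have WD: "(\<Sum>w\<in>W. real (zmult w) / (1 + \<bar>Im z - Im w\<bar>)) \<le> D" if z: "z \<in> W" for z
      proof -
        have "(\<Sum>w\<in>W. real (zmult w) / (1 + \<bar>Im z - Im w\<bar>)) \<le> (\<Sum>w\<in>critical_zeros T. real (zmult w) / (1 + \<bar>Im w - Im z\<bar>))"
          unfolding abs_minus_commute[of "Im z"] by (intro sum_mono2) (auto simp: W_def)
        also have "\<dots> \<le> C5 * (ln (T + 6))\<^sup>2"
          using C5(2) T2 z by (auto simp: W_def critical_zeros_def)
        also have "\<dots> \<le> D" unfolding D_def using T T2 C5(1)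
          by (intro mult_left_mono power_mono) (auto simp: N_def)
        finally show ?thesis .
      qed
      obtain I where I: "((\<lambda>x. (norm (\<Sum>z\<in>W. zero_term x z))\<^sup>2) has_integral I) {1..X}"
        "I \<le> 4 * X\<^sup>2 * D * (\<Sum>z\<in>W. real (zmult z) / (norm z)\<^sup>2)"
        by (rule mean_square_zero_sum[OF W X(2) WD])
      \<comment> \<open>A threshold X for the square means sqrt X for the sum, which fits into the
        slack \<eta> sqrt X (ln X)^2. Dividing the mean square, X^(2 - \<delta>) up to logarithms,
        by X gives the measure.\<close>
      define B where "B = {x\<in>{1..X}. (norm (\<Sum>z\<in>W. zero_term x z))\<^sup>2 \<ge> X}"
      have cont: "continuous_on {1..X} (\<lambda>x. (norm (\<Sum>z\<in>W. zero_term x z))\<^sup>2)"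
        using W(2)[of 0] by (intro continuous_intros) (auto simp: complex_nonpos_Reals_iff)
      note B = markov_inequality_interval[OF cont I(1) _ X(3), folded B_def]
      have BI: "measure lebesgue B \<le> X * X powr (- \<delta>) * G X"
      proof -
        have D0: "D \<ge> 0" using C5(1) by (simp add: D_def)
        define H where "H = (ln (X ^ 10 + 2))\<^sup>2 / (2 * pi) + C4 * (1 + ln (X ^ 10 + 2))"
        have GX: "G X = 4 * D * H" by (simp only: G_def D_def H_def)
        have "(\<Sum>z\<in>W. real (zmult z) / (norm z)\<^sup>2) \<le> (\<Sum>z | z \<in> ball 0 (T + 1) \<and> zeta_entire z = 0. real (zmult z) / norm z) / T\<^sub>0"
          unfolding W_def by (rule critical_zeros_tail_sum_le[OF T\<^sub>0(2)])
        also have "\<dots> \<le> ((ln (T + 1))\<^sup>2 / (2 * pi) + C4 * (1 + ln (T + 1))) / T\<^sub>0"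
          using T2 T\<^sub>0 by (intro divide_right_mono C4) auto
        also have "\<dots> \<le> H / T\<^sub>0"
          unfolding H_def using T T2 T\<^sub>0 C4(1) by (intro divide_right_mono add_mono mult_left_mono power_mono) (auto simp: N_def)
        finally have "I \<le> 4 * X\<^sup>2 * D * (H / T\<^sub>0)"
          using D0 by (intro order.trans[OF I(2)] mult_left_mono) auto
        also have "\<dots> = X\<^sup>2 * X powr (-\<delta>) * G X" by (simp add: GX T\<^sub>0_def powr_minus divide_inverse mult_ac)
        finally have "I / X \<le> X\<^sup>2 * X powr (-\<delta>) * G X / X" using X by (intro divide_right_mono) auto
        also have "\<dots> = X * X powr (-\<delta>) * G X" using X by (simp add: power2_eq_square)
        finally show ?thesis using B(2) by auto
      qed
      define d where "d = 1 / X ^ 4"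
      have d: "0 < d" "d \<le> 1" using X one_le_power[OF X(2), of 4] by (auto simp: d_def)
      define A where "A = (\<Union>n\<in>{..nat \<lceil>X\<rceil>}. {real n - d..real n + d})"
      note A = near_integers_measure[OF X(2) d, folded A_def]
      have sub: "S \<epsilon> X \<subseteq> {0..1} \<union> A \<union> B"
      proof
        fix x assume "x \<in> S \<epsilon> X"
        hence x: "0 < x" "x \<le> X" "\<bar>chebyshev_psi x - x\<bar> \<ge> \<epsilon> * X powr (1 / 2) * (ln X)\<^sup>2" by (auto simp: S_def)
        show "x \<in> {0..1} \<union> A \<union> B"
        proof (rule ccontr)
          assume nx: "x \<notin> {0..1} \<union> A \<union> B"
          hence x1: "x \<ge> 1" using x by auto
          define ZW where "ZW = (\<Sum>z\<in>W. zero_term x z)"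
          define ZV where "ZV = (\<Sum>z\<in>V. zero_term x z)"
          have "critical_zeros T = W \<union> V" "W \<inter> V = {}" by (auto simp: W_def V_def)
          hence ZZ: "zero_sum T x = ZW + ZV"
            using W(1) V by (simp add: ZW_def ZV_def sum.union_disjoint)
          have "norm (of_real (chebyshev_psi x) - (of_real x - (ZW + ZV))) \<le>
             C3 * (x ^ 4 / (T * d) + x ^ 3 * (ln (N + 6))\<^sup>2 / T + x powr (2/5) * (ln (N + 6))\<^sup>2)"
            unfolding ZZ[symmetric] using nx A(3) x by (intro T(3) x1 d) auto
          also have "\<dots> \<le> err X"
            unfolding err_def d_def N_def[symmetric] using x x1 T N X C3(1)
            by (intro mult_left_mono add_mono frac_le mult_right_mono power_mono powr_mono2 mult_pos_pos mult_nonneg_nonneg) auto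
          finally have 1: "norm (of_real (chebyshev_psi x) - (of_real x - (ZW + ZV))) \<le> err X" .
          have "norm ZV \<le> x powr (1/2) * (\<Sum>z | z \<in> ball 0 T\<^sub>0 \<and> zeta_entire z = 0. real (zmult z) / norm z)"
            unfolding ZV_def V_def by (rule low_zero_sum_bound[OF x(1)])
          also have "\<dots> \<le> X powr (1/2) * ((ln T\<^sub>0)\<^sup>2 / (2 * pi) + C4 * (1 + ln T\<^sub>0))"
            using x T\<^sub>0 by (intro mult_mono C4 powr_mono2 sum_nonneg) auto
          also have "\<dots> = X powr (1/2) * (\<delta>\<^sup>2 / (2 * pi)) * (ln X)\<^sup>2 + X powr (1/2) * (C4 * (1 + \<delta> * ln X))"
            unfolding T\<^sub>0(3) by (simp add: power_mult_distrib algebra_simps)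
          finally have 2: "norm ZV \<le> X powr (1/2) * (\<delta>\<^sup>2 / (2 * pi)) * (ln X)\<^sup>2 + X powr (1/2) * (C4 * (1 + \<delta> * ln X))" .
          have 3: "norm ZW < X powr (1/2)"
          proof -
            have "(norm ZW)\<^sup>2 < X" using nx x x1 by (auto simp: B_def ZW_def)
            also have "X = (X powr (1/2))\<^sup>2" using X by (simp add: powr_half_sqrt)
            finally show ?thesis by (rule power2_less_imp_less) auto
          qed
          have "complex_of_real (chebyshev_psi x - x) = (of_real (chebyshev_psi x) - (of_real x - (ZW + ZV))) - ZW - ZV" by simp
          hence "\<bar>chebyshev_psi x - x\<bar> = norm ((of_real (chebyshev_psi x) - (of_real x - (ZW + ZV))) - ZW - ZV)"
            by (metis norm_of_real)
          also have "\<dots> \<le> norm (of_real (chebyshev_psi x) - (of_real x - (ZW + ZV))) + norm ZW + norm ZV"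
            by (rule order.trans[OF norm_triangle_ineq4 add_right_mono[OF norm_triangle_ineq4]])
          also have "\<dots> < err X + X powr (1/2) + (X powr (1/2) * (\<delta>\<^sup>2 / (2 * pi)) * (ln X)\<^sup>2 + X powr (1/2) * (C4 * (1 + \<delta> * ln X)))"
            using 1 2 3 by linarith
          also have "\<dots> \<le> X powr (1/2) * (\<delta>\<^sup>2 / (2 * pi)) * (ln X)\<^sup>2 + \<eta> * X powr (1/2) * (ln X)\<^sup>2"
            using elim(1) by linarith
          also have "\<dots> = \<epsilon> * X powr (1/2) * (ln X)\<^sup>2" by (simp add: \<eta>_def algebra_simps)
          finally show False using x(3) by linarith
        qed
      qed
      show "measure lebesgue (S \<epsilon> X) \<le> 1 * X powr (1 - \<kappa>)"
      \<comment> \<open>\<open>measure\<close> is 0 on sets outside the \<sigma>-algebra, so the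
        bound is immediate in the first case and measurability of \<open>S \<epsilon> X\<close> need
        not be established.\<close>
      proof (cases "S \<epsilon> X \<in> sets lebesgue")
        case False
        thus ?thesis by (simp add: measure_notin_sets)
      next
        case True
        have Bs: "B \<in> sets lebesgue" using B(1) by auto
        have "bounded ({0..1} \<union> A \<union> B)" unfolding A_def B_def
          by (intro bounded_Un[THEN iffD2] conjI bounded_UN ballI finite_atMost bounded_closed_interval bounded_subset[of "{1..X}"]) auto
        hence "{0..1} \<union> A \<union> B \<in> lmeasurable" by (intro bounded_set_imp_lmeasurable sets.Un A(1) Bs) auto
        hence "measure lebesgue (S \<epsilon> X) \<le> measure lebesgue ({0..1} \<union> A \<union> B)"
          by (intro measure_mono_fmeasurable sub True)
        also have "\<dots> \<le> measure lebesgue ({0..1} \<union> A) + measure lebesgue B"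
          using A(1) Bs by (intro measure_Un_le) auto
        also have "measure lebesgue ({0..1} \<union> A) \<le> measure lebesgue {0..1::real} + measure lebesgue A"
          using A(1) by (intro measure_Un_le) auto
        also have "measure lebesgue {0..1::real} = 1" by (simp add: measure_completion)
        also have "1 + measure lebesgue A + measure lebesgue B \<le> 1 + (X + 2) * (2 * d) + X * X powr (- \<delta>) * G X"
          using A(2) BI by linarith
        also have "\<dots> \<le> X powr p / 2 + X * X powr (- \<delta>) * (X powr q / 2)"
          using elim(3,4) X unfolding d_def by (intro add_mono mult_left_mono) auto
        also have "X * X powr (- \<delta>) * (X powr q / 2) = X powr p / 2"
        proof -
          have "X * X powr (- \<delta>) * X powr q = X powr (1 + (- \<delta>) + q)" using X by (simp only: powr_add powr_one)
          also have "1 + (- \<delta>) + q = p" by (simp add: p_def q_def)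
          finally show ?thesis by simp
        qed
        finally show ?thesis by (simp add: p_def)
      qed
    qed
  qed
  have main: "\<exists>K::real. \<forall>\<^sub>F X in at_top. measure lebesgue (S \<epsilon> X) \<le> K * X powr (1 - c' * \<epsilon> powr (1/2))"
    if \<epsilon>: "0 < \<epsilon>" "\<epsilon> < 1/10" and c': "c' < sqrt (2 * pi)" for \<epsilon> c'
  proof -
    define \<delta>\<^sub>0 where "\<delta>\<^sub>0 = sqrt (2 * pi * \<epsilon>)"
    define \<kappa> where "\<kappa> = c' * \<epsilon> powr (1/2)"
    have "\<kappa> < sqrt (2 * pi) * sqrt \<epsilon>"
      unfolding \<kappa>_def using \<epsilon> c' by (simp add: powr_half_sqrt)
    hence \<kappa>\<delta>: "\<kappa> < \<delta>\<^sub>0" by (simp add: \<delta>\<^sub>0_def real_sqrt_mult)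
    have \<delta>\<^sub>0: "\<delta>\<^sub>0 > 0" using \<epsilon> by (simp add: \<delta>\<^sub>0_def)
    \<comment> \<open>The choice of 1/10: it forces 2 pi \<epsilon> < 1, hence
      \<open>\<delta>\<^sub>0\<close> < 1, and so the condition \<kappa> < 1 of
      \<open>key\<close>.\<close>
    have "2 * pi * \<epsilon> < 8 * (1/10)"
      using pi_less_4 \<epsilon> by (intro mult_strict_mono) auto
    hence "\<delta>\<^sub>0 < sqrt 1" unfolding \<delta>\<^sub>0_def by (subst real_sqrt_less_iff) simp
    hence \<delta>1: "\<delta>\<^sub>0 < 1" by simp
    \<comment> \<open>The midpoint lies strictly between \<kappa> and
      \<open>\<delta>\<^sub>0\<close>; the maximum with 0 keeps \<delta> positive when c' is
      negative.\<close>
    define \<delta> where "\<delta> = (max \<kappa> 0 + \<delta>\<^sub>0) / 2"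
    have \<delta>: "0 < \<delta>" "\<kappa> < \<delta>" "\<delta> < \<delta>\<^sub>0" using \<kappa>\<delta> \<delta>\<^sub>0 by (auto simp: \<delta>_def max_def)
    have "\<delta>\<^sup>2 < \<delta>\<^sub>0\<^sup>2" using \<delta> by (intro power_strict_mono) auto
    hence "\<delta>\<^sup>2 / (2 * pi) < \<epsilon>" using \<epsilon> by (simp add: \<delta>\<^sub>0_def field_simps)
    from key[OF \<epsilon>(1) \<delta>(1) this \<delta>(2)] show ?thesis
      using \<kappa>\<delta> \<delta>1 unfolding \<kappa>_def by (intro exI[of _ 1]) auto
  qed
  show ?thesis
  proof (rule exI[of _ "1/10"], intro conjI allI impI)
    fix \<epsilon> c' :: real
    assume "0 < \<epsilon> \<and> \<epsilon> < 1/10" "c' < sqrt (2 * pi)"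
    thus "\<exists>K::real. \<forall>\<^sub>F X::real in at_top.
        measure lebesgue {x. 0 < x \<and> x \<le> X \<and>
            \<bar>chebyshev_psi x - x\<bar> \<ge> \<epsilon> * X powr (1 / 2) * (ln X)\<^sup>2}
          \<le> K * X powr (1 - c' * \<epsilon> powr (1 / 2))"
      using main[unfolded S_def, of \<epsilon> c'] by blast
  qed simp
qed

end
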